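(* Let $\mathbb{H}=\{(z_1,z_2)\in\mathbb{C}^2:|z_1|<|z_2|<1\}$ be the Hartogs triangle, let $1\le p<\infty$, and let $\alpha=\alpha_1\,d\bar z_1+\alpha_2\,d\bar z_2$ be a $(0,1)$-form that is $\bar\partial$-closed in the weak sense on $\mathbb{H}$. Assume that (1) $\alpha_1,\alpha_2\in L^p_{-2}(\mathbb{H})$, (2) $\partial \alpha_2/\partial \bar z_1=\partial \alpha_1/\partial \bar z_2\in L^p_{-1}(\mathbb{H})$ and $\partial \alpha_1/\partial \bar z_1\in L^p_{-1}(\mathbb{H})$. Let $\phi:\mathbb{H}\to\mathbb{D}\times\mathbb{D}^*$ be the biholomorphism $\phi(z_1,z_2)=(z_1/z_2,z_2)=(w_1,w_2)$, let $\tilde\alpha_j=\alpha_j\circ\phi^{-1}$ for $j=1,2$, and let $f=f_1\,d\bar w_1+f_2\,d\bar w_2$ be the form on $\mathbb{D}\times\mathbb{D}^*$ with $f_1=\bar w_2\,\tilde\alpha_1$ and $f_2=\bar w_1\,\tilde\alpha_1+\tilde\alpha_2$. Then $v=T(f)\circ\phi$, with $T$ the integral operator on $\mathbb{D}\times\mathbb{D}^*$ given in the context, is a weak solution of $\bar\partial v=\alpha$ on $\mathbb{H}$ satisfying the $L^p$ estimate $$ \|v\|_{L^p(\mathbb{H})}\le C\left(\sum_{j=1}^2\|\alpha_j\|_{L^p_{-2}(\mathbb{H})}+\sum_{j=1}^2\left\|\frac{\partial \alpha_1}{\partial \bar z_j}\right\|_{L^p_{-1}(\mathbb{H})}\right)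 $$ for some constant $C>0$ independent of $\alpha$.
   Context: $\mathbb{D}=\{z\in\mathbb{C}:|z|<1\}$, $\mathbb{D}^*=\{z\in\mathbb{C}:0<|z|<1\}$. For real $s$, $\|g\|^p_{L^p_{s}(\mathbb{H})}=\int_{\mathbb{H}}|g|^p|z_2|^{s}\,dV(z)$, with $dV$ Lebesgue measure, and $g\in L^p_s(\mathbb{H})$ means this is finite (used with $s=-2$ and $s=-1$). Derivatives of the $\alpha_j$ are distributional; weakly $\bar\partial$-closed means $\frac{\partial\alpha_1}{\partial\bar z_2}=\frac{\partial\alpha_2}{\partial\bar z_1}$ as distributions, and a weak solution of $\bar\partial v=\alpha$ satisfies $\frac{\partial v}{\partial\bar z_j}=\alpha_j$ as distributions, $j=1,2$. The operator $T$ on $(0,1)$-forms $f=f_1\,d\bar w_1+f_2\,d\bar w_2$ on $\mathbb{D}\times\mathbb{D}^*$ is $$ \begin{aligned} T(f)(w_1,w_2) &=\frac{-1}{2 \pi i}\int_{\mathbb{D}^*}\frac{f_2(w_1,\zeta_2)}{\zeta_2-w_2}\,d\bar \zeta_2\wedge d\zeta_2+\frac{-1}{2 \pi i}\int_{\mathbb{D}}\frac{f_1(\zeta_1,w_2)}{\zeta_1-w_1}\,d\bar \zeta_1\wedge d\zeta_1\\ &\quad+\frac{-1}{(2 \pi i)^2}\int_{\mathbb{D}\times\mathbb{D}^*}\frac{(\mathscr{D}f)(\zeta_1,\zeta_2)}{(\zeta_1-w_1)(\zeta_2-w_2)}\,d\bar \zeta_1\wedge d\zeta_1\wedge d\bar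 \zeta_2\wedge d\zeta_2, \end{aligned} $$ where $\mathscr{D} f= \frac 12\left( \frac{\partial f_1}{\partial\bar w_2} + \frac{\partial f_2}{\partial\bar w_1}\right)$ in the distributional sense, and $d\bar\zeta\wedge d\zeta=2i\,dA(\zeta)$ in one complex variable. *)

theory Defs
  imports "HOL-Analysis.Analysis"
begin

section \<open>Test functions and distributions on open subsets of complex 2-space\<close>

type_synonym cfun2 = "complex \<times> complex \<Rightarrow> complex"

text \<open>\<open>C_k k f\<close>: all iterated directional derivatives of order at most \<open>k\<close> exist and are
  continuous (each derivative below the top order is Frechet differentiable, hence continuous).\<close>

primrec C_k :: "nat \<Rightarrow> ('a::real_normed_vector \<Rightarrow> 'b::real_normed_vector) \<Rightarrow> bool" where
  "C_k 0 f \<longleftrightarrow> continuous_on UNIV f"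
| "C_k (Suc k) f \<longleftrightarrow>
     (\<forall>x. f differentiable (at x)) \<and> (\<forall>v. C_k k (\<lambda>x. frechet_derivative f (at x) v))"

definition smooth :: "('a::real_normed_vector \<Rightarrow> 'b::real_normed_vector) \<Rightarrow> bool" where
  "smooth f \<longleftrightarrow> (\<forall>k. C_k k f)"

definition test_functions :: "(complex \<times> complex) set \<Rightarrow> cfun2 set" where
  "test_functions \<Omega> =
     {\<psi>. smooth \<psi> \<and> compact (closure {z. \<psi> z \<noteq> 0}) \<and> closure {z. \<psi> z \<noteq> 0} \<subseteq> \<Omega>}"

definition coord_axis :: "nat \<Rightarrow> complex \<Rightarrow> complex \<times> complex" where
  "coord_axis j c = (if j = 1 then (c, 0) else (0, c))"

text \<open>The classical Wirtinger derivative with respect to the conjugate of the \<open>j\<close>-th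
  variable, \<open>1/2 (\<partial>/\<partial>x\<^sub>j + \<i> \<partial>/\<partial>y\<^sub>j)\<close>, for \<open>j = 1, 2\<close>.\<close>

definition wirtinger_bar :: "nat \<Rightarrow> cfun2 \<Rightarrow> cfun2" where
  "wirtinger_bar j \<psi> z =
     (frechet_derivative \<psi> (at z) (coord_axis j 1)
        + \<i> * frechet_derivative \<psi> (at z) (coord_axis j \<i>)) / 2"

definition locally_integrable :: "(complex \<times> complex) set \<Rightarrow> cfun2 \<Rightarrow> bool" where
  "locally_integrable \<Omega> u \<longleftrightarrow> (\<forall>K. compact K \<and> K \<subseteq> \<Omega> \<longrightarrow> set_integrable lebesgue K u)"

text \<open>Distributions are represented by functionals on functions, of which only the values on
  \<open>test_functions \<Omega>\<close> matter. \<open>distr_of \<Omega> u\<close> is meaningful for locally integrable \<open>u\<close>.\<close>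

definition distr_of :: "(complex \<times> complex) set \<Rightarrow> cfun2 \<Rightarrow> cfun2 \<Rightarrow> complex" where
  "distr_of \<Omega> u \<psi> = (LINT z:\<Omega>|lebesgue. u z * \<psi> z)"

definition distr_dbar :: "nat \<Rightarrow> (cfun2 \<Rightarrow> complex) \<Rightarrow> cfun2 \<Rightarrow> complex" where
  "distr_dbar j S \<psi> = - S (wirtinger_bar j \<psi>)"

definition distr_eq ::
    "(complex \<times> complex) set \<Rightarrow> (cfun2 \<Rightarrow> complex) \<Rightarrow> (cfun2 \<Rightarrow> complex) \<Rightarrow> bool" where
  "distr_eq \<Omega> S S' \<longleftrightarrow> (\<forall>\<psi>\<in>test_functions \<Omega>. S \<psi> = S' \<psi>)"

definition is_function ::
    "(complex \<times> complex) set \<Rightarrow> (cfun2 \<Rightarrow> complex) \<Rightarrow> cfun2 \<Rightarrow> bool" where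
  "is_function \<Omega> S g \<longleftrightarrow> locally_integrable \<Omega> g \<and> distr_eq \<Omega> S (distr_of \<Omega> g)"

definition weakly_dbar_closed :: "(complex \<times> complex) set \<Rightarrow> cfun2 \<Rightarrow> cfun2 \<Rightarrow> bool" where
  "weakly_dbar_closed \<Omega> \<alpha>1 \<alpha>2 \<longleftrightarrow>
     locally_integrable \<Omega> \<alpha>1 \<and> locally_integrable \<Omega> \<alpha>2 \<and>
     distr_eq \<Omega> (distr_dbar 2 (distr_of \<Omega> \<alpha>1)) (distr_dbar 1 (distr_of \<Omega> \<alpha>2))"

definition weak_dbar_solution ::
    "(complex \<times> complex) set \<Rightarrow> cfun2 \<Rightarrow> cfun2 \<Rightarrow> cfun2 \<Rightarrow> bool" where
  "weak_dbar_solution \<Omega> v \<alpha>1 \<alpha>2 \<longleftrightarrow>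
     locally_integrable \<Omega> v \<and>
     distr_eq \<Omega> (distr_dbar 1 (distr_of \<Omega> v)) (distr_of \<Omega> \<alpha>1) \<and>
     distr_eq \<Omega> (distr_dbar 2 (distr_of \<Omega> v)) (distr_of \<Omega> \<alpha>2)"

section \<open>The Hartogs triangle\<close>

definition hartogs :: "(complex \<times> complex) set" where
  "hartogs = {(z1, z2). cmod z1 < cmod z2 \<and> cmod z2 < 1}"

abbreviation disc :: "complex set" where
  "disc \<equiv> ball 0 1"

abbreviation punctured_disc :: "complex set" where
  "punctured_disc \<equiv> ball 0 1 - {0}"

definition hartogs_map :: "complex \<times> complex \<Rightarrow> complex \<times> complex" where
  "hartogs_map z = (fst z / snd z, snd z)"

lemma bij_betw_hartogs_map: "bij_betw hartogs_map hartogs (disc \<times> punctured_disc)"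
  by (rule bij_betw_byWitness[where f' = "\<lambda>w. (fst w * snd w, snd w)"])
    (auto simp: hartogs_def hartogs_map_def norm_divide norm_mult divide_simps)

definition hartogs_map_inv :: "complex \<times> complex \<Rightarrow> complex \<times> complex" where
  "hartogs_map_inv = the_inv_into hartogs hartogs_map"

definition weighted_Lp :: "real \<Rightarrow> real \<Rightarrow> cfun2 set" where
  "weighted_Lp p s =
     {g. set_borel_measurable lebesgue hartogs g \<and>
         set_integrable lebesgue hartogs (\<lambda>z. cmod (g z) powr p * cmod (snd z) powr s)}"

text \<open>The case \<open>s = 0\<close> is the unweighted norm, as \<open>z\<^sub>2 \<noteq> 0\<close> on the Hartogs triangle.\<close>

definition weighted_Lp_norm :: "real \<Rightarrow> real \<Rightarrow> cfun2 \<Rightarrow> real" where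
  "weighted_Lp_norm p s g =
     (LINT z:hartogs|lebesgue. cmod (g z) powr p * cmod (snd z) powr s) powr (1 / p)"

section \<open>The transported form and the integral operator\<close>

definition transport1 :: "cfun2 \<Rightarrow> cfun2" where
  "transport1 \<alpha>1 w = cnj (snd w) * (\<alpha>1 \<circ> hartogs_map_inv) w"

definition transport2 :: "cfun2 \<Rightarrow> cfun2 \<Rightarrow> cfun2" where
  "transport2 \<alpha>1 \<alpha>2 w =
     cnj (fst w) * (\<alpha>1 \<circ> hartogs_map_inv) w + (\<alpha>2 \<circ> hartogs_map_inv) w"

definition mixed_distr :: "cfun2 \<Rightarrow> cfun2 \<Rightarrow> cfun2 \<Rightarrow> complex" where
  "mixed_distr f1 f2 \<psi> =
     (1 / 2) * (distr_dbar 2 (distr_of (disc \<times> punctured_disc) f1) \<psi>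
              + distr_dbar 1 (distr_of (disc \<times> punctured_disc) f2) \<psi>)"

text \<open>A function representing \<open>mixed_distr f1 f2\<close>; it is unique up to a null set when it exists,
  so the choice does not affect the integral in which it occurs.\<close>

definition mixed_fun :: "cfun2 \<Rightarrow> cfun2 \<Rightarrow> cfun2" where
  "mixed_fun f1 f2 = (SOME g. is_function (disc \<times> punctured_disc) (mixed_distr f1 f2) g)"

text \<open>The factors \<open>2 * \<i>\<close> come from \<open>d\<zeta>-bar \<and> d\<zeta> = 2 \<i> dA(\<zeta>)\<close>, once per complex variable.\<close>

definition T_op :: "cfun2 \<Rightarrow> cfun2 \<Rightarrow> cfun2" where
  "T_op f1 f2 w =
     (- 1 / (2 * pi * \<i>)) *
       (LINT \<zeta>2:punctured_disc|lebesgue. f2 (fst w, \<zeta>2) / (\<zeta>2 - snd w) * (2 * \<i>))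
   + (- 1 / (2 * pi * \<i>)) *
       (LINT \<zeta>1:disc|lebesgue. f1 (\<zeta>1, snd w) / (\<zeta>1 - fst w) * (2 * \<i>))
   + (- 1 / (2 * pi * \<i>)\<^sup>2) *
       (LINT \<zeta>:disc \<times> punctured_disc|lebesgue.
          mixed_fun f1 f2 \<zeta> / ((fst \<zeta> - fst w) * (snd \<zeta> - snd w)) * ((2 * \<i>) * (2 * \<i>)))"

text \<open>The integrals in \<open>T_op\<close> are total in the logic (divergent ones are 0). The next two notions
  say that \<open>T_op\<close> is genuinely given by the formula: the mixed derivative is a function, and
  the three integrals converge absolutely at \<open>w\<close>.\<close>

definition mixed_is_function :: "cfun2 \<Rightarrow> cfun2 \<Rightarrow> bool" where
  "mixed_is_function f1 f2 \<longleftrightarrow>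
     (\<exists>g. is_function (disc \<times> punctured_disc) (mixed_distr f1 f2) g)"

definition T_converges_at :: "cfun2 \<Rightarrow> cfun2 \<Rightarrow> complex \<times> complex \<Rightarrow> bool" where
  "T_converges_at f1 f2 w \<longleftrightarrow>
     set_integrable lebesgue punctured_disc (\<lambda>\<zeta>2. f2 (fst w, \<zeta>2) / (\<zeta>2 - snd w)) \<and>
     set_integrable lebesgue disc (\<lambda>\<zeta>1. f1 (\<zeta>1, snd w) / (\<zeta>1 - fst w)) \<and>
     set_integrable lebesgue (disc \<times> punctured_disc)
       (\<lambda>\<zeta>. mixed_fun f1 f2 \<zeta> / ((fst \<zeta> - fst w) * (snd \<zeta> - snd w)))"

end

(*
  In the coordinates w = phi(z) the problem lives on the product of two discs, and the Jacobian
  |w_2|^2 turns the weights |z_2|^(-2) and |z_2|^(-1) into the statement that f_1, f_2 and the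
  mixed derivative h = d f_1 / d wbar_2 = d f_2 / d wbar_1 belong to unweighted L^p.  With S_j the
  solid Cauchy transform in the j-th variable, T f = S_1 f_1 + S_2 f_2 - S_1 S_2 h.  Since S_j
  inverts d/d wbar_j and commutes with the derivative in the other variable, both dbar-equations
  follow, and the L^p bound holds because the kernel 1/w is integrable on discs.

  The commutation needs no boundary regularity: to shift a test function along the j-th variable
  out of the domain it suffices to multiply by cutoffs depending on w_j alone, which d/d wbar_i
  does not see.
*)

theory Submission
  imports Defs
begin

section \<open>Smooth functions\<close>

text \<open>The mixed derivative is where the hypotheses on both derivatives of \<alpha>1 are spent.
  By the chain rule h = A1 + cnj w_1 (cnj w_2 \<beta>1) + cnj w_2 \<beta>2, where A1 is the
  transported \<alpha>1 and \<beta>1, \<beta>2 are its transported derivatives in zbar_1, zbar_2.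
  Each of them carries a factor cnj w_2, and the Jacobian leaves |w_2| of the weight |z_2|^(-1);
  since |w_2|^p <= |w_2| for p >= 1, this factor pays for the weaker weight. Weak equations are
  moved between the two domains by transporting test functions: the Jacobian w_2 cnj w_2 is split so
  that its holomorphic half goes into the test function, where barred derivatives do not see it. In
  the equation for d/d wbar_1 the derivative of S_2 f_2 is S_2 h, which the derivative of S_1 S_2 h
  cancels, so that only f_1 survives. The formula for T has slice integrals of functions known only
  up to null sets, and a function h that is merely chosen; so T is identified with convolutions
  almost everywhere, by Fubini and by uniqueness of the function representing a
  distribution.\<close>

lemma C_k_SucI:
  assumes "\<And>x. (f has_derivative f' x) (at x)" "\<And>v. C_k k (\<lambda>x. f' x v)"
  shows "C_k (Suc k) f"
proof -
  have "frechet_derivative f (at x) = f' x" for x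
    using frechet_derivative_at[OF assms(1)[of x]] by simp
  then show ?thesis using assms by (auto simp: differentiable_def)
qed

lemma C_k_Suc_has_derivative:
  "C_k (Suc k) f \<Longrightarrow> (f has_derivative frechet_derivative f (at x)) (at x)"
  using frechet_derivative_works[of f "at x"] by simp

text \<open>\<open>C_k\<close> at order \<open>Suc k\<close> mentions differentiability and the
  derivatives only, so the lower orders have to be recovered: the induction hypothesis is applied to
  every directional derivative, and at the bottom differentiability gives continuity.\<close>

lemma C_k_SucD: "C_k (Suc k) f \<Longrightarrow> C_k k f"
proof (induction k arbitrary: f)
  case 0
  then show ?case
    by (auto intro!: continuous_at_imp_continuous_on differentiable_imp_continuous_within)
next
  case (Suc k)
  from Suc.prems have "\<And>x. f differentiable (at x)"
    and "\<And>v. C_k (Suc k) (\<lambda>x. frechet_derivative f (at x) v)" by auto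
  with Suc.IH have "\<And>v. C_k k (\<lambda>x. frechet_derivative f (at x) v)" by blast
  with \<open>\<And>x. f differentiable (at x)\<close> show ?case by simp
qed

lemma C_k_continuous_on: "C_k k f \<Longrightarrow> continuous_on UNIV f"
proof (induction k)
  case (Suc k)
  from Suc.IH[OF C_k_SucD[OF Suc.prems]] show ?case .
qed simp

lemma C_k_const: "C_k k (\<lambda>x. c)"
proof (induction k arbitrary: c)
  case (Suc k)
  then show ?case by (intro C_k_SucI[where f' = "\<lambda>_ _. 0"]) auto
qed auto

lemma C_k_bounded_linear: "bounded_linear L \<Longrightarrow> C_k k L"
proof (cases k)
  case (Suc m)
  assume "bounded_linear L"
  then show ?thesis unfolding Suc
    by (intro C_k_SucI[where f' = "\<lambda>_. L"]) (auto intro: bounded_linear_imp_has_derivative C_k_const)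
qed (auto intro: linear_continuous_on)

lemma C_k_add: "C_k k f \<Longrightarrow> C_k k g \<Longrightarrow> C_k k (\<lambda>x. f x + g x)"
proof (induction k arbitrary: f g)
  case (Suc k)
  show ?case
    by (rule C_k_SucI[OF has_derivative_add[OF C_k_Suc_has_derivative[OF Suc.prems(1)]
           C_k_Suc_has_derivative[OF Suc.prems(2)]]])
      (use Suc in auto)
qed (auto intro: continuous_intros)

lemma C_k_linear_compose: "bounded_linear L \<Longrightarrow> C_k k f \<Longrightarrow> C_k k (\<lambda>x. L (f x))"
proof (induction k arbitrary: f)
  case 0
  then show ?case by (auto intro: bounded_linear.continuous_on)
next
  case (Suc k)
  show ?case
    by (rule C_k_SucI[OF bounded_linear.has_derivative[OF Suc.prems(1) C_k_Suc_has_derivative[OF Suc.prems(2)]]])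
      (use Suc in auto)
qed

lemma C_k_compose_affine: "bounded_linear L \<Longrightarrow> C_k k f \<Longrightarrow> C_k k (\<lambda>x. f (a + L x))"
proof (induction k arbitrary: f)
  case 0
  then show ?case
    using continuous_on_compose2[of UNIV f UNIV "\<lambda>x. a + L x"]
    by (simp add: continuous_on_add linear_continuous_on)
next
  case (Suc k)
  show ?case
  proof (rule C_k_SucI)
    show "((\<lambda>x. f (a + L x)) has_derivative (\<lambda>v. frechet_derivative f (at (a + L x)) (L v))) (at x)" for x
    proof -
      have "((\<lambda>x. a + L x) has_derivative L) (at x)"
        using has_derivative_add[OF has_derivative_const bounded_linear_imp_has_derivative[OF Suc.prems(1)]]
        by simp
      then show ?thesis
        using diff_chain_at[of "\<lambda>x. a + L x" L x f] C_k_Suc_has_derivative[OF Suc.prems(2)]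
        by (simp add: o_def)
    qed
    show "C_k k (\<lambda>x. frechet_derivative f (at (a + L x)) (L v))" for v
      using Suc.IH[OF Suc.prems(1), of "\<lambda>x. frechet_derivative f (at x) (L v)"] Suc.prems(2) by auto
  qed
qed

lemma C_k_mult:
  fixes f g :: "'a::real_normed_vector \<Rightarrow> 'b::real_normed_algebra"
  shows "C_k k f \<Longrightarrow> C_k k g \<Longrightarrow> C_k k (\<lambda>x. f x * g x)"
proof (induction k arbitrary: f g)
  case (Suc k)
  note lower = Suc.prems[THEN C_k_SucD]
  have "C_k k (\<lambda>x. frechet_derivative f (at x) v)" "C_k k (\<lambda>x. frechet_derivative g (at x) v)" for v
    using Suc.prems by simp_all
  note deriv = this
  show ?case
    by (rule C_k_SucI[OF has_derivative_mult[OF C_k_Suc_has_derivative[OF Suc.prems(1)]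
           C_k_Suc_has_derivative[OF Suc.prems(2)]]])
      (rule C_k_add[OF Suc.IH[OF lower(1) deriv(2)] Suc.IH[OF deriv(1) lower(2)]])
qed (auto intro: continuous_intros)

lemma C_k_diff:
  fixes f g :: "'a::real_normed_vector \<Rightarrow> 'b::real_normed_vector"
  assumes "C_k k f" "C_k k g" shows "C_k k (\<lambda>x. f x - g x)"
  using C_k_add[OF assms(1) C_k_linear_compose[OF bounded_linear_minus[OF bounded_linear_ident] assms(2)]]
  by simp

lemma C_k_prod:
  fixes f :: "'i \<Rightarrow> 'a::real_normed_vector \<Rightarrow> 'b::{real_normed_algebra, comm_ring_1}"
  shows "(\<And>i. i \<in> I \<Longrightarrow> C_k k (f i)) \<Longrightarrow> C_k k (\<lambda>x. \<Prod>i\<in>I. f i x)"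
  by (induction I rule: infinite_finite_induct) (auto intro: C_k_const C_k_mult)

lemma C_k_cnj: "C_k k f \<Longrightarrow> C_k k (\<lambda>x. cnj (f x))"
  by (rule C_k_linear_compose[OF bounded_linear_cnj])

lemma C_k_of_real: "C_k k f \<Longrightarrow> C_k k (\<lambda>x. complex_of_real (f x))"
  by (rule C_k_linear_compose[OF bounded_linear_of_real])

lemmas C_k_fst = C_k_bounded_linear[OF bounded_linear_fst]
lemmas C_k_snd = C_k_bounded_linear[OF bounded_linear_snd]

text \<open>For \<open>m = 0\<close> this is the classical flat function exp(-1/t) on the positive
  axis. The powers of \<open>inverse t\<close> are carried along because the derivative of member
  \<open>m\<close> is a combination of the members \<open>m + 1\<close> and \<open>m + 2\<close>, so
  the family is closed under differentiation.\<close>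

definition exp_bump :: "nat \<Rightarrow> real \<Rightarrow> real" where
  "exp_bump m t = (if 0 < t then exp (- inverse t) * inverse t ^ m else 0)"

lemma exp_bump_tendsto_0: "((\<lambda>t. exp_bump m t) \<longlongrightarrow> 0) (at 0)"
proof -
  have 1: "((\<lambda>x::real. x ^ m / exp x) \<longlongrightarrow> 0) at_top" by (rule tendsto_power_div_exp_0)
  have "((\<lambda>t::real. inverse t ^ m / exp (inverse t)) \<longlongrightarrow> 0) (at_right 0)"
    by (rule filterlim_compose[OF 1 filterlim_inverse_at_top_right])
  then have "(exp_bump m \<longlongrightarrow> 0) (at_right 0)"
    by (rule Lim_transform_eventually)
      (auto simp: exp_bump_def eventually_at_filter exp_minus field_simps)
  moreover have "\<forall>\<^sub>F t in at_left 0. exp_bump m t = 0"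
    by (simp add: exp_bump_def eventually_at_filter)
  then have "(exp_bump m \<longlongrightarrow> 0) (at_left 0)"
    by (rule tendsto_eventually)
  ultimately show ?thesis by (simp add: filterlim_split_at)
qed

lemma exp_bump_deriv:
  "(exp_bump m has_real_derivative (exp_bump (m+2) t - real m * exp_bump (m+1) t)) (at t)"
proof -
  consider "t > 0" | "t < 0" | "t = 0" by linarith
  then show ?thesis
  proof cases
    case 1
    have "((\<lambda>t. exp (- inverse t) * inverse t ^ m) has_real_derivative
        (exp_bump (m+2) t - real m * exp_bump (m+1) t)) (at t)"
      using 1 by (auto intro!: derivative_eq_intros simp: exp_bump_def algebra_simps power2_eq_square
            power_Suc[symmetric] simp del: power_Suc) (cases m; simp add: algebra_simps)
    then show ?thesis
      by (rule has_field_derivative_transform_within_open[where S="{0<..}"])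
        (use 1 in \<open>auto simp: exp_bump_def\<close>)
  next
    case 2
    have "((\<lambda>t. 0) has_real_derivative (exp_bump (m+2) t - real m * exp_bump (m+1) t)) (at t)"
      using 2 by (auto simp: exp_bump_def)
    then show ?thesis
      by (rule has_field_derivative_transform_within_open[where S="{..<0}"])
        (use 2 in \<open>auto simp: exp_bump_def\<close>)
  next
    case 3
    \<comment> \<open>For nonzero \<open>h\<close> the difference quotient at 0 is
      \<open>exp_bump (m+1) h\<close> itself: dividing by \<open>h\<close> raises the power by
      one.\<close>
    have "((\<lambda>h. (exp_bump m (0 + h) - exp_bump m 0) / h) \<longlongrightarrow> 0) (at 0)"
      by (rule Lim_transform_eventually[OF exp_bump_tendsto_0[of "m+1"]])
        (auto simp: exp_bump_def eventually_at_filter field_simps)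
    then show ?thesis unfolding 3 by (simp add: DERIV_def exp_bump_def)
  qed
qed

text \<open>The induction runs over all \<open>m\<close> and \<open>Q\<close> at once, because a
  derivative of the composition is built from such compositions with larger \<open>m\<close> and a
  derivative of \<open>Q\<close>.\<close>

lemma C_k_exp_bump: "C_k k Q \<Longrightarrow> C_k k (\<lambda>x. exp_bump m (Q x))"
proof (induction k arbitrary: m Q)
  case 0
  have "continuous_on UNIV (exp_bump m)"
    by (intro continuous_at_imp_continuous_on ballI DERIV_isCont[OF exp_bump_deriv])
  then have "continuous_on UNIV (exp_bump m \<circ> Q)"
    using 0 by (intro continuous_on_compose) (auto elim: continuous_on_subset)
  then show ?case by (simp add: comp_def)
next
  case (Suc k)
  show ?case
  proof (rule C_k_SucI)
    show "((\<lambda>x. exp_bump m (Q x)) has_derivative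
        (\<lambda>v. (exp_bump (m+2) (Q x) - real m * exp_bump (m+1) (Q x)) * frechet_derivative Q (at x) v)) (at x)" for x
      using DERIV_compose_FDERIV[OF exp_bump_deriv C_k_Suc_has_derivative[OF Suc.prems]]
      by (simp add: mult.commute)
    have Q: "C_k k Q" using C_k_SucD Suc.prems by blast
    show "C_k k (\<lambda>x. (exp_bump (m+2) (Q x) - real m * exp_bump (m+1) (Q x)) * frechet_derivative Q (at x) v)" for v
      by (intro C_k_mult C_k_diff Suc.IH Q C_k_const) (use Suc.prems in simp)
  qed
qed

lemma exp_bump_0: "0 \<le> exp_bump 0 t" "exp_bump 0 t \<le> 1" "exp_bump 0 t = 0 \<longleftrightarrow> t \<le> 0"
  by (auto simp: exp_bump_def)

text \<open>Scaling the argument turns the flat function into smooth approximations of the indicator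
  of the positive axis, from which smooth approximations of boxes are made later.\<close>

lemma exp_bump_scaled_tendsto: "(\<lambda>n. exp_bump 0 (real n * t)) \<longlonglongrightarrow> (if 0 < t then 1 else 0)"
proof (cases "0 < t")
  case True
  have "(\<lambda>n. exp (- (inverse (real n) * inverse t))) \<longlonglongrightarrow> exp (- (0 * inverse t))"
    by (rule tendsto_exp[OF tendsto_minus[OF tendsto_mult_right[OF lim_inverse_n]]])
  moreover have "exp (- (inverse (real n) * inverse t)) = exp_bump 0 (real n * t)" if "n \<ge> 1" for n
    using that True by (simp add: exp_bump_def)
  then have "\<forall>\<^sub>F n in sequentially. exp (- (inverse (real n) * inverse t)) = exp_bump 0 (real n * t)"
    by (auto simp: eventually_sequentially)
  ultimately show ?thesis
    using True Lim_transform_eventually by fastforce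
next
  case False
  then have "exp_bump 0 (real n * t) = 0" for n
    by (simp add: exp_bump_0 mult_nonneg_nonpos)
  then show ?thesis using False by simp
qed

section \<open>Test functions and the biholomorphism\<close>

lemma coord_axis_simps [simp]:
  "coord_axis (Suc 0) c = (c, 0)" "coord_axis 2 c = (0, c)"
  by (simp_all add: coord_axis_def)

text \<open>The equations involve the barred derivatives only, but smoothness of compositions
  concerns the full real derivative, which contains the holomorphic half as well.\<close>

definition wirtinger :: "nat \<Rightarrow> cfun2 \<Rightarrow> cfun2" where
  "wirtinger j \<psi> z =
     (frechet_derivative \<psi> (at z) (coord_axis j 1)
        - \<i> * frechet_derivative \<psi> (at z) (coord_axis j \<i>)) / 2"

lemma wirtinger_bar_has_derivative:
  assumes "(\<psi> has_derivative \<psi>') (at z)"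
  shows "wirtinger_bar j \<psi> z = (\<psi>' (coord_axis j 1) + \<i> * \<psi>' (coord_axis j \<i>)) / 2"
  using frechet_derivative_at[OF assms] by (simp add: wirtinger_bar_def)

text \<open>Splits the real derivative into its complex linear and antilinear parts. Holomorphic
  substitutions respect this splitting, which keeps the chain rules below short.\<close>

lemma has_derivative_wirtinger:
  assumes "\<psi> differentiable (at z)"
  shows "(\<psi> has_derivative (\<lambda>v. wirtinger 1 \<psi> z * fst v + wirtinger_bar 1 \<psi> z * cnj (fst v)
           + wirtinger 2 \<psi> z * snd v + wirtinger_bar 2 \<psi> z * cnj (snd v))) (at z)"
proof -
  let ?D = "frechet_derivative \<psi> (at z)"
  have D: "(\<psi> has_derivative ?D) (at z)" using assms frechet_derivative_works by blast
  interpret D: bounded_linear ?D using D by (rule has_derivative_bounded_linear)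
  have "?D v = wirtinger 1 \<psi> z * fst v + wirtinger_bar 1 \<psi> z * cnj (fst v)
           + wirtinger 2 \<psi> z * snd v + wirtinger_bar 2 \<psi> z * cnj (snd v)" for v
  proof -
    have "v = Re (fst v) *\<^sub>R (1, 0) + Im (fst v) *\<^sub>R (\<i>, 0) + Re (snd v) *\<^sub>R (0, 1) + Im (snd v) *\<^sub>R (0, \<i>)"
      by (simp add: prod_eq_iff complex_eq_iff)
    then have "?D v = ?D (Re (fst v) *\<^sub>R (1, 0) + Im (fst v) *\<^sub>R (\<i>, 0) + Re (snd v) *\<^sub>R (0, 1) + Im (snd v) *\<^sub>R (0, \<i>))"
      by simp
    also have "\<dots> = Re (fst v) *\<^sub>R ?D (1, 0) + Im (fst v) *\<^sub>R ?D (\<i>, 0)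
        + Re (snd v) *\<^sub>R ?D (0, 1) + Im (snd v) *\<^sub>R ?D (0, \<i>)"
      by (simp only: D.add D.scaleR)
    finally show ?thesis
      by (simp add: wirtinger_def wirtinger_bar_def scaleR_conv_of_real
          complex_eq_iff algebra_simps diff_divide_distrib add_divide_distrib)
  qed
  then have "?D = (\<lambda>v. wirtinger 1 \<psi> z * fst v + wirtinger_bar 1 \<psi> z * cnj (fst v)
           + wirtinger 2 \<psi> z * snd v + wirtinger_bar 2 \<psi> z * cnj (snd v))" by blast
  with D show ?thesis by metis
qed

lemma C_k_frechet: "C_k (Suc k) f \<Longrightarrow> C_k k (\<lambda>x. frechet_derivative f (at x) v)"
  by simp

lemma C_k_wirtinger_bar: "C_k (Suc k) \<psi> \<Longrightarrow> C_k k (wirtinger_bar j \<psi>)"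
  unfolding wirtinger_bar_def[abs_def] divide_inverse
  by (intro C_k_add C_k_mult C_k_const C_k_frechet)

lemma C_k_wirtinger: "C_k (Suc k) \<psi> \<Longrightarrow> C_k k (wirtinger j \<psi>)"
  unfolding wirtinger_def[abs_def] divide_inverse
  by (intro C_k_diff C_k_mult C_k_const C_k_frechet)

section \<open>Supports, test functions and the chain rule\<close>

lemma frechet_derivative_zero_outside:
  assumes "closed K" "\<And>z. z \<notin> K \<Longrightarrow> \<psi> z = 0" "z \<notin> K"
  shows "frechet_derivative \<psi> (at z) v = 0"
proof -
  have "(\<psi> has_derivative (\<lambda>_. 0)) (at z)"
    by (rule has_derivative_transform_within_open[OF has_derivative_const, of "- K"])
      (use assms in \<open>auto simp: open_Compl\<close>)
  from frechet_derivative_at[OF this] show ?thesis by metis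
qed

lemma wirtinger_zero_outside:
  assumes "closed K" "\<And>z. z \<notin> K \<Longrightarrow> \<psi> z = 0" "z \<notin> K"
  shows "wirtinger_bar j \<psi> z = 0" "wirtinger j \<psi> z = 0"
  using frechet_derivative_zero_outside[OF assms] by (auto simp: wirtinger_bar_def wirtinger_def)

text \<open>Any compact set outside which the function vanishes may serve in place of the exact
  support, whose closure is awkward to determine after products and substitutions.\<close>

lemma test_functionsI:
  assumes "\<And>k. C_k k \<psi>" "compact K" "K \<subseteq> \<Omega>" "\<And>z. z \<notin> K \<Longrightarrow> \<psi> z = 0"
  shows "\<psi> \<in> test_functions \<Omega>"
proof -
  have "closure {z. \<psi> z \<noteq> 0} \<subseteq> K"
    using assms(4) by (intro closure_minimal compact_imp_closed assms) auto
  moreover from this have "compact (closure {z. \<psi> z \<noteq> 0})"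
    using compact_Int_closed[OF assms(2) closed_closure, of "{z. \<psi> z \<noteq> 0}"] by (metis inf.absorb2)
  ultimately show ?thesis using assms(1,3) by (auto simp: test_functions_def smooth_def)
qed

lemma test_functionsE:
  assumes "\<psi> \<in> test_functions \<Omega>"
  obtains K where "\<And>k. C_k k \<psi>" "compact K" "K \<subseteq> \<Omega>" "\<And>z. z \<notin> K \<Longrightarrow> \<psi> z = 0"
  using assms closure_subset[of "{z. \<psi> z \<noteq> 0}"] 
  by (intro that[of "closure {z. \<psi> z \<noteq> 0}"]) (auto simp: test_functions_def smooth_def)

lemma test_functions_mult:
  assumes "\<psi> \<in> test_functions \<Omega>" "\<And>k. C_k k g"
  shows "(\<lambda>z. g z * \<psi> z) \<in> test_functions \<Omega>"
  using assms(1)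
proof (rule test_functionsE)
  fix K assume "\<And>k. C_k k \<psi>" "compact K" "K \<subseteq> \<Omega>" "\<And>z. z \<notin> K \<Longrightarrow> \<psi> z = 0"
  then show ?thesis
    by (intro test_functionsI[of _ K] C_k_mult assms) auto
qed

lemma C_k_differentiable: "C_k (Suc k) \<psi> \<Longrightarrow> \<psi> differentiable (at z)"
  by simp

lemma wirtinger_bar_mult:
  assumes "g differentiable (at z)" "\<psi> differentiable (at z)"
  shows "wirtinger_bar j (\<lambda>z. g z * \<psi> z) z = g z * wirtinger_bar j \<psi> z + wirtinger_bar j g z * \<psi> z"
proof -
  have "((\<lambda>z. g z * \<psi> z) has_derivative (\<lambda>v. g z * frechet_derivative \<psi> (at z) v
      + frechet_derivative g (at z) v * \<psi> z)) (at z)"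
    using assms by (intro has_derivative_mult) (simp_all add: frechet_derivative_works)
  from wirtinger_bar_has_derivative[OF this, of j] show ?thesis
    unfolding wirtinger_bar_def by algebra
qed

text \<open>The last two assumptions say that the derivative of \<Phi> is complex linear in the j-th
  variable. Then the holomorphic terms of \<psi> enter once with the factor 1 and once with
  \<open>\<i> * \<i>\<close> and cancel, while the antilinear terms are doubled and absorb the
  division by 2.\<close>

lemma wirtinger_bar_chain:
  assumes "\<psi> differentiable (at (\<Phi> z))"
    and "(\<Phi> has_derivative (\<lambda>v. (A v, B v))) (at z)"
    and "A (coord_axis j \<i>) = \<i> * A (coord_axis j 1)" "B (coord_axis j \<i>) = \<i> * B (coord_axis j 1)"
  shows "wirtinger_bar j (\<lambda>z. \<psi> (\<Phi> z)) z =
     wirtinger_bar 1 \<psi> (\<Phi> z) * cnj (A (coord_axis j 1)) + wirtinger_bar 2 \<psi> (\<Phi> z) * cnj (B (coord_axis j 1))"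
proof -
  let ?w = "wirtinger_bar j (\<lambda>z. \<psi> (\<Phi> z)) z" and ?r = "wirtinger_bar 1 \<psi> (\<Phi> z) * cnj (A (coord_axis j 1))
     + wirtinger_bar 2 \<psi> (\<Phi> z) * cnj (B (coord_axis j 1))"
  have "2 * ?w = 2 * ?r"
    using wirtinger_bar_has_derivative[OF diff_chain_at[OF assms(2) has_derivative_wirtinger[OF assms(1)],
      unfolded o_def fst_conv snd_conv], of j]
    by (simp add: assms(3,4) field_simps)
  then show ?thesis by (simp only: mult_cancel_left) simp
qed

text \<open>The explicit inverse of \<open>hartogs_map\<close>. Being polynomial it is smooth on the
  whole space, so functions extended by zero from the Hartogs triangle can be composed with it
  without case distinctions. \<open>hartogs_map_inv_eq\<close> links it to
  \<open>hartogs_map_inv\<close>.\<close>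

definition hartogs_param :: "complex \<times> complex \<Rightarrow> complex \<times> complex" where
  "hartogs_param w = (fst w * snd w, snd w)"

lemma hartogs_param_has_derivative:
  "(hartogs_param has_derivative (\<lambda>v. (fst w * snd v + fst v * snd w, snd v))) (at w)"
  unfolding hartogs_param_def[abs_def] by (auto intro!: derivative_eq_intros)

lemma continuous_hartogs_param: "continuous_on S hartogs_param"
  unfolding hartogs_param_def[abs_def] by (intro continuous_intros)

lemma hartogs_map_param: "snd w \<noteq> 0 \<Longrightarrow> hartogs_map (hartogs_param w) = w"
  by (simp add: hartogs_map_def hartogs_param_def)

lemma hartogs_param_map: "snd z \<noteq> 0 \<Longrightarrow> hartogs_param (hartogs_map z) = z"
  by (simp add: hartogs_map_def hartogs_param_def)

abbreviation punctured_bidisc :: "(complex \<times> complex) set" where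
  "punctured_bidisc \<equiv> disc \<times> punctured_disc"

text \<open>Valid at all points, also where the second coordinate is 0, so vanishing outside one
  domain turns into vanishing outside the other.\<close>

lemma hartogs_param_mem: "hartogs_param w \<in> hartogs \<longleftrightarrow> w \<in> punctured_bidisc"
  by (cases w) (auto simp: hartogs_param_def hartogs_def norm_mult mult_less_cancel_right2)

lemma hartogs_map_mem: "hartogs_map z \<in> punctured_bidisc \<longleftrightarrow> z \<in> hartogs"
  by (cases z) (auto simp: hartogs_map_def hartogs_def norm_divide divide_simps)

lemma wirtinger_bar_hartogs_param:
  assumes "\<psi> differentiable (at (hartogs_param w))"
  shows "wirtinger_bar 1 (\<lambda>w. \<psi> (hartogs_param w)) w = wirtinger_bar 1 \<psi> (hartogs_param w) * cnj (snd w)"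
    and "wirtinger_bar 2 (\<lambda>w. \<psi> (hartogs_param w)) w =
      wirtinger_bar 1 \<psi> (hartogs_param w) * cnj (fst w) + wirtinger_bar 2 \<psi> (hartogs_param w)"
  by (subst wirtinger_bar_chain[OF assms hartogs_param_has_derivative]; simp)+

text \<open>The derivative of the composition consists of first derivatives of \<psi> composed with
  the same map, multiplied by polynomials in the coordinates and their conjugates; hence \<psi>
  stays arbitrary in the induction.\<close>

lemma C_k_hartogs_param:
  fixes \<psi> :: cfun2
  assumes "C_k k \<psi>" shows "C_k k (\<lambda>w. \<psi> (hartogs_param w))"
  using assms
proof (induction k arbitrary: \<psi>)
  case 0
  then have "continuous_on (range hartogs_param) \<psi>"
    by (auto elim: continuous_on_subset)
  then show ?case
    using continuous_on_compose[OF continuous_hartogs_param[of UNIV], of \<psi>] by (simp add: o_def)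
next
  case (Suc k)
  note diff = C_k_differentiable[OF Suc.prems]
  show ?case
  proof (rule C_k_SucI)
    show "((\<lambda>w. \<psi> (hartogs_param w)) has_derivative
        (\<lambda>v. wirtinger 1 \<psi> (hartogs_param w) * (fst w * snd v + fst v * snd w)
           + wirtinger_bar 1 \<psi> (hartogs_param w) * cnj (fst w * snd v + fst v * snd w)
           + wirtinger 2 \<psi> (hartogs_param w) * snd v
           + wirtinger_bar 2 \<psi> (hartogs_param w) * cnj (snd v))) (at w)" for w
      using diff_chain_at[OF hartogs_param_has_derivative has_derivative_wirtinger[OF diff]]
      by (simp add: o_def)
  qed (intro C_k_add C_k_mult C_k_cnj C_k_const C_k_fst C_k_snd Suc.IH
      C_k_wirtinger C_k_wirtinger_bar Suc.prems)
qed

lemma test_functions_hartogs_param: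
  assumes "\<psi> \<in> test_functions hartogs"
  shows "(\<lambda>w. \<psi> (hartogs_param w)) \<in> test_functions punctured_bidisc"
  using assms
proof (rule test_functionsE)
  fix K assume K: "\<And>k. C_k k \<psi>" "compact K" "K \<subseteq> hartogs" "\<And>z. z \<notin> K \<Longrightarrow> \<psi> z = 0"
  \<comment> \<open>On the support the second coordinate does not vanish, so
    \<open>hartogs_map\<close> is continuous there although it divides by it.\<close>
  have nz: "snd z \<noteq> 0" if "z \<in> K" for z using that K(3) by (auto simp: hartogs_def)
  have "continuous_on K hartogs_map"
    unfolding hartogs_map_def[abs_def] using nz by (intro continuous_intros) auto
  then show ?thesis
  proof (intro test_functionsI[of _ "hartogs_map ` K"])
    show "compact (hartogs_map ` K)" if "continuous_on K hartogs_map"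
      using that K(2) by (rule compact_continuous_image)
    show "hartogs_map ` K \<subseteq> punctured_bidisc"
      using K(3) hartogs_map_mem by blast
    show "\<psi> (hartogs_param w) = 0" if "w \<notin> hartogs_map ` K" for w
    proof (rule K(4), rule notI)
      assume *: "hartogs_param w \<in> K"
      then have "snd w \<noteq> 0" using nz by (force simp: hartogs_param_def)
      with * that show False by (metis hartogs_map_param imageI)
    qed
  qed (auto intro: C_k_hartogs_param K)
qed

lemma hartogs_map_has_derivative:
  assumes "snd z \<noteq> 0"
  shows "(hartogs_map has_derivative
     (\<lambda>v. ((fst v - fst (hartogs_map z) * snd v) * inverse (snd z), snd v))) (at z)"
  unfolding hartogs_map_def[abs_def] using assms
  by (auto intro!: derivative_eq_intros simp: field_simps)

text \<open>The two open sets of the last claim cover the space: on the first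
  \<open>hartogs_map\<close> is smooth, on the second a function supported in \<open>K\<close> and
  composed with it vanishes. Regularity can be checked on each of them separately.\<close>

lemma hartogs_map_pullback_off_support:
  assumes "compact K" "K \<subseteq> {w. snd w \<noteq> 0}"
  shows "closed (hartogs_param ` K)"
    and "\<And>z. z \<notin> hartogs_param ` K \<Longrightarrow> hartogs_map z \<notin> K"
    and "open (- (hartogs_param ` K))" "{z. snd z \<noteq> 0} \<union> - (hartogs_param ` K) = UNIV"
proof -
  show *: "closed (hartogs_param ` K)"
    by (intro compact_imp_closed compact_continuous_image continuous_hartogs_param assms)
  then show "open (- (hartogs_param ` K))" by (simp add: open_Compl)
  show "{z. snd z \<noteq> 0} \<union> - (hartogs_param ` K) = UNIV"
    using assms(2) by (force simp: hartogs_param_def)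
  show "hartogs_map z \<notin> K" if z: "z \<notin> hartogs_param ` K" for z
  proof
    assume *: "hartogs_map z \<in> K"
    with assms(2) have "snd z \<noteq> 0" by (force simp: hartogs_map_def)
    with * z show False by (metis hartogs_param_map imageI)
  qed
qed

text \<open>Where \<open>snd z = 0\<close>, division by zero gives \<open>hartogs_map z = 0\<close>, which lies outside the
  support of \<open>\<Psi>\<close>; hence this total function is already the extension by zero.\<close>

definition hartogs_pullback :: "nat \<Rightarrow> nat \<Rightarrow> cfun2 \<Rightarrow> cfun2" where
  "hartogs_pullback n m \<Psi> z = \<Psi> (hartogs_map z) * inverse (snd z) ^ n * inverse (cnj (snd z)) ^ m"

text \<open>The derivative written again as a sum of pullbacks. The derivative of
  \<open>hartogs_map\<close> contributes one more factor \<open>inverse (snd z)\<close> or its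
  conjugate, which is why the exponents \<open>n\<close> and \<open>m\<close> are
  parameters.\<close>

definition hartogs_pullback_deriv ::
    "nat \<Rightarrow> nat \<Rightarrow> cfun2 \<Rightarrow> complex \<times> complex \<Rightarrow> complex \<times> complex \<Rightarrow> complex" where
  "hartogs_pullback_deriv n m \<Psi> z v =
     hartogs_pullback (Suc n) m (\<lambda>w. wirtinger 1 \<Psi> w * (fst v - fst w * snd v)) z
     + hartogs_pullback n (Suc m) (\<lambda>w. wirtinger_bar 1 \<Psi> w * cnj (fst v - fst w * snd v)) z
     + hartogs_pullback n m (\<lambda>w. wirtinger 2 \<Psi> w * snd v + wirtinger_bar 2 \<Psi> w * cnj (snd v)) z
     + hartogs_pullback (Suc n) m (\<lambda>w. \<Psi> w * (- of_nat n * snd v)) z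
     + hartogs_pullback n (Suc m) (\<lambda>w. \<Psi> w * (- of_nat m * cnj (snd v))) z"

lemma has_derivative_inverse_power_snd:
  fixes z :: "complex \<times> complex"
  assumes "snd z \<noteq> 0"
  shows "((\<lambda>z. inverse (snd z) ^ n) has_derivative
           (\<lambda>v. - of_nat n * inverse (snd z) ^ Suc n * snd v)) (at z)"
proof -
  have "((\<lambda>x. inverse x ^ n) has_field_derivative (- of_nat n * inverse (snd z) ^ Suc n)) (at (snd z))"
    using DERIV_power[OF DERIV_inverse[OF assms, of UNIV], of n] by (cases n) (simp_all add: algebra_simps)
  from has_derivative_compose[OF has_derivative_snd[OF has_derivative_ident] this[unfolded has_field_derivative_def]]
  show ?thesis by simp
qed

lemma has_derivative_hartogs_pullback:
  assumes "\<And>w. \<Psi> differentiable (at w)" "compact K" "K \<subseteq> {w. snd w \<noteq> 0}"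
    and off: "\<And>w. w \<notin> K \<Longrightarrow> \<Psi> w = 0"
  shows "(hartogs_pullback n m \<Psi> has_derivative hartogs_pullback_deriv n m \<Psi> z) (at z)"
proof (cases "snd z = 0")
  case False
  have 1: "((\<lambda>z. \<Psi> (hartogs_map z)) has_derivative
      (\<lambda>v. wirtinger 1 \<Psi> (hartogs_map z) * ((fst v - fst (hartogs_map z) * snd v) * inverse (snd z))
         + wirtinger_bar 1 \<Psi> (hartogs_map z) * cnj ((fst v - fst (hartogs_map z) * snd v) * inverse (snd z))
         + wirtinger 2 \<Psi> (hartogs_map z) * snd v
         + wirtinger_bar 2 \<Psi> (hartogs_map z) * cnj (snd v))) (at z)"
    using diff_chain_at[OF hartogs_map_has_derivative[OF False] has_derivative_wirtinger[OF assms(1)]]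
    by (simp add: o_def)
  have 2: "((\<lambda>z. inverse (cnj (snd z)) ^ m) has_derivative
           (\<lambda>v. - of_nat m * inverse (cnj (snd z)) ^ Suc m * cnj (snd v))) (at z)"
    using has_derivative_cnj[OF has_derivative_inverse_power_snd[OF False, of m]] by simp
  note 3 = has_derivative_mult[OF has_derivative_mult[OF 1 has_derivative_inverse_power_snd[OF False, of n]] 2]
  show ?thesis
    unfolding hartogs_pullback_def[abs_def]
    by (rule has_derivative_eq_rhs[OF 3])
      (simp add: hartogs_pullback_deriv_def hartogs_pullback_def fun_eq_iff algebra_simps)
next
  case True
  \<comment> \<open>Points with second coordinate 0 lie in an open set on which the pullback is
    identically zero; its derivative vanishes there, and so does the formula.\<close>
  note off_support = hartogs_map_pullback_off_support[OF assms(2,3)]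
  have z: "z \<in> - (hartogs_param ` K)" using off_support(4) True by blast
  have "hartogs_pullback_deriv n m \<Psi> z v = 0" for v
    using off_support(2)[of z] z wirtinger_zero_outside[OF compact_imp_closed[OF assms(2)] off] off
    by (simp add: hartogs_pullback_deriv_def hartogs_pullback_def)
  then have "hartogs_pullback_deriv n m \<Psi> z = (\<lambda>v. 0)" by auto
  moreover have "(hartogs_pullback n m \<Psi> has_derivative (\<lambda>_. 0)) (at z)"
    by (rule has_derivative_transform_within_open[OF has_derivative_const off_support(3) z])
      (use off off_support(2) in \<open>auto simp: hartogs_pullback_def\<close>)
  ultimately show ?thesis by simp
qed

lemma C_k_hartogs_pullback:
  assumes "C_k k \<Psi>" "compact K" "K \<subseteq> {w. snd w \<noteq> 0}" "\<And>w. w \<notin> K \<Longrightarrow> \<Psi> w = 0"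
  shows "C_k k (hartogs_pullback n m \<Psi>)"
  using assms(1,4)
proof (induction k arbitrary: \<Psi> n m)
  case 0
  note off_support = hartogs_map_pullback_off_support[OF assms(2,3)]
  have "continuous_on UNIV \<Psi>" using 0 by simp
  moreover have "continuous_on {z. snd z \<noteq> 0} hartogs_map"
    unfolding hartogs_map_def[abs_def] by (intro continuous_intros) auto
  ultimately have "continuous_on {z. snd z \<noteq> 0} (\<Psi> \<circ> hartogs_map)"
    by (intro continuous_on_compose) (auto elim: continuous_on_subset)
  then have "continuous_on {z. snd z \<noteq> 0} (hartogs_pullback n m \<Psi>)"
    unfolding hartogs_pullback_def[abs_def] o_def by (intro continuous_intros) auto
  moreover have "continuous_on (- (hartogs_param ` K)) (hartogs_pullback n m \<Psi>)"
    using off_support(2) 0(2)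
    by (intro continuous_on_cong[THEN iffD2, OF refl _ continuous_on_const[of _ 0]])
      (auto simp: hartogs_pullback_def)
  moreover have "open {z::complex \<times> complex. snd z \<noteq> 0}"
    by (intro open_Collect_neq continuous_intros)
  ultimately have "continuous_on ({z. snd z \<noteq> 0} \<union> - (hartogs_param ` K)) (hartogs_pullback n m \<Psi>)"
    using off_support(3) by (intro continuous_on_open_Un)
  then show ?case using off_support(4) by simp
next
  case (Suc k)
  note Psi = C_k_SucD[OF Suc.prems(1)] C_k_differentiable[OF Suc.prems(1)]
  note zero = wirtinger_zero_outside[OF compact_imp_closed[OF assms(2)] Suc.prems(2)]
  show ?case
  proof (rule C_k_SucI)
    show "(hartogs_pullback n m \<Psi> has_derivative hartogs_pullback_deriv n m \<Psi> z) (at z)" for z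
      by (rule has_derivative_hartogs_pullback[OF Psi(2) assms(2,3)]) (rule Suc.prems(2))
    show "C_k k (\<lambda>z. hartogs_pullback_deriv n m \<Psi> z v)" for v
      unfolding hartogs_pullback_deriv_def
      by (intro C_k_add Suc.IH C_k_mult C_k_cnj C_k_diff C_k_const C_k_fst Psi(1)
          C_k_wirtinger C_k_wirtinger_bar Suc.prems) (auto simp: zero Suc.prems(2))
  qed
qed

lemma test_functions_hartogs_pullback:
  assumes "\<Psi> \<in> test_functions punctured_bidisc"
  shows "hartogs_pullback n m \<Psi> \<in> test_functions hartogs"
    and "wirtinger_bar j (hartogs_pullback 1 0 \<Psi>) z = 
      (hartogs_pullback_deriv 1 0 \<Psi> z (coord_axis j 1) + \<i> * hartogs_pullback_deriv 1 0 \<Psi> z (coord_axis j \<i>)) / 2"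
proof -
  from assms obtain K where K: "\<And>k. C_k k \<Psi>" "compact K" "K \<subseteq> punctured_bidisc"
    "\<And>w. w \<notin> K \<Longrightarrow> \<Psi> w = 0"
    using test_functionsE by blast
  have nz: "K \<subseteq> {w. snd w \<noteq> 0}" using K(3) by auto
  note off_support = hartogs_map_pullback_off_support[OF K(2) nz]
  show "hartogs_pullback n m \<Psi> \<in> test_functions hartogs"
  proof (rule test_functionsI)
    show "C_k k (hartogs_pullback n m \<Psi>)" for k by (rule C_k_hartogs_pullback) (use K nz in blast)+
    show "compact (hartogs_param ` K)"
      by (intro compact_continuous_image continuous_hartogs_param K)
    show "hartogs_param ` K \<subseteq> hartogs" using K(3) hartogs_param_mem by blast
    show "hartogs_pullback n m \<Psi> z = 0" if "z \<notin> hartogs_param ` K" for z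
      using off_support(2)[OF that] K(4) by (simp add: hartogs_pullback_def)
  qed
  have "(hartogs_pullback 1 0 \<Psi> has_derivative hartogs_pullback_deriv 1 0 \<Psi> z) (at z)"
    by (rule has_derivative_hartogs_pullback[OF C_k_differentiable[OF K(1)]]) (use K nz in blast)+
  from wirtinger_bar_has_derivative[OF this] show "wirtinger_bar j (hartogs_pullback 1 0 \<Psi>) z = 
      (hartogs_pullback_deriv 1 0 \<Psi> z (coord_axis j 1) + \<i> * hartogs_pullback_deriv 1 0 \<Psi> z (coord_axis j \<i>)) / 2" .
qed

text \<open>The exponents 1 and 0 are chosen because \<open>inverse (snd z)\<close> is holomorphic,
  so that the barred derivatives pass it by. After the substitution it cancels the holomorphic half
  of the Jacobian \<open>snd w * cnj (snd w)\<close>.\<close>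

lemma wirtinger_bar_hartogs_pullback:
  assumes "\<Psi> \<in> test_functions punctured_bidisc"
  shows "wirtinger_bar 1 (hartogs_pullback 1 0 \<Psi>) z = hartogs_pullback 1 1 (wirtinger_bar 1 \<Psi>) z"
    and "wirtinger_bar 2 (hartogs_pullback 1 0 \<Psi>) z =
      hartogs_pullback 1 0 (wirtinger_bar 2 \<Psi>) z
      - hartogs_pullback 1 1 (\<lambda>w. cnj (fst w) * wirtinger_bar 1 \<Psi> w) z"
  unfolding test_functions_hartogs_pullback(2)[OF assms]
  by (simp_all add: hartogs_pullback_deriv_def hartogs_pullback_def algebra_simps
      add_divide_distrib diff_divide_distrib)

section \<open>The Cauchy--Pompeiu formula\<close>

lemma borel_measurable_cnj [measurable]: "cnj \<in> borel_measurable borel"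
  by (intro borel_measurable_continuous_onI continuous_intros)

section \<open>Translation invariance of Lebesgue measure and its infinitesimal form\<close>

lemma distr_lborel_reflect:
  fixes a :: "'a::euclidean_space"
  shows "distr lborel borel (\<lambda>x. a + x) = lborel" "distr lborel borel (\<lambda>x. x + a) = lborel"
    "distr lborel borel (\<lambda>x. a - x) = lborel" "distr lborel borel (\<lambda>x. x - a) = lborel"
proof -
  show *: "distr lborel borel (\<lambda>x. b + x) = lborel" for b :: 'a
    using lborel_distr_plus[of b] by (simp add: comp_def)
  from *[of a] *[of "- a"] show "distr lborel borel (\<lambda>x. x + a) = lborel" "distr lborel borel (\<lambda>x. x - a) = lborel"
    by (simp_all add: add.commute)
  show "distr lborel borel (\<lambda>x. a - x) = lborel"
    using lborel_affine[of "-1" a] by (simp add: density_1)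
qed

lemma lborel_nn_integral_shift:
  fixes f :: "'a::euclidean_space \<Rightarrow> ennreal"
  assumes [measurable]: "f \<in> borel_measurable borel"
  shows "(\<integral>\<^sup>+x. f (x + a) \<partial>lborel) = (\<integral>\<^sup>+x. f x \<partial>lborel)"
    "(\<integral>\<^sup>+x. f (x - a) \<partial>lborel) = (\<integral>\<^sup>+x. f x \<partial>lborel)"
    "(\<integral>\<^sup>+x. f (a - x) \<partial>lborel) = (\<integral>\<^sup>+x. f x \<partial>lborel)"
  using nn_integral_distr[of "\<lambda>x. x + a" lborel borel f] nn_integral_distr[of "\<lambda>x. x - a" lborel borel f]
    nn_integral_distr[of "\<lambda>x. a - x" lborel borel f]
  by (simp_all add: distr_lborel_reflect)

lemma lborel_integral_shift:
  fixes f :: "'a::euclidean_space \<Rightarrow> 'b::{banach, second_countable_topology}"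
  assumes [measurable]: "f \<in> borel_measurable borel"
  shows "(LINT x|lborel. f (x + a)) = (LINT x|lborel. f x)"
    "(LINT x|lborel. f (x - a)) = (LINT x|lborel. f x)"
    "(LINT x|lborel. f (a - x)) = (LINT x|lborel. f x)"
  using integral_distr[of "\<lambda>x. x + a" lborel borel f] integral_distr[of "\<lambda>x. x - a" lborel borel f]
    integral_distr[of "\<lambda>x. a - x" lborel borel f]
  by (simp_all add: distr_lborel_reflect)

lemma lborel_integrable_shift:
  fixes f :: "'a::euclidean_space \<Rightarrow> 'b::{banach, second_countable_topology}"
  assumes [measurable]: "f \<in> borel_measurable borel"
  shows "integrable lborel (\<lambda>x. f (x + a)) \<longleftrightarrow> integrable lborel f"
    "integrable lborel (\<lambda>x. f (x - a)) \<longleftrightarrow> integrable lborel f"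
    "integrable lborel (\<lambda>x. f (a - x)) \<longleftrightarrow> integrable lborel f"
  using integrable_distr_eq[of "\<lambda>x. x + a" lborel borel f] integrable_distr_eq[of "\<lambda>x. x - a" lborel borel f]
    integrable_distr_eq[of "\<lambda>x. a - x" lborel borel f]
  by (simp_all add: distr_lborel_reflect)

lemma integrable_compact_support:
  fixes f :: "'a::euclidean_space \<Rightarrow> 'b::{banach, second_countable_topology}"
  assumes "continuous_on UNIV f" "compact K" "\<And>x. x \<notin> K \<Longrightarrow> f x = 0"
  shows "integrable lborel f"
proof -
  have "integrable lborel (\<lambda>x. indicator K x *\<^sub>R f x)"
    using assms(1,2) by (intro borel_integrable_compact) (auto elim: continuous_on_subset)
  moreover have "indicator K x *\<^sub>R f x = f x" for x using assms(3) by (auto simp: indicator_def)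
  ultimately show ?thesis by simp
qed

lemma bounded_compact_support:
  fixes f :: "'a::euclidean_space \<Rightarrow> 'b::real_normed_vector"
  assumes "continuous_on UNIV f" "compact K" "\<And>x. x \<notin> K \<Longrightarrow> f x = 0"
  obtains B where "B > 0" "\<And>x. norm (f x) \<le> B"
proof -
  have "bounded (f ` K)"
    using assms(1,2) by (intro compact_imp_bounded compact_continuous_image) (auto elim: continuous_on_subset)
  then obtain B where "B > 0" "\<And>x. x \<in> K \<Longrightarrow> norm (f x) \<le> B" by (auto simp: bounded_pos)
  with assms(3) show ?thesis by (intro that[of B]) (metis less_imp_le norm_zero)+
qed

text \<open>Differentiate the translation invariance of the integral.\<close>

lemma integral_directional_derivative:
  fixes \<Phi> :: "'a::euclidean_space \<Rightarrow> 'b::{banach, second_countable_topology}"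
  assumes deriv: "\<And>x. (\<Phi> has_derivative \<Phi>' x) (at x)"
    and cont: "continuous_on UNIV (\<lambda>x. \<Phi>' x v)"
    and K: "compact K" "\<And>x. x \<notin> K \<Longrightarrow> \<Phi> x = 0"
  shows "integrable lborel (\<lambda>x. \<Phi>' x v)" "(LINT x|lborel. \<Phi>' x v) = 0"
proof -
  have contP: "continuous_on UNIV \<Phi>"
    using deriv by (intro continuous_at_imp_continuous_on) (auto intro: has_derivative_continuous)
  have zero: "\<Phi>' x v = 0" if "x \<notin> K" for x
  proof -
    have "(\<Phi> has_derivative (\<lambda>_. 0)) (at x)"
      by (rule has_derivative_transform_within_open[OF has_derivative_const, of "- K"])
        (use K that in \<open>auto simp: open_Compl compact_imp_closed\<close>)
    then show ?thesis using has_derivative_unique[OF deriv] by metis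
  qed
  from bounded_compact_support[OF cont K(1) zero] obtain B where
    B: "B > 0" "\<And>x. norm (\<Phi>' x v) \<le> B" by blast
  show int: "integrable lborel (\<lambda>x. \<Phi>' x v)"
    using cont K(1) zero by (rule integrable_compact_support)
  define h where "h n = inverse (real (Suc n))" for n
  have h: "h n > 0" "h n \<le> 1" for n by (auto simp: h_def divide_simps)
  define q where "q n x = (1 / h n) *\<^sub>R (\<Phi> (x + h n *\<^sub>R v) - \<Phi> x)" for n x
  \<comment> \<open>\<open>K'\<close> contains the supports of all difference quotients, because
    every step length \<open>h n\<close> lies in (0, 1]; together with the bound \<open>B\<close> it
    gives the dominating function.\<close>
  define K' where "K' = (\<lambda>(x, t). x - t *\<^sub>R v) ` (K \<times> {0..1})"
  have K': "compact K'"
    unfolding K'_def case_prod_unfold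
    by (intro compact_continuous_image continuous_intros compact_Times K compact_Icc)
  have line: "((\<lambda>t. \<Phi> (x + t *\<^sub>R v)) has_derivative (\<lambda>s. s *\<^sub>R \<Phi>' (x + t *\<^sub>R v) v)) (at t within S)" for x t S
  proof -
    have "((\<lambda>t. x + t *\<^sub>R v) has_derivative (\<lambda>s. s *\<^sub>R v)) (at t within S)"
      by (auto intro!: derivative_eq_intros)
    from has_derivative_compose[OF this deriv] show ?thesis
      using linear_cmul[OF has_derivative_linear[OF deriv]] by simp
  qed
  have "(\<lambda>n. LINT x|lborel. q n x) \<longlonglongrightarrow> (LINT x|lborel. \<Phi>' x v)"
  proof (rule integral_dominated_convergence[where w="\<lambda>x. indicator K' x * B"])
    show "(\<lambda>x. \<Phi>' x v) \<in> borel_measurable lborel" using int by simp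
    show "q n \<in> borel_measurable lborel" for n
      unfolding q_def[abs_def]
      by (simp, intro borel_measurable_continuous_onI continuous_intros continuous_on_compose2[OF contP]) auto
    show "integrable lborel (\<lambda>x. indicator K' x * B)"
      using K' by (auto intro!: emeasure_compact_finite borel_compact integrable_mult_left)
    show "AE x in lborel. (\<lambda>n. q n x) \<longlonglongrightarrow> \<Phi>' x v"
    proof (rule AE_I2)
      fix x
      have "((\<lambda>t. norm (\<Phi> (x + t *\<^sub>R v) - \<Phi> x - t *\<^sub>R \<Phi>' x v) / norm t) \<longlongrightarrow> 0) (at 0)"
        using line[of x 0 UNIV] unfolding has_derivative_at by simp
      then have "((\<lambda>t. norm ((1 / t) *\<^sub>R (\<Phi> (x + t *\<^sub>R v) - \<Phi> x) - \<Phi>' x v)) \<longlongrightarrow> 0) (at 0)"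
      proof (rule Lim_transform_eventually)
        have "norm (\<Phi> (x + t *\<^sub>R v) - \<Phi> x - t *\<^sub>R \<Phi>' x v) / norm t
            = norm ((1 / t) *\<^sub>R (\<Phi> (x + t *\<^sub>R v) - \<Phi> x) - \<Phi>' x v)" if "t \<noteq> 0" for t
        proof -
          have "(1 / t) *\<^sub>R (\<Phi> (x + t *\<^sub>R v) - \<Phi> x) - \<Phi>' x v
              = (1 / t) *\<^sub>R (\<Phi> (x + t *\<^sub>R v) - \<Phi> x - t *\<^sub>R \<Phi>' x v)"
            using that by (simp add: scaleR_diff_right)
          then show ?thesis by simp
        qed
        then show "\<forall>\<^sub>F t in at 0. norm (\<Phi> (x + t *\<^sub>R v) - \<Phi> x - t *\<^sub>R \<Phi>' x v) / norm t
            = norm ((1 / t) *\<^sub>R (\<Phi> (x + t *\<^sub>R v) - \<Phi> x) - \<Phi>' x v)"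
          by (auto simp: eventually_at_filter)
      qed
      then have "((\<lambda>t. (1 / t) *\<^sub>R (\<Phi> (x + t *\<^sub>R v) - \<Phi> x)) \<longlongrightarrow> \<Phi>' x v) (at 0)"
        unfolding tendsto_norm_zero_iff by (rule LIM_zero_cancel)
      moreover have "filterlim h (at 0) sequentially"
        using LIMSEQ_inverse_real_of_nat h unfolding h_def by (auto simp: filterlim_at)
      ultimately show "(\<lambda>n. q n x) \<longlonglongrightarrow> \<Phi>' x v"
        unfolding q_def by (rule filterlim_compose)
    qed
    show "AE x in lborel. norm (q n x) \<le> indicator K' x * B" for n
    proof (rule AE_I2)
      fix x
      show "norm (q n x) \<le> indicator K' x * B"
      proof (cases "x \<in> K'")
        case True
        \<comment> \<open>The mean value inequality along the segment, with the bound on the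
          directional derivative.\<close>
        have "norm (\<Phi> (x + h n *\<^sub>R v) - \<Phi> (x + 0 *\<^sub>R v)) \<le> B * norm (h n - 0)"
        proof (rule differentiable_bound[OF convex_UNIV line])
          show "onorm (\<lambda>s. s *\<^sub>R \<Phi>' (x + t *\<^sub>R v) v) \<le> B" for t
            using B by (intro onorm_bound) (auto simp: mult.commute[of B] intro!: mult_left_mono)
        qed auto
        then show ?thesis
          using True h[of n] unfolding q_def norm_scaleR by (simp add: divide_simps)
      next
        case False
        have "x + t *\<^sub>R v \<notin> K" if "0 \<le> t" "t \<le> 1" for t
          using False that unfolding K'_def by (force simp: image_iff)
        from this[of 0] this[of "h n"] have "q n x = 0" using h[of n] K(2) by (simp add: q_def)
        then show ?thesis using False by simp
      qed
    qed
  qed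
  \<comment> \<open>The shifted and the unshifted function have the same integral, so each quotient
    integrates to zero.\<close>
  moreover have "(LINT x|lborel. q n x) = 0" for n
  proof -
    have [measurable]: "\<Phi> \<in> borel_measurable borel" using contP by (rule borel_measurable_continuous_onI)
    have "integrable lborel \<Phi>" using contP K by (rule integrable_compact_support)
    then show ?thesis
      unfolding q_def by (simp add: lborel_integral_shift lborel_integrable_shift)
  qed
  ultimately show "(LINT x|lborel. \<Phi>' x v) = 0" by (simp add: LIMSEQ_const_iff)
qed

text \<open>Polar coordinates with the angle already integrated out. Both measures give the
  half-line up to \<open>a\<close> the area \<open>pi * a\<^sup>2\<close> of a disc, and half-lines
  form a generator stable under intersection.\<close>

lemma distr_norm_complex:
  "distr lborel borel (norm :: complex \<Rightarrow> real) = density lborel (\<lambda>s. ennreal (2 * pi * s) * indicator {0..} s)"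
    (is "?M = ?N")
proof (rule measure_eqI_generator_eq)
  let ?E = "range (\<lambda>a::real. {..a})"
  show "Int_stable ?E" by (auto simp: Int_stable_def)
  show "?E \<subseteq> Pow UNIV" by simp
  show "sets ?M = sigma_sets UNIV ?E" "sets ?N = sigma_sets UNIV ?E"
    by (simp_all add: borel_eq_atMost)
  have M: "emeasure ?M {..a} = (if 0 \<le> a then ennreal (pi * a\<^sup>2) else 0)" for a
  proof -
    have "emeasure ?M {..a} = emeasure lborel (cball 0 a :: complex set)"
      by (subst emeasure_distr) (auto intro!: arg_cong[where f="emeasure lborel"])
    then show ?thesis
      by (auto simp: emeasure_cball unit_ball_vol_2)
  qed
  show "emeasure ?M X = emeasure ?N X" if X: "X \<in> ?E" for X
  proof -
    obtain a where a: "X = {..a}" using X by auto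
    have "emeasure ?N X = (\<integral>\<^sup>+s. ennreal (2 * pi * s) * indicator {0..a} s \<partial>lborel)"
      unfolding a by (subst emeasure_density) (auto intro!: nn_integral_cong simp: indicator_def)
    also have "\<dots> = (if 0 \<le> a then ennreal (pi * a\<^sup>2) else 0)"
    proof (cases "0 \<le> a")
      case True
      then show ?thesis
        by (subst nn_integral_FTC_Icc[where F="\<lambda>s. pi * s\<^sup>2"]) (auto intro!: derivative_eq_intros)
    qed simp
    finally show ?thesis using M a by simp
  qed
  show "range (\<lambda>i::nat. {..real i}) \<subseteq> ?E" by auto
  show "(\<Union>i::nat. {..real i}) = UNIV" using real_arch_simple by auto
  show "emeasure ?M {..real i} \<noteq> \<infinity>" for i by (simp add: M)
qed

lemma nn_integral_radial:
  assumes [measurable]: "F \<in> borel_measurable borel"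
  shows "(\<integral>\<^sup>+z. F (cmod z) \<partial>lborel) = (\<integral>\<^sup>+s. ennreal (2 * pi * s) * indicator {0..} s * F s \<partial>lborel)"
  using nn_integral_distr[of norm "lborel :: complex measure" borel F]
  by (simp add: distr_norm_complex nn_integral_density)

text \<open>Truncated at the diameter of the unit disc: integrable on the whole plane, and still equal to
  \<open>1 / (z - \<zeta>)\<close> for all \<open>z\<close>, \<open>\<zeta>\<close> in the disc.\<close>

definition cauchy_kernel :: "complex \<Rightarrow> complex" where
  "cauchy_kernel z = (if cmod z \<le> 2 then 1 / z else 0)"

lemma borel_measurable_cauchy_kernel [measurable]: "cauchy_kernel \<in> borel_measurable borel"
  unfolding cauchy_kernel_def[abs_def] by measurable

lemma integrable_cauchy_kernel: "integrable lborel cauchy_kernel"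
proof (rule integrableI_bounded)
  have "(\<integral>\<^sup>+z. ennreal (norm (cauchy_kernel z)) \<partial>lborel)
      = (\<integral>\<^sup>+z. ennreal (if cmod z \<le> 2 then 1 / cmod z else 0) \<partial>lborel)"
    by (intro nn_integral_cong) (simp add: cauchy_kernel_def norm_divide)
  also have "\<dots> = (\<integral>\<^sup>+s. ennreal (2 * pi * s) * indicator {0..} s * ennreal (if s \<le> 2 then 1 / s else 0) \<partial>lborel)"
    by (rule nn_integral_radial) measurable
  \<comment> \<open>The density s of the radial measure cancels the singularity 1/s, leaving a
    constant on a bounded interval.\<close>
  also have "\<dots> \<le> (\<integral>\<^sup>+s. ennreal (2 * pi) * indicator {0..2::real} s \<partial>lborel)"
    by (intro nn_integral_mono) (auto simp: indicator_def ennreal_mult[symmetric])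
  also have "\<dots> < \<infinity>"
    by (subst nn_integral_cmult) (auto simp: ennreal_mult_less_top)
  finally show "(\<integral>\<^sup>+z. ennreal (norm (cauchy_kernel z)) \<partial>lborel) < \<infinity>" .
qed simp

text \<open>Supplies the mass \<open>pi\<close> of the approximate identity in the Cauchy--Pompeiu
  formula; the radial integrand has the antiderivative
  \<open>- pi / (1 + s\<^sup>2)\<close>.\<close>

lemma has_bochner_integral_inverse_square:
  "has_bochner_integral lborel (\<lambda>z::complex. 1 / (1 + (cmod z)\<^sup>2)\<^sup>2) pi"
proof (rule has_bochner_integral_nn_integral)
  have "(\<integral>\<^sup>+z. ennreal (1 / (1 + (cmod z)\<^sup>2)\<^sup>2) \<partial>lborel)
      = (\<integral>\<^sup>+s. ennreal (2 * pi * s) * indicator {0..} s * ennreal (1 / (1 + s\<^sup>2)\<^sup>2) \<partial>lborel)"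
    by (rule nn_integral_radial) measurable
  also have "\<dots> = (\<integral>\<^sup>+s. ennreal (2 * pi * s / (1 + s\<^sup>2)\<^sup>2) * indicator {0..} s \<partial>lborel)"
    by (intro nn_integral_cong) (auto simp: indicator_def ennreal_mult[symmetric])
  also have "\<dots> = ennreal (0 - (- pi / (1 + 0\<^sup>2)))"
  proof (rule nn_integral_FTC_atLeast)
    fix s :: real assume "0 \<le> s"
    have nz: "1 + s\<^sup>2 \<noteq> 0" by (metis add_pos_nonneg less_irrefl zero_le_power2 zero_less_one)
    then show "((\<lambda>s. - pi / (1 + s\<^sup>2)) has_real_derivative 2 * pi * s / (1 + s\<^sup>2)\<^sup>2) (at s)"
      by (auto intro!: derivative_eq_intros simp: power2_eq_square)
    show "0 \<le> 2 * pi * s / (1 + s\<^sup>2)\<^sup>2" using \<open>0 \<le> s\<close> by simp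
  next
    have "filterlim (\<lambda>s::real. 1 + s\<^sup>2) at_top at_top"
      by (intro filterlim_tendsto_add_at_top[OF tendsto_const] filterlim_pow_at_top filterlim_ident) auto
    then show "((\<lambda>s. - pi / (1 + s\<^sup>2)) \<longlongrightarrow> 0) at_top"
      by (intro tendsto_divide_0[OF tendsto_const] filterlim_at_top_imp_at_infinity)
  qed measurable
  finally show "(\<integral>\<^sup>+z. ennreal (1 / (1 + (cmod z)\<^sup>2)\<^sup>2) \<partial>lborel) = ennreal pi" by simp
qed auto

text \<open>Integration by parts against \<open>cnj x / (|x|\<^sup>2 + d\<^sup>2)\<close>, whose \<open>\<partial>\<close>-bar derivative
  \<open>d\<^sup>2 / (|x|\<^sup>2 + d\<^sup>2)\<^sup>2\<close> is an approximate identity of mass \<open>pi\<close> as \<open>d\<close> tends to 0.\<close>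

lemma cauchy_pompeiu:
  fixes g :: "complex \<Rightarrow> complex"
  assumes deriv: "\<And>x. (g has_derivative g' x) (at x)"
    and cont': "continuous_on UNIV (\<lambda>x. g' x 1)" "continuous_on UNIV (\<lambda>x. g' x \<i>)"
    and off: "\<And>x. 2 < cmod x \<Longrightarrow> g x = 0"
  shows "(LINT x|lborel. cauchy_kernel x * ((g' x 1 + \<i> * g' x \<i>) / 2)) = - pi * g 0"
proof -
  define db where "db x = (g' x 1 + \<i> * g' x \<i>) / 2" for x
  have K: "compact (cball (0::complex) 2)" by simp
  have off': "x \<notin> cball 0 2 \<Longrightarrow> g x = 0" for x using off by simp
  have contg: "continuous_on UNIV g"
    using deriv by (intro continuous_at_imp_continuous_on) (auto intro: has_derivative_continuous)
  have contdb: "continuous_on UNIV db"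
    unfolding db_def[abs_def] using cont' by (intro continuous_intros) auto
  have db0: "db x = 0" if "x \<notin> cball 0 2" for x
  proof -
    have "(g has_derivative (\<lambda>_. 0)) (at x)"
      by (rule has_derivative_transform_within_open[OF has_derivative_const, of "- cball 0 2"])
        (use off' that in \<open>auto simp: open_Compl\<close>)
    then have "g' x = (\<lambda>_. 0)" using has_derivative_unique[OF deriv] by metis
    then show ?thesis by (simp add: db_def)
  qed
  obtain B where B: "B > 0" "\<And>x. cmod (db x) \<le> B"
    using bounded_compact_support[OF contdb K db0] by blast
  obtain C where C: "C > 0" "\<And>x. cmod (g x) \<le> C"
    using bounded_compact_support[OF contg K off'] by blast
  have [measurable]: "g \<in> borel_measurable borel" "db \<in> borel_measurable borel"
    using contg contdb by (auto intro: borel_measurable_continuous_onI)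
  define d where "d n = inverse (real (Suc n))" for n
  have d: "d n > 0" for n by (simp add: d_def)
  have dlim: "d \<longlonglongrightarrow> 0" unfolding d_def[abs_def] by (rule LIMSEQ_inverse_real_of_nat)
  \<comment> \<open>The squared modulus is written as \<open>x * cnj x\<close> so that it can be
    differentiated as a polynomial.\<close>
  define den where "den n x = x * cnj x + complex_of_real ((d n)\<^sup>2)" for n x
  have den_real: "den n x = complex_of_real ((cmod x)\<^sup>2 + (d n)\<^sup>2)" for n x
    by (simp only: den_def of_real_add complex_norm_square)
  have den: "den n x \<noteq> 0" for n x
    unfolding den_real using d[of n] by (simp add: add_nonneg_eq_0_iff del: of_real_add of_real_power)
  define \<Phi>' where "\<Phi>' n x h = cnj x / den n x * g' x h
      + (cnj h * den n x - cnj x * (h * cnj x + x * cnj h)) / (den n x * den n x) * g x" for n x h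
  have \<Phi>': "((\<lambda>x. cnj x / den n x * g x) has_derivative \<Phi>' n x) (at x)" for n x
  proof -
    have "((\<lambda>x. cnj x / den n x) has_derivative (\<lambda>h. (cnj h * den n x - cnj x * (h * cnj x + x * cnj h)) / (den n x * den n x))) (at x)"
      using den[of n x] unfolding den_def
      by (auto intro!: derivative_eq_intros simp: algebra_simps)
    from has_derivative_mult[OF this deriv] show ?thesis
      by (rule has_derivative_eq_rhs) (simp add: \<Phi>'_def fun_eq_iff)
  qed
  have contden: "continuous_on UNIV (den n)" for n unfolding den_def[abs_def] by (intro continuous_intros)
  have cont\<Phi>: "continuous_on UNIV (\<lambda>x. \<Phi>' n x 1)" "continuous_on UNIV (\<lambda>x. \<Phi>' n x \<i>)" for n
    unfolding \<Phi>'_def using den by (intro continuous_intros contden contg cont'; simp)+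
  \<comment> \<open>This is g times the barred derivative of \<open>cnj x / den n x\<close>: the
    quotient rule gives the numerator \<open>den n x - x * cnj x\<close>, which is
    \<open>(d n)\<^sup>2\<close>.\<close>
  define p where "p n x = complex_of_real ((d n)\<^sup>2) / (den n x)\<^sup>2 * g x" for n x
  have split: "(\<Phi>' n x 1 + \<i> * \<Phi>' n x \<i>) / 2 = cnj x / den n x * db x + p n x" for n x
  proof -
    have e: "complex_of_real ((d n)\<^sup>2) = den n x - x * cnj x" by (simp add: den_def)
    show ?thesis
      unfolding \<Phi>'_def db_def p_def e using den[of n x] by (simp add: field_simps power2_eq_square)
  qed
  have off\<Phi>: "cnj x / den n x * g x = 0" if "x \<notin> cball 0 2" for n x using off'[OF that] by simp
  have "((LINT x|lborel. \<Phi>' n x 1) + \<i> * (LINT x|lborel. \<Phi>' n x \<i>)) / 2 =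
      (LINT x|lborel. (\<Phi>' n x 1 + \<i> * \<Phi>' n x \<i>) / 2)" for n
    using integral_directional_derivative(1)[OF \<Phi>' cont\<Phi>(1) K off\<Phi>]
      integral_directional_derivative(1)[OF \<Phi>' cont\<Phi>(2) K off\<Phi>] by simp
  moreover have "(LINT x|lborel. \<Phi>' n x 1) = 0" "(LINT x|lborel. \<Phi>' n x \<i>) = 0" for n
    using integral_directional_derivative(2)[OF \<Phi>' cont\<Phi>(1) K off\<Phi>]
      integral_directional_derivative(2)[OF \<Phi>' cont\<Phi>(2) K off\<Phi>] by simp_all
  ultimately have 0: "(LINT x|lborel. cnj x / den n x * db x + p n x) = 0" for n
    unfolding split by (metis add.right_neutral div_0 mult_zero_right)
  have "integrable lborel (\<lambda>x. cnj x / den n x * db x)" "integrable lborel (p n)" for n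
    unfolding p_def[abs_def] using den
    by (intro integrable_compact_support[OF _ K] continuous_intros contden contdb contg;
        simp add: off' db0)+
  with 0 have ibp: "(LINT x|lborel. cnj x / den n x * db x) = - (LINT x|lborel. p n x)" for n
    by (simp add: Bochner_Integration.integral_add add_eq_0_iff2)
  have "(LINT x|lborel. p n x) = (LINT y|lborel. complex_of_real (1 / (1 + (cmod y)\<^sup>2)\<^sup>2) * g (d n *\<^sub>R y))" for n
  proof -
    have [measurable]: "p n \<in> borel_measurable borel"
      unfolding p_def[abs_def] den_def by measurable
    \<comment> \<open>Substituting \<open>d n *\<^sub>R y\<close> for \<open>x\<close> brings the
      factor \<open>(d n)\<^sup>2\<close> from the two real dimensions, which makes the kernel
      independent of \<open>n\<close>.\<close>
    have "(LINT x|lborel. p n x) = (LINT x|density (distr lborel borel (\<lambda>x::complex. 0 + d n *\<^sub>R x)) (\<lambda>_. ennreal (\<bar>d n\<bar> ^ DIM(complex))). p n x)"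
      by (subst lborel_affine[of "d n" 0, symmetric]) (use d[of n] in auto)
    also have "\<dots> = (LINT y|lborel. (d n)\<^sup>2 *\<^sub>R p n (d n *\<^sub>R y))"
      by (subst integral_density) (simp_all add: integral_distr)
    also have "\<dots> = (LINT y|lborel. complex_of_real (1 / (1 + (cmod y)\<^sup>2)\<^sup>2) * g (d n *\<^sub>R y))"
    proof (rule Bochner_Integration.integral_cong[OF refl])
      fix y
      have "den n (d n *\<^sub>R y) = complex_of_real ((d n)\<^sup>2 * (1 + (cmod y)\<^sup>2))"
        unfolding den_real by (simp add: power_mult_distrib algebra_simps)
      moreover have "(d n)\<^sup>2 * ((d n)\<^sup>2 / ((d n)\<^sup>2 * (1 + (cmod y)\<^sup>2))\<^sup>2) = 1 / (1 + (cmod y)\<^sup>2)\<^sup>2"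
      proof -
        have "a * (a / (a * b)\<^sup>2) = 1 / b\<^sup>2" if "a \<noteq> 0" for a b :: real
          using that by (simp add: power_mult_distrib power2_eq_square)
        from this[of "(d n)\<^sup>2" "1 + (cmod y)\<^sup>2"] d[of n] show ?thesis by (simp del: times_divide_eq_right)
      qed
      ultimately show "(d n)\<^sup>2 *\<^sub>R p n (d n *\<^sub>R y) = complex_of_real (1 / (1 + (cmod y)\<^sup>2)\<^sup>2) * g (d n *\<^sub>R y)"
        unfolding p_def scaleR_conv_of_real by (metis (no_types, lifting) mult.assoc of_real_divide of_real_mult of_real_power)
    qed
    finally show ?thesis .
  qed
  moreover have "(\<lambda>n. LINT y|lborel. complex_of_real (1 / (1 + (cmod y)\<^sup>2)\<^sup>2) * g (d n *\<^sub>R y))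
      \<longlonglongrightarrow> (LINT y|lborel. complex_of_real (1 / (1 + (cmod y)\<^sup>2)\<^sup>2) * g 0)"
  proof (rule integral_dominated_convergence[where w="\<lambda>y. 1 / (1 + (cmod y)\<^sup>2)\<^sup>2 * C"])
    show "integrable lborel (\<lambda>y::complex. 1 / (1 + (cmod y)\<^sup>2)\<^sup>2 * C)"
      using has_bochner_integral_inverse_square unfolding has_bochner_integral_iff by (intro integrable_mult_left) blast
    have "(\<lambda>n. g (d n *\<^sub>R y)) \<longlonglongrightarrow> g 0" for y
    proof -
      have "(\<lambda>n. d n *\<^sub>R y) \<longlonglongrightarrow> 0 *\<^sub>R y" by (intro tendsto_intros dlim)
      moreover have "isCont g 0" using contg by (simp add: continuous_on_eq_continuous_at)
      ultimately show ?thesis by (intro isCont_tendsto_compose[of 0 g]) auto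
    qed
    then show "AE y in lborel. (\<lambda>n. complex_of_real (1 / (1 + (cmod y)\<^sup>2)\<^sup>2) * g (d n *\<^sub>R y))
        \<longlonglongrightarrow> complex_of_real (1 / (1 + (cmod y)\<^sup>2)\<^sup>2) * g 0"
      by (intro AE_I2 tendsto_intros)
    show "AE y in lborel. norm (complex_of_real (1 / (1 + (cmod y)\<^sup>2)\<^sup>2) * g (d n *\<^sub>R y)) \<le> 1 / (1 + (cmod y)\<^sup>2)\<^sup>2 * C" for n
      unfolding norm_mult norm_of_real using C by (intro AE_I2 mult_mono) auto
  qed measurable
  moreover have "(LINT y|lborel. complex_of_real (1 / (1 + (cmod y)\<^sup>2)\<^sup>2) * g 0) = pi * g 0"
    using has_bochner_integral_inverse_square unfolding has_bochner_integral_iff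
    by (subst integral_mult_left_zero, subst integral_complex_of_real) simp
  ultimately have "(\<lambda>n. LINT x|lborel. cnj x / den n x * db x) \<longlonglongrightarrow> - (pi * g 0)"
    unfolding ibp by (intro tendsto_minus) simp
  moreover have "(\<lambda>n. LINT x|lborel. cnj x / den n x * db x) \<longlonglongrightarrow> (LINT x|lborel. cauchy_kernel x * db x)"
  proof (rule integral_dominated_convergence[where w="\<lambda>x. cmod (cauchy_kernel x) * B"])
    show "integrable lborel (\<lambda>x. cmod (cauchy_kernel x) * B)"
      using integrable_cauchy_kernel by (intro integrable_mult_left integrable_norm)
    show "AE x in lborel. (\<lambda>n. cnj x / den n x * db x) \<longlonglongrightarrow> cauchy_kernel x * db x"
    proof (rule AE_I2)
      fix x
      show "(\<lambda>n. cnj x / den n x * db x) \<longlonglongrightarrow> cauchy_kernel x * db x"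
      \<comment> \<open>At 0 both sides are 0, since division by zero makes
        \<open>cauchy_kernel 0\<close> equal to 0; outside the disc of radius 2 the factor
        \<open>db x\<close> vanishes, so the truncation of the kernel is invisible.\<close>
      proof (cases "x = 0 \<or> x \<notin> cball 0 2")
        case True
        then have "x = 0 \<or> db x = 0" using db0 by blast
        then show ?thesis by (auto simp: cauchy_kernel_def)
      next
        case False
        have "(\<lambda>n. den n x) \<longlonglongrightarrow> x * cnj x + complex_of_real (0\<^sup>2)"
          unfolding den_def by (intro tendsto_intros dlim)
        then have "(\<lambda>n. cnj x / den n x * db x) \<longlonglongrightarrow> cnj x / (x * cnj x + complex_of_real (0\<^sup>2)) * db x"
          using False by (intro tendsto_intros) auto
        then show ?thesis using False by (simp add: cauchy_kernel_def)
      qed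
    qed
    show "AE x in lborel. norm (cnj x / den n x * db x) \<le> cmod (cauchy_kernel x) * B" for n
    proof (rule AE_I2)
      fix x
      show "norm (cnj x / den n x * db x) \<le> cmod (cauchy_kernel x) * B"
      proof (cases "x = 0 \<or> x \<notin> cball 0 2")
        case True
        then have "x = 0 \<or> db x = 0" using db0 by blast
        then show ?thesis using B(1) by (auto simp: cauchy_kernel_def)
      next
        case False
        have "cmod (den n x) = (cmod x)\<^sup>2 + (d n)\<^sup>2"
          unfolding den_real norm_of_real by simp
        \<comment> \<open>Dropping \<open>(d n)\<^sup>2\<close> from the denominator only increases
          the quotient, so the kernel itself dominates all its regularizations.\<close>
        then have "cmod (cnj x / den n x) \<le> cmod x / (cmod x)\<^sup>2"
          unfolding norm_divide complex_mod_cnj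
          using False d[of n] by (intro divide_left_mono) (auto intro!: mult_pos_pos add_pos_pos)
        also have "\<dots> = cmod (cauchy_kernel x)"
          using False by (simp add: cauchy_kernel_def norm_divide power2_eq_square)
        finally show ?thesis unfolding norm_mult using B by (intro mult_mono) auto
      qed
    qed
    show "(\<lambda>x. cnj x / den n x * db x) \<in> borel_measurable lborel" for n
      unfolding den_def by measurable
  qed measurable
  ultimately have "(LINT x|lborel. cauchy_kernel x * db x) = - (pi * g 0)"
    by (rule LIMSEQ_unique[rotated])
  then show ?thesis unfolding db_def by (simp only: minus_mult_left of_real_minus)
qed

section \<open>Convolution along a subspace\<close>

text \<open>The map \<iota> places the integration variable in the space: a coordinate axis gives
  the transform in one variable, the sum of both axes the transform in both. All estimates are thus
  proved once.\<close>

definition convol ::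
    "('b::euclidean_space \<Rightarrow> 'a::euclidean_space) \<Rightarrow> ('b \<Rightarrow> complex) \<Rightarrow> ('a \<Rightarrow> complex) \<Rightarrow> 'a \<Rightarrow> complex" where
  "convol \<iota> \<kappa> F w = (LINT \<eta>|lborel. \<kappa> \<eta> * F (w - \<iota> \<eta>))"

lemma integrable_tensor:
  fixes \<kappa>1 :: "'b::euclidean_space \<Rightarrow> complex" and \<kappa>2 :: "'c::euclidean_space \<Rightarrow> complex"
  assumes "integrable lborel \<kappa>1" "integrable lborel \<kappa>2"
  shows "integrable lborel (\<lambda>\<eta>. \<kappa>1 (fst \<eta>) * \<kappa>2 (snd \<eta>))"
proof -
  have [measurable]: "\<kappa>1 \<in> borel_measurable borel" "\<kappa>2 \<in> borel_measurable borel"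
    using assms by (simp_all add: integrable_iff_bounded)
  have "integrable (lborel \<Otimes>\<^sub>M lborel) (\<lambda>\<eta>. \<kappa>1 (fst \<eta>) * \<kappa>2 (snd \<eta>))"
  proof (rule lborel_pair.Fubini_integrable)
    show "integrable lborel (\<lambda>x. LINT y|lborel. norm (\<kappa>1 (fst (x, y)) * \<kappa>2 (snd (x, y))))"
      using assms by (simp add: norm_mult)
    show "AE x in lborel. integrable lborel (\<lambda>y. \<kappa>1 (fst (x, y)) * \<kappa>2 (snd (x, y)))"
      using assms by simp
  qed measurable
  then show ?thesis by (simp add: lborel_prod)
qed

context
  fixes \<iota> :: "'b::euclidean_space \<Rightarrow> 'a::euclidean_space" and \<kappa> :: "'b \<Rightarrow> complex"
  assumes iota [measurable]: "\<iota> \<in> borel_measurable borel" and kappa: "integrable lborel \<kappa>"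
begin

private lemma kappa_borel: "\<kappa> \<in> borel_measurable borel"
  using kappa by (simp add: integrable_iff_bounded)

lemma borel_measurable_convol:
  assumes [measurable]: "F \<in> borel_measurable borel"
  shows "convol \<iota> \<kappa> F \<in> borel_measurable borel"
proof -
  note kappa_borel [measurable]
  have "(\<lambda>w. LINT \<eta>|lborel. \<kappa> \<eta> * F (w - \<iota> \<eta>)) \<in> borel_measurable borel"
    by (rule lborel.borel_measurable_lebesgue_integral) measurable
  then show ?thesis by (simp add: convol_def[abs_def])
qed

text \<open>Tonelli, then translation invariance for each fixed \<eta>: the shift by
  \<open>\<iota> \<eta>\<close> does not change the integral over \<open>w\<close>.\<close>

lemma nn_integral_convol:
  fixes f :: "'a \<Rightarrow> ennreal"
  assumes [measurable]: "f \<in> borel_measurable borel"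
  shows "(\<integral>\<^sup>+w. (\<integral>\<^sup>+\<eta>. ennreal (cmod (\<kappa> \<eta>)) * f (w - \<iota> \<eta>) \<partial>lborel) \<partial>lborel)
     = (\<integral>\<^sup>+\<eta>. cmod (\<kappa> \<eta>) \<partial>lborel) * (\<integral>\<^sup>+w. f w \<partial>lborel)"
proof -
  note kappa_borel [measurable]
  have "(\<integral>\<^sup>+w. (\<integral>\<^sup>+\<eta>. ennreal (cmod (\<kappa> \<eta>)) * f (w - \<iota> \<eta>) \<partial>lborel) \<partial>lborel)
      = (\<integral>\<^sup>+\<eta>. (\<integral>\<^sup>+w. ennreal (cmod (\<kappa> \<eta>)) * f (w - \<iota> \<eta>) \<partial>lborel) \<partial>lborel)"
    by (rule lborel_pair.Fubini'[symmetric]) measurable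
  also have "\<dots> = (\<integral>\<^sup>+\<eta>. ennreal (cmod (\<kappa> \<eta>)) * (\<integral>\<^sup>+w. f w \<partial>lborel) \<partial>lborel)"
    by (simp add: nn_integral_cmult lborel_nn_integral_shift)
  also have "\<dots> = (\<integral>\<^sup>+\<eta>. cmod (\<kappa> \<eta>) \<partial>lborel) * (\<integral>\<^sup>+w. f w \<partial>lborel)"
    by (rule nn_integral_multc) measurable
  finally show ?thesis .
qed

lemma integrable_convol_pair:
  assumes F: "integrable lborel F"
  shows "integrable (lborel \<Otimes>\<^sub>M lborel) (\<lambda>(w, \<eta>). \<kappa> \<eta> * F (w - \<iota> \<eta>))"
proof (rule integrableI_bounded)
  note kappa_borel [measurable]
  have [measurable]: "F \<in> borel_measurable borel" using F by (simp add: integrable_iff_bounded)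
  show "(\<lambda>(w, \<eta>). \<kappa> \<eta> * F (w - \<iota> \<eta>)) \<in> borel_measurable (lborel \<Otimes>\<^sub>M lborel)" by measurable
  have "(\<integral>\<^sup>+x. ennreal (norm (case x of (w, \<eta>) \<Rightarrow> \<kappa> \<eta> * F (w - \<iota> \<eta>))) \<partial>(lborel \<Otimes>\<^sub>M lborel))
     = (\<integral>\<^sup>+w. (\<integral>\<^sup>+\<eta>. ennreal (cmod (\<kappa> \<eta>)) * ennreal (cmod (F (w - \<iota> \<eta>))) \<partial>lborel) \<partial>lborel)"
    by (subst lborel.nn_integral_fst[symmetric]) (auto simp: norm_mult ennreal_mult)
  also have "\<dots> = (\<integral>\<^sup>+\<eta>. cmod (\<kappa> \<eta>) \<partial>lborel) * (\<integral>\<^sup>+w. cmod (F w) \<partial>lborel)"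
    by (rule nn_integral_convol) measurable
  also have "\<dots> < \<infinity>"
    using kappa F by (auto simp: integrable_iff_bounded ennreal_mult_less_top)
  finally show "(\<integral>\<^sup>+x. ennreal (norm (case x of (w, \<eta>) \<Rightarrow> \<kappa> \<eta> * F (w - \<iota> \<eta>))) \<partial>(lborel \<Otimes>\<^sub>M lborel)) < \<infinity>" .
qed

lemma integrable_convol:
  assumes F: "integrable lborel F"
  shows "AE w in lborel. integrable lborel (\<lambda>\<eta>. \<kappa> \<eta> * F (w - \<iota> \<eta>))" "integrable lborel (convol \<iota> \<kappa> F)"
  using lborel_pair.AE_integrable_fst[OF integrable_convol_pair[OF F]]
    lborel_pair.integrable_fst[OF integrable_convol_pair[OF F]]
  by (simp_all add: convol_def[abs_def])

text \<open>The translation moves onto \<phi> while the integral over \<eta> stays outside. This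
  order suits statements that hold for each fixed translate, such as those on derivatives in the
  other variable.\<close>

lemma integral_convol_mult:
  assumes F: "integrable lborel F" and [measurable]: "\<phi> \<in> borel_measurable borel"
    and bdd: "\<And>w. cmod (\<phi> w) \<le> B"
  shows "(LINT w|lborel. convol \<iota> \<kappa> F w * \<phi> w) = (LINT \<eta>|lborel. \<kappa> \<eta> * (LINT w|lborel. F w * \<phi> (w + \<iota> \<eta>)))"
proof -
  note kappa_borel [measurable]
  have [measurable]: "F \<in> borel_measurable borel" using F by (simp add: integrable_iff_bounded)
  have "integrable (lborel \<Otimes>\<^sub>M lborel) (\<lambda>(w, \<eta>). \<kappa> \<eta> * F (w - \<iota> \<eta>) * \<phi> w)"
  proof (rule Bochner_Integration.integrable_bound)
    show "integrable (lborel \<Otimes>\<^sub>M lborel) (\<lambda>x. B *\<^sub>R (case x of (w, \<eta>) \<Rightarrow> \<kappa> \<eta> * F (w - \<iota> \<eta>)))"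
      by (rule integrable_scaleR_right) (rule integrable_convol_pair[OF F])
    have B: "0 \<le> B" using bdd[of undefined] norm_ge_zero order_trans by blast
    show "AE x in lborel \<Otimes>\<^sub>M lborel. norm (case x of (w, \<eta>) \<Rightarrow> \<kappa> \<eta> * F (w - \<iota> \<eta>) * \<phi> w)
       \<le> norm (B *\<^sub>R (case x of (w, \<eta>) \<Rightarrow> \<kappa> \<eta> * F (w - \<iota> \<eta>)))"
    proof (rule AE_I2, clarify)
      fix w \<eta>
      have "(cmod (\<kappa> \<eta>) * cmod (F (w - \<iota> \<eta>))) * cmod (\<phi> w) \<le> (cmod (\<kappa> \<eta>) * cmod (F (w - \<iota> \<eta>))) * B"
        by (intro mult_left_mono bdd) simp
      then show "norm (\<kappa> \<eta> * F (w - \<iota> \<eta>) * \<phi> w) \<le> norm (B *\<^sub>R (\<kappa> \<eta> * F (w - \<iota> \<eta>)))"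
        using B by (simp add: norm_mult mult_ac)
    qed
  qed measurable
  note * = lborel_pair.integral_fst[OF this] lborel_pair.integral_snd[OF this]
  have "(LINT w|lborel. convol \<iota> \<kappa> F w * \<phi> w) = (LINT w|lborel. (LINT \<eta>|lborel. \<kappa> \<eta> * F (w - \<iota> \<eta>) * \<phi> w))"
    by (simp add: convol_def)
  also have "\<dots> = (LINT \<eta>|lborel. (LINT w|lborel. \<kappa> \<eta> * F (w - \<iota> \<eta>) * \<phi> w))"
    using * by simp
  also have "\<dots> = (LINT \<eta>|lborel. \<kappa> \<eta> * (LINT w|lborel. F w * \<phi> (w + \<iota> \<eta>)))"
  proof (rule Bochner_Integration.integral_cong[OF refl])
    fix \<eta>
    have "(LINT w|lborel. F w * \<phi> (w + \<iota> \<eta>)) = (LINT w|lborel. F (w - \<iota> \<eta>) * \<phi> ((w - \<iota> \<eta>) + \<iota> \<eta>))"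
      by (rule lborel_integral_shift(2)[symmetric]) measurable
    then show "(LINT w|lborel. \<kappa> \<eta> * F (w - \<iota> \<eta>) * \<phi> w) = \<kappa> \<eta> * (LINT w|lborel. F w * \<phi> (w + \<iota> \<eta>))"
      by (simp add: mult.assoc)
  qed
  finally show ?thesis .
qed

text \<open>The opposite order: for each fixed \<open>w\<close> the kernel is integrated against
  \<phi>, which is the form to which the Cauchy--Pompeiu formula applies.\<close>

lemma integral_convol_mult':
  assumes F: "integrable lborel F" and [measurable]: "\<phi> \<in> borel_measurable borel"
    and bdd: "\<And>w. cmod (\<phi> w) \<le> B"
  shows "(LINT w|lborel. convol \<iota> \<kappa> F w * \<phi> w) = (LINT w|lborel. F w * (LINT \<eta>|lborel. \<kappa> \<eta> * \<phi> (w + \<iota> \<eta>)))"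
proof -
  note kappa_borel [measurable]
  have [measurable]: "F \<in> borel_measurable borel" using F by (simp add: integrable_iff_bounded)
  have "integrable (lborel \<Otimes>\<^sub>M lborel) (\<lambda>(w, \<eta>). \<kappa> \<eta> * (F w * \<phi> (w + \<iota> \<eta>)))"
  proof (rule Bochner_Integration.integrable_bound)
    show "integrable (lborel \<Otimes>\<^sub>M lborel) (\<lambda>x. B *\<^sub>R (F (fst x) * \<kappa> (snd x)))"
      unfolding lborel_prod by (rule integrable_scaleR_right) (rule integrable_tensor[OF F kappa])
    have B: "0 \<le> B" using bdd[of undefined] norm_ge_zero order_trans by blast
    show "AE x in lborel \<Otimes>\<^sub>M lborel. norm (case x of (w, \<eta>) \<Rightarrow> \<kappa> \<eta> * (F w * \<phi> (w + \<iota> \<eta>)))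
       \<le> norm (B *\<^sub>R (F (fst x) * \<kappa> (snd x)))"
    proof (rule AE_I2, clarify)
      fix w \<eta>
      have "(cmod (\<kappa> \<eta>) * cmod (F w)) * cmod (\<phi> (w + \<iota> \<eta>)) \<le> (cmod (\<kappa> \<eta>) * cmod (F w)) * B"
        by (intro mult_left_mono bdd) simp
      then show "norm (\<kappa> \<eta> * (F w * \<phi> (w + \<iota> \<eta>))) \<le> norm (B *\<^sub>R (F (fst (w, \<eta>)) * \<kappa> (snd (w, \<eta>))))"
        using B by (simp add: norm_mult mult_ac)
    qed
  qed measurable
  note * = lborel_pair.integral_fst[OF this] lborel_pair.integral_snd[OF this]
  have "(LINT w|lborel. convol \<iota> \<kappa> F w * \<phi> w) = (LINT \<eta>|lborel. (LINT w|lborel. \<kappa> \<eta> * (F w * \<phi> (w + \<iota> \<eta>))))"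
    using integral_convol_mult[OF assms] by simp
  also have "\<dots> = (LINT w|lborel. (LINT \<eta>|lborel. \<kappa> \<eta> * (F w * \<phi> (w + \<iota> \<eta>))))"
    unfolding * ..
  also have "\<dots> = (LINT w|lborel. F w * (LINT \<eta>|lborel. \<kappa> \<eta> * \<phi> (w + \<iota> \<eta>)))"
    by (simp add: mult.left_commute[of "\<kappa> _" "F _"])
  finally show ?thesis .
qed

text \<open>With \<open>t\<^sup>p\<close> the integral of \<open>|\<kappa>| |F|\<^sup>p\<close>, the bound \<open>x \<le> t + t x\<^sup>p / t\<^sup>p\<close> replaces Hoelder's inequality.\<close>

lemma convol_powr_le:
  assumes [measurable]: "F \<in> borel_measurable borel" and p: "1 \<le> p"
    and M: "(\<integral>\<^sup>+\<eta>. cmod (\<kappa> \<eta>) \<partial>lborel) = ennreal M" "0 \<le> M"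
  shows "ennreal (cmod (convol \<iota> \<kappa> F w) powr p)
    \<le> ennreal ((M + 1) powr p) * (\<integral>\<^sup>+\<eta>. ennreal (cmod (\<kappa> \<eta>)) * ennreal (cmod (F (w - \<iota> \<eta>)) powr p) \<partial>lborel)"
    (is "?l \<le> ?c * ?A")
proof (cases "integrable lborel (\<lambda>\<eta>. \<kappa> \<eta> * F (w - \<iota> \<eta>))")
  \<comment> \<open>A divergent integral has the value 0, so the left side vanishes.\<close>
  case False
  then show ?thesis by (simp add: convol_def not_integrable_integral_eq)
next
  case True
  note kappa_borel [measurable]
  consider "?A = \<infinity>" | "?A = 0" | A where "?A = ennreal A" "0 < A"
    by (cases ?A) (auto simp: less_le)
  then show ?thesis
  proof cases
    \<comment> \<open>An infinite integral makes the right side infinite only if the constant is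
      nonzero; \<open>M + 1\<close> guarantees this even for a kernel of mass 0.\<close>
    case 1
    have "?c \<noteq> 0" using M by simp
    then show ?thesis using 1 by (simp add: ennreal_mult_top)
  next
    case 2
    have "AE \<eta> in lborel. ennreal (cmod (\<kappa> \<eta>)) * ennreal (cmod (F (w - \<iota> \<eta>)) powr p) = 0"
      using 2 by (subst (asm) nn_integral_0_iff_AE) auto
    then have "AE \<eta> in lborel. \<kappa> \<eta> * F (w - \<iota> \<eta>) = 0" by eventually_elim auto
    then have "convol \<iota> \<kappa> F w = 0" unfolding convol_def by (rule integral_eq_zero_AE)
    then show ?thesis by simp
  next
    case 3
    define t where "t = A powr (1 / p)"
    have t: "t > 0" "t powr p = A" using 3 p by (auto simp: t_def powr_powr)
    have young: "x \<le> t + (t / A) * x powr p" if "0 \<le> x" for x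
    proof (cases "x \<le> t")
      case False
      then have "1 \<le> x / t" using t by simp
      then have "x / t \<le> (x / t) powr p"
        using powr_mono[of 1 p "x / t"] p t that by simp
      also have "\<dots> = x powr p / A" using t that by (simp add: powr_divide)
      finally show ?thesis using t by (simp add: field_simps)
    qed (use 3 t in \<open>simp add: add_increasing2\<close>)
    have "ennreal (cmod (convol \<iota> \<kappa> F w)) \<le> (\<integral>\<^sup>+\<eta>. cmod (\<kappa> \<eta> * F (w - \<iota> \<eta>)) \<partial>lborel)"
      unfolding convol_def by (rule integral_norm_bound_ennreal[OF True])
    also have "\<dots> \<le> (\<integral>\<^sup>+\<eta>. ennreal t * ennreal (cmod (\<kappa> \<eta>)) +
        ennreal (t / A) * (ennreal (cmod (\<kappa> \<eta>)) * ennreal (cmod (F (w - \<iota> \<eta>)) powr p)) \<partial>lborel)"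
    proof (rule nn_integral_mono)
      fix \<eta>
      have "cmod (\<kappa> \<eta>) * cmod (F (w - \<iota> \<eta>)) \<le> cmod (\<kappa> \<eta>) * (t + (t / A) * cmod (F (w - \<iota> \<eta>)) powr p)"
        by (intro mult_left_mono young) auto
      then show "ennreal (cmod (\<kappa> \<eta> * F (w - \<iota> \<eta>))) \<le> ennreal t * ennreal (cmod (\<kappa> \<eta>)) +
        ennreal (t / A) * (ennreal (cmod (\<kappa> \<eta>)) * ennreal (cmod (F (w - \<iota> \<eta>)) powr p))"
        using t 3 by (simp add: norm_mult ennreal_mult[symmetric] ennreal_plus[symmetric] algebra_simps del: ennreal_plus)
    qed
    \<comment> \<open>The weight \<open>t / A\<close> turns the second integral into
      \<open>t\<close>, so the two contributions add up to \<open>t * (M + 1)\<close>.\<close>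
    also have "\<dots> = ennreal t * ennreal M + ennreal (t / A) * ennreal A"
      by (simp add: nn_integral_add nn_integral_cmult M(1) 3(1))
    also have "\<dots> = ennreal (t * (M + 1))"
      using t 3 M by (simp add: ennreal_mult[symmetric] ennreal_plus[symmetric] algebra_simps del: ennreal_plus)
    finally have "cmod (convol \<iota> \<kappa> F w) \<le> t * (M + 1)"
      using t M by (simp add: ennreal_le_iff)
    then have "cmod (convol \<iota> \<kappa> F w) powr p \<le> (t * (M + 1)) powr p"
      using p by (intro powr_mono2) auto
    also have "\<dots> = (M + 1) powr p * A" using t M by (simp add: powr_mult)
    finally show ?thesis using 3 by (simp add: ennreal_mult[symmetric] ennreal_leI)
  qed
qed

text \<open>The elementary pointwise bound gives \<open>(M + 1) powr p * M\<close> in place of the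
  sharp \<open>M powr p\<close> of Young's inequality; what matters below is that the constant is
  finite and independent of \<open>F\<close>.\<close>

lemma nn_integral_convol_powr_le:
  assumes [measurable]: "F \<in> borel_measurable borel" and p: "1 \<le> p"
    and M: "(\<integral>\<^sup>+\<eta>. cmod (\<kappa> \<eta>) \<partial>lborel) = ennreal M" "0 \<le> M"
  shows "(\<integral>\<^sup>+w. cmod (convol \<iota> \<kappa> F w) powr p \<partial>lborel)
    \<le> ennreal ((M + 1) powr p * M) * (\<integral>\<^sup>+w. cmod (F w) powr p \<partial>lborel)"
proof -
  note kappa_borel [measurable]
  have "(\<integral>\<^sup>+w. cmod (convol \<iota> \<kappa> F w) powr p \<partial>lborel) \<le> (\<integral>\<^sup>+w. ennreal ((M + 1) powr p) *
      (\<integral>\<^sup>+\<eta>. ennreal (cmod (\<kappa> \<eta>)) * ennreal (cmod (F (w - \<iota> \<eta>)) powr p) \<partial>lborel) \<partial>lborel)"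
    by (intro nn_integral_mono convol_powr_le assms)
  also have "\<dots> = ennreal ((M + 1) powr p) * (\<integral>\<^sup>+w.
      (\<integral>\<^sup>+\<eta>. ennreal (cmod (\<kappa> \<eta>)) * ennreal (cmod (F (w - \<iota> \<eta>)) powr p) \<partial>lborel) \<partial>lborel)"
    by (rule nn_integral_cmult) measurable
  also have "\<dots> = ennreal ((M + 1) powr p) * (ennreal M * (\<integral>\<^sup>+w. cmod (F w) powr p \<partial>lborel))"
    by (subst nn_integral_convol[of "\<lambda>x. ennreal (cmod (F x) powr p)"]) (simp_all add: M(1))
  finally show ?thesis
    unfolding ennreal_mult[OF powr_ge_zero M(2)] mult.assoc .
qed

end

text \<open>Fubini at every \<open>w\<close> where the double integral converges absolutely, which
  integrability of \<open>G\<close> gives for almost all \<open>w\<close>. Both orders are recorded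
  because each of the two equations wants the transform in its own variable outermost.\<close>

lemma convol_tensor:
  fixes \<iota>1 :: "'b::euclidean_space \<Rightarrow> 'a::euclidean_space" and \<iota>2 :: "'c::euclidean_space \<Rightarrow> 'a"
  assumes "integrable lborel \<kappa>1" "integrable lborel \<kappa>2"
    and [measurable]: "\<iota>1 \<in> borel_measurable borel" "\<iota>2 \<in> borel_measurable borel"
    and G: "integrable lborel G"
  shows "AE w in lborel. convol (\<lambda>\<eta>. \<iota>1 (fst \<eta>) + \<iota>2 (snd \<eta>)) (\<lambda>\<eta>. \<kappa>1 (fst \<eta>) * \<kappa>2 (snd \<eta>)) G w
      = convol \<iota>1 \<kappa>1 (convol \<iota>2 \<kappa>2 G) w"
    and "AE w in lborel. convol (\<lambda>\<eta>. \<iota>1 (fst \<eta>) + \<iota>2 (snd \<eta>)) (\<lambda>\<eta>. \<kappa>1 (fst \<eta>) * \<kappa>2 (snd \<eta>)) G w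
      = convol \<iota>2 \<kappa>2 (convol \<iota>1 \<kappa>1 G) w"
proof -
  have "(\<lambda>\<eta>. \<iota>1 (fst \<eta>) + \<iota>2 (snd \<eta>)) \<in> borel_measurable borel"
    unfolding borel_prod[symmetric] by measurable
  from integrable_convol(1)[OF this integrable_tensor[OF assms(1,2)] G]
  have int: "AE w in lborel. integrable (lborel \<Otimes>\<^sub>M lborel)
      (\<lambda>(a, b). \<kappa>1 a * \<kappa>2 b * G (w - (\<iota>1 a + \<iota>2 b)))"
    by (simp add: lborel_prod case_prod_unfold)
  show "AE w in lborel. convol (\<lambda>\<eta>. \<iota>1 (fst \<eta>) + \<iota>2 (snd \<eta>)) (\<lambda>\<eta>. \<kappa>1 (fst \<eta>) * \<kappa>2 (snd \<eta>)) G w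
      = convol \<iota>1 \<kappa>1 (convol \<iota>2 \<kappa>2 G) w"
    using int
  proof eventually_elim
    case (elim w)
    have eq: "\<kappa>1 a * \<kappa>2 b * G (w - (\<iota>1 a + \<iota>2 b)) = \<kappa>1 a * (\<kappa>2 b * G (w - \<iota>1 a - \<iota>2 b))" for a b
      by (simp add: algebra_simps)
    have "convol (\<lambda>\<eta>. \<iota>1 (fst \<eta>) + \<iota>2 (snd \<eta>)) (\<lambda>\<eta>. \<kappa>1 (fst \<eta>) * \<kappa>2 (snd \<eta>)) G w
        = (LINT p|(lborel \<Otimes>\<^sub>M lborel). (case p of (a, b) \<Rightarrow> \<kappa>1 a * \<kappa>2 b * G (w - (\<iota>1 a + \<iota>2 b))))"
      by (simp only: convol_def lborel_prod case_prod_unfold)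
    also have "\<dots> = convol \<iota>1 \<kappa>1 (convol \<iota>2 \<kappa>2 G) w"
      using lborel_pair.integral_fst[OF elim, symmetric]
      by (simp only: eq integral_mult_right_zero convol_def)
    finally show ?case .
  qed
  show "AE w in lborel. convol (\<lambda>\<eta>. \<iota>1 (fst \<eta>) + \<iota>2 (snd \<eta>)) (\<lambda>\<eta>. \<kappa>1 (fst \<eta>) * \<kappa>2 (snd \<eta>)) G w
      = convol \<iota>2 \<kappa>2 (convol \<iota>1 \<kappa>1 G) w"
    using int
  proof eventually_elim
    case (elim w)
    have eq: "\<kappa>1 a * \<kappa>2 b * G (w - (\<iota>1 a + \<iota>2 b)) = \<kappa>2 b * (\<kappa>1 a * G (w - \<iota>2 b - \<iota>1 a))" for a b
      by (simp add: algebra_simps)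
    have "convol (\<lambda>\<eta>. \<iota>1 (fst \<eta>) + \<iota>2 (snd \<eta>)) (\<lambda>\<eta>. \<kappa>1 (fst \<eta>) * \<kappa>2 (snd \<eta>)) G w
        = (LINT p|(lborel \<Otimes>\<^sub>M lborel). (case p of (a, b) \<Rightarrow> \<kappa>1 a * \<kappa>2 b * G (w - (\<iota>1 a + \<iota>2 b))))"
      by (simp only: convol_def lborel_prod case_prod_unfold)
    also have "\<dots> = convol \<iota>2 \<kappa>2 (convol \<iota>1 \<kappa>1 G) w"
      using lborel_pair.integral_snd[OF elim, symmetric]
      by (simp only: eq integral_mult_right_zero convol_def)
    finally show ?case .
  qed
qed

section \<open>Weak derivatives of Cauchy transforms\<close>

definition coord :: "nat \<Rightarrow> complex \<times> complex \<Rightarrow> complex" where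
  "coord j w = (if j = 1 then fst w else snd w)"

lemma coord_simps [simp]: "coord (Suc 0) w = fst w" "coord 2 w = snd w"
  by (simp_all add: coord_def)

lemma coord_add_axis: "coord j (w + coord_axis j t) = coord j w + t"
  by (simp add: coord_def coord_axis_def)

text \<open>Every index other than 1 stands for the second variable, so
  \<open>(i = 1) \<noteq> (j = 1)\<close> says that the two indices name different
  variables.\<close>

lemma coord_add_other_axis: "(i = 1) \<noteq> (j = 1) \<Longrightarrow> coord i (w + coord_axis j t) = coord i w"
  by (auto simp: coord_def coord_axis_def)

lemma coord_diff_other_axis: "(i = 1) \<noteq> (j = 1) \<Longrightarrow> coord i (w - coord_axis j t) = coord i w"
  by (auto simp: coord_def coord_axis_def)

lemma bounded_linear_coord: "bounded_linear (coord j)"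
  by (cases "j = 1") (simp_all add: coord_def[abs_def] bounded_linear_fst bounded_linear_snd)

lemma bounded_linear_coord_axis: "bounded_linear (coord_axis j)"
  by (cases "j = 1")
    (auto simp: coord_axis_def[abs_def] intro!: bounded_linear_Pair bounded_linear_ident bounded_linear_zero)

lemma borel_measurable_coord_axis [measurable]: "coord_axis j \<in> borel_measurable borel"
  by (intro borel_measurable_continuous_onI linear_continuous_on bounded_linear_coord_axis)

text \<open>The cutoffs below vanish on this hyperplane, also for the first variable, whose disc is
  not punctured. Being a null set it does not disturb their limit.\<close>

lemma AE_coord_neq_0: "AE w in lborel. coord j w \<noteq> 0"
proof (cases "j = 1")
  case True
  have "(1, 0) \<in> (Basis :: (complex \<times> complex) set)" by (simp add: Basis_prod_def Basis_complex_def)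
  from AE_lborel_inner_neq[OF this, of 0] True show ?thesis
    by (auto simp: coord_def inner_prod_def inner_complex_def)
next
  case False
  have "(0, 1) \<in> (Basis :: (complex \<times> complex) set)" by (simp add: Basis_prod_def Basis_complex_def)
  from AE_lborel_inner_neq[OF this, of 0] False show ?thesis
    by (auto simp: coord_def inner_prod_def inner_complex_def)
qed

text \<open>For functions supported in the bidisc, and at points of the bidisc, this is
  \<open>pi\<close> times the solid Cauchy transform S_j; the constant is divided out in
  \<open>cauchy_solution\<close>.\<close>

definition cauchy_transform :: "nat \<Rightarrow> cfun2 \<Rightarrow> cfun2" where
  "cauchy_transform j = convol (coord_axis j) cauchy_kernel"

lemma test_function_bounded:
  fixes \<psi> :: cfun2
  assumes "\<psi> \<in> test_functions \<Omega>"
  shows "\<exists>B. \<forall>z. cmod (\<psi> z) \<le> B"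
  using assms
proof (rule test_functionsE)
  fix K assume K: "\<And>k. C_k k \<psi>" "compact K" "\<And>z. z \<notin> K \<Longrightarrow> \<psi> z = 0"
  show ?thesis
    using bounded_compact_support[OF C_k_continuous_on[OF K(1)] K(2,3)] by metis
qed

lemma borel_measurable_test_function:
  fixes \<psi> :: cfun2
  shows "\<psi> \<in> test_functions \<Omega> \<Longrightarrow> \<psi> \<in> borel_measurable borel"
  by (erule test_functionsE) (intro borel_measurable_continuous_onI C_k_continuous_on)

lemma wirtinger_bar_test_function:
  fixes \<psi> :: cfun2
  assumes "\<psi> \<in> test_functions \<Omega>" shows "wirtinger_bar j \<psi> \<in> test_functions \<Omega>"
  using assms
proof (rule test_functionsE)
  fix K assume K: "\<And>k. C_k k \<psi>" "compact K" "K \<subseteq> \<Omega>" "\<And>z. z \<notin> K \<Longrightarrow> \<psi> z = 0"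
  show ?thesis
    by (rule test_functionsI[OF C_k_wirtinger_bar[OF K(1)] K(2,3)])
      (rule wirtinger_zero_outside(1)[OF compact_imp_closed[OF K(2)] K(4)])
qed

text \<open>Moving the kernel to the test function reduces the claim to the Cauchy--Pompeiu formula
  in the j-th variable. Only the j-th coordinate of the support of \<open>F\<close> is restricted,
  so \<open>F\<close> may itself be a Cauchy transform in the other variable.\<close>

lemma integral_cauchy_transform_wirtinger_bar:
  fixes \<psi> :: cfun2
  assumes F: "integrable lborel F" "\<And>w. 1 \<le> cmod (coord j w) \<Longrightarrow> F w = 0"
    and \<psi>: "\<psi> \<in> test_functions \<Omega>" "\<Omega> \<subseteq> {w. cmod (coord j w) < 1}"
  shows "(LINT w|lborel. cauchy_transform j F w * wirtinger_bar j \<psi> w) = - pi * (LINT w|lborel. F w * \<psi> w)"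
proof -
  note w\<psi> = wirtinger_bar_test_function[OF \<psi>(1), of j]
  obtain B where B: "\<And>z. cmod (wirtinger_bar j \<psi> z) \<le> B"
    using test_function_bounded[OF w\<psi>] by blast
  obtain K where K: "\<And>k. C_k k \<psi>" "compact K" "K \<subseteq> \<Omega>" "\<And>z. z \<notin> K \<Longrightarrow> \<psi> z = 0"
    using test_functionsE[OF \<psi>(1)] by blast
  have diff: "\<psi> differentiable (at z)" for z by (rule C_k_differentiable[OF K(1)])
  have inner: "(LINT \<eta>|lborel. cauchy_kernel \<eta> * wirtinger_bar j \<psi> (w + coord_axis j \<eta>)) = - pi * \<psi> w"
    if w: "cmod (coord j w) < 1" for w
  proof -
    let ?g' = "\<lambda>t h. frechet_derivative \<psi> (at (w + coord_axis j t)) (coord_axis j h)"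
    have "(LINT \<eta>|lborel. cauchy_kernel \<eta> * ((?g' \<eta> 1 + \<i> * ?g' \<eta> \<i>) / 2)) = - pi * \<psi> (w + coord_axis j 0)"
    proof (rule cauchy_pompeiu)
      show "((\<lambda>t. \<psi> (w + coord_axis j t)) has_derivative ?g' t) (at t)" for t
      proof -
        have "((\<lambda>t. w + coord_axis j t) has_derivative coord_axis j) (at t)"
          using has_derivative_add[OF has_derivative_const bounded_linear_imp_has_derivative[OF bounded_linear_coord_axis]]
          by simp
        from has_derivative_compose[OF this, of \<psi>] show ?thesis
          using diff[unfolded frechet_derivative_works] by simp
      qed
      have "continuous_on UNIV (\<lambda>t. ?g' t h)" for h
        using C_k_compose_affine[OF bounded_linear_coord_axis C_k_frechet[OF K(1)]]
        by (rule C_k_continuous_on)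
      then show "continuous_on UNIV (\<lambda>t. ?g' t 1)" "continuous_on UNIV (\<lambda>t. ?g' t \<i>)" by auto
      \<comment> \<open>Both \<open>w\<close> and every point of the support of \<psi> have j-th
        coordinate in the unit disc, so these coordinates differ by less than the diameter
        2.\<close>
      show "\<psi> (w + coord_axis j t) = 0" if "2 < cmod t" for t
      proof (rule K(4), rule notI)
        assume "w + coord_axis j t \<in> K"
        then have "w + coord_axis j t \<in> {w. cmod (coord j w) < 1}" using K(3) \<psi>(2) by blast
        then have "cmod (coord j w + t) < 1" by (simp add: coord_add_axis)
        moreover have "cmod t \<le> cmod (coord j w + t) + cmod (coord j w)"
          by (metis add_diff_cancel_left' norm_triangle_ineq4)
        ultimately show False using that w by simp
      qed
    qed
    then show ?thesis
      using linear_0[OF bounded_linear.linear[OF bounded_linear_coord_axis]] by (simp add: wirtinger_bar_def)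
  qed
  have "(LINT w|lborel. cauchy_transform j F w * wirtinger_bar j \<psi> w)
      = (LINT w|lborel. F w * (LINT \<eta>|lborel. cauchy_kernel \<eta> * wirtinger_bar j \<psi> (w + coord_axis j \<eta>)))"
    unfolding cauchy_transform_def
    by (rule integral_convol_mult'[OF borel_measurable_coord_axis integrable_cauchy_kernel F(1) borel_measurable_test_function[OF w\<psi>] B])
  also have "\<dots> = (LINT w|lborel. - pi * (F w * \<psi> w))"
  proof (rule Bochner_Integration.integral_cong[OF refl])
    show "F w * (LINT \<eta>|lborel. cauchy_kernel \<eta> * wirtinger_bar j \<psi> (w + coord_axis j \<eta>)) = - pi * (F w * \<psi> w)" for w
      using inner[of w] F(2)[of w] by (cases "cmod (coord j w) < 1") (simp_all add: not_less)
  qed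
  finally show ?thesis by (simp only: integral_mult_right_zero)
qed

text \<open>With \<open>n < 2\<close> in place of \<open>n + 2\<close>, both factors could be negative at the same point.\<close>

definition cutoff :: "nat \<Rightarrow> nat \<Rightarrow> complex \<times> complex \<Rightarrow> real" where
  "cutoff n j w = exp_bump 0 ((real (n + 2) * (cmod (coord j w))\<^sup>2 - 1) * (1 - (cmod (coord j w))\<^sup>2 - 1 / real (n + 2)))"

lemma C_k_cutoff: "C_k k (cutoff n j)"
proof -
  \<comment> \<open>The norm is not differentiable at 0, but its square is a polynomial in the real
    coordinates.\<close>
  have sq: "(cmod z)\<^sup>2 = Re z * Re z + Im z * Im z" for z by (simp only: cmod_power2) (simp only: power2_eq_square)
  note C_k_linear_compose[OF bounded_linear_Re C_k_bounded_linear[OF bounded_linear_coord]]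
    C_k_linear_compose[OF bounded_linear_Im C_k_bounded_linear[OF bounded_linear_coord]]
  then show ?thesis
    unfolding cutoff_def[abs_def] sq by (intro C_k_exp_bump C_k_mult C_k_diff C_k_add C_k_const)
qed

lemma cutoff_bounds: "0 \<le> cutoff n j w" "cutoff n j w \<le> 1"
  by (simp_all add: cutoff_def exp_bump_0)

lemma cutoff_support:
  assumes "cutoff n j w \<noteq> 0"
  shows "1 / real (n + 2) \<le> (cmod (coord j w))\<^sup>2" "(cmod (coord j w))\<^sup>2 \<le> 1 - 1 / real (n + 2)"
proof -
  let ?t = "(cmod (coord j w))\<^sup>2" and ?m = "real (n + 2)"
  have m: "?m \<ge> 2" by simp
  have "0 < (?m * ?t - 1) * (1 - ?t - 1 / ?m)"
    using assms unfolding cutoff_def exp_bump_0 by linarith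
  then have "0 < ?m * ?t - 1 \<and> 0 < 1 - ?t - 1 / ?m \<or> ?m * ?t - 1 < 0 \<and> 1 - ?t - 1 / ?m < 0"
    by (simp only: zero_less_mult_iff)
  \<comment> \<open>Two negative factors would mean 1 - 1/m < |w_j|^2 < 1/m, which 1/m <= 1/2
    excludes.\<close>
  moreover have "1 / ?m \<le> 1 / 2" using m by (intro divide_left_mono) auto
  moreover have "?m * ?t - 1 < 0 \<longleftrightarrow> ?t < 1 / ?m" "0 < ?m * ?t - 1 \<longleftrightarrow> 1 / ?m < ?t"
    using m by (simp_all add: field_simps)
  ultimately show "1 / ?m \<le> ?t" "?t \<le> 1 - 1 / ?m" by linarith+
qed

text \<open>The first factor of the argument tends to infinity and the second to the positive number
  1 - |w_j|^2, so the argument tends to infinity and its bump to 1.\<close>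

lemma cutoff_tendsto:
  assumes "coord j w \<noteq> 0" "cmod (coord j w) < 1"
  shows "(\<lambda>n. cutoff n j w) \<longlonglongrightarrow> 1"
proof -
  let ?t = "(cmod (coord j w))\<^sup>2"
  have t: "0 < ?t" "?t < 1" using assms by (simp_all add: abs_square_less_1)
  have n: "filterlim (\<lambda>n. real (n + 2)) at_top sequentially"
    by (rule filterlim_compose[OF filterlim_real_sequentially filterlim_add_const_nat_at_top])
  define q where "q n = (real (n + 2) * ?t - 1) * (1 - ?t - 1 / real (n + 2))" for n
  have "(\<lambda>n. 1 / real (n + 2)) \<longlonglongrightarrow> 0"
    by (rule tendsto_divide_0[OF tendsto_const filterlim_at_top_imp_at_infinity[OF n]])
  then have "(\<lambda>n. 1 - ?t - 1 / real (n + 2)) \<longlonglongrightarrow> 1 - ?t - 0" by (intro tendsto_intros)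
  moreover have "filterlim (\<lambda>n. real (n + 2) * ?t - 1) at_top sequentially"
    using filterlim_tendsto_add_at_top[OF tendsto_const[of "-1"] filterlim_at_top_mult_tendsto_pos[OF tendsto_const t(1) n]]
    by simp
  ultimately have q: "filterlim q at_top sequentially"
    unfolding q_def using t by (intro filterlim_at_top_mult_tendsto_pos) auto
  then have "(\<lambda>n. exp (- inverse (q n))) \<longlonglongrightarrow> exp (- 0)"
    by (intro tendsto_intros filterlim_compose[OF tendsto_inverse_0] filterlim_at_top_imp_at_infinity)
  moreover have "\<forall>\<^sub>F n in sequentially. exp (- inverse (q n)) = cutoff n j w"
    using filterlim_at_top_dense[THEN iffD1, OF q, rule_format, of 0]
    by eventually_elim (simp add: cutoff_def exp_bump_def q_def)
  ultimately show ?thesis using Lim_transform_eventually by fastforce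
qed

lemma frechet_derivative_eq_0_if_constant_along:
  assumes "f differentiable (at x)" "\<And>s. f (x + s *\<^sub>R v) = f x"
  shows "frechet_derivative f (at x) v = 0"
proof -
  have "((\<lambda>s. x + s *\<^sub>R v) has_derivative (\<lambda>s. s *\<^sub>R v)) (at 0)"
    by (auto intro!: derivative_eq_intros)
  from has_derivative_compose[OF this, of f "frechet_derivative f (at x)"]
  have "((\<lambda>s. f x) has_derivative (\<lambda>s. frechet_derivative f (at x) (s *\<^sub>R v))) (at (0::real))"
    using assms by (simp add: frechet_derivative_works)
  from has_derivative_unique[OF this has_derivative_const] show ?thesis
    by (metis scaleR_one)
qed

lemma wirtinger_bar_cutoff:
  assumes "(i = 1) \<noteq> (j = 1)"
  shows "wirtinger_bar i (\<lambda>w. complex_of_real (cutoff n j w)) w = 0"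
proof -
  have "cutoff n j (w + s *\<^sub>R coord_axis i v) = cutoff n j w" for s v
  proof -
    have "s *\<^sub>R coord_axis i v = coord_axis i (s *\<^sub>R v)" by (simp add: coord_axis_def)
    then show ?thesis
      using coord_add_other_axis[of j i w "s *\<^sub>R v"] assms by (auto simp: cutoff_def)
  qed
  then have "frechet_derivative (\<lambda>w. complex_of_real (cutoff n j w)) (at w) (coord_axis i v) = 0" for v
    using C_k_differentiable[OF C_k_of_real[OF C_k_cutoff]]
    by (intro frechet_derivative_eq_0_if_constant_along) auto
  then show ?thesis by (simp add: wirtinger_bar_def)
qed

lemma wirtinger_bar_shift:
  fixes \<psi> :: cfun2
  assumes "\<psi> differentiable (at (w + a))"
  shows "wirtinger_bar i (\<lambda>w. \<psi> (w + a)) w = wirtinger_bar i \<psi> (w + a)"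
proof -
  have "((\<lambda>w. w + a) has_derivative (\<lambda>h. h)) (at w)"
    by (auto intro!: derivative_eq_intros)
  from has_derivative_compose[OF this, of \<psi> "frechet_derivative \<psi> (at (w + a))"]
  have "((\<lambda>w. \<psi> (w + a)) has_derivative frechet_derivative \<psi> (at (w + a))) (at w)"
    using assms by (simp add: frechet_derivative_works)
  from wirtinger_bar_has_derivative[OF this] show ?thesis by (simp add: wirtinger_bar_def)
qed

text \<open>A translate along axis \<open>j\<close> can leave the domain only through the j-th
  coordinate. The cutoff confines this coordinate to a compact annulus, while the other coordinate
  still runs through the projection of the support.\<close>

lemma cutoff_shift_test_function:
  fixes \<psi> :: cfun2
  assumes \<psi>: "\<psi> \<in> test_functions punctured_bidisc"
  shows "(\<lambda>w. complex_of_real (cutoff n j w) * \<psi> (w + coord_axis j \<eta>)) \<in> test_functions punctured_bidisc"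
  using \<psi>
proof (rule test_functionsE)
  fix K assume K: "\<And>k. C_k k \<psi>" "compact K" "K \<subseteq> punctured_bidisc" "\<And>z. z \<notin> K \<Longrightarrow> \<psi> z = 0"
  let ?m = "real (n + 2)"
  define A where "A = {z. 1 / ?m \<le> (cmod z)\<^sup>2} \<inter> {z. (cmod z)\<^sup>2 \<le> 1 - 1 / ?m}"
  have A_sub: "A \<subseteq> punctured_disc"
  proof
    fix z assume z: "z \<in> A"
    define e where "e = 1 / ?m"
    have "0 < e" "e \<le> (cmod z)\<^sup>2" "(cmod z)\<^sup>2 \<le> 1 - e"
      using z by (simp_all add: A_def e_def)
    then have "0 < (cmod z)\<^sup>2" "(cmod z)\<^sup>2 < 1" by linarith+
    then show "z \<in> punctured_disc" by (auto simp: abs_square_less_1)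
  qed
  have A: "compact A"
  proof -
    have "bounded A" using A_sub by (rule bounded_subset[rotated]) (auto intro: bounded_subset[OF bounded_ball])
    moreover have "closed A"
      unfolding A_def by (intro closed_Int closed_Collect_le continuous_intros)
    ultimately show ?thesis by (simp add: compact_eq_bounded_closed)
  qed
  define S where "S = (if j = 1 then A \<times> snd ` K else fst ` K \<times> A)"
  show ?thesis
  proof (rule test_functionsI)
    have "C_k k (\<lambda>w. \<psi> (coord_axis j \<eta> + w))" for k
      by (rule C_k_compose_affine[OF bounded_linear_ident K(1)])
    then show "C_k k (\<lambda>w. complex_of_real (cutoff n j w) * \<psi> (w + coord_axis j \<eta>))" for k
      by (intro C_k_mult C_k_of_real C_k_cutoff) (simp add: add.commute)
    have "compact (fst ` K)" "compact (snd ` K)"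
      by (intro compact_continuous_image continuous_intros K(2))+
    then show "compact S" unfolding S_def using A by (auto intro: compact_Times)
    show "S \<subseteq> punctured_bidisc"
      unfolding S_def using A_sub K(3) by auto
    show "complex_of_real (cutoff n j w) * \<psi> (w + coord_axis j \<eta>) = 0" if "w \<notin> S" for w
    proof (rule ccontr)
      assume "complex_of_real (cutoff n j w) * \<psi> (w + coord_axis j \<eta>) \<noteq> 0"
      then have "coord j w \<in> A" "w + coord_axis j \<eta> \<in> K"
        using cutoff_support[of n j w] K(4)[of "w + coord_axis j \<eta>"] by (auto simp: A_def)
      moreover from imageI[OF this(2), of fst] imageI[OF this(2), of snd]
      have "(if j = 1 then snd w \<in> snd ` K else fst w \<in> fst ` K)"
        by (cases "j = 1") (simp_all add: coord_axis_def)
      ultimately have "w \<in> S" by (cases w) (auto simp: S_def coord_def split: if_splits)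
      with that show False ..
    qed
  qed
qed

text \<open>The translate of \<psi> need not be a test function on the domain. It is approximated by
  its products with cutoffs, for which the weak equation holds; because \<open>i\<close> and
  \<open>j\<close> name different variables, no derivative of a cutoff appears, and nothing has to
  be controlled near the boundary as the cutoffs tend to 1.\<close>

lemma weak_derivative_shift:
  fixes F G \<psi> :: cfun2
  assumes F: "integrable lborel F" "\<And>w. w \<notin> punctured_bidisc \<Longrightarrow> F w = 0"
    and G: "integrable lborel G" "\<And>w. w \<notin> punctured_bidisc \<Longrightarrow> G w = 0"
    and weak: "\<And>\<psi>. \<psi> \<in> test_functions punctured_bidisc \<Longrightarrow>
       (LINT w|lborel. F w * wirtinger_bar i \<psi> w) = - (LINT w|lborel. G w * \<psi> w)"
    and ij: "(i = 1) \<noteq> (j = 1)" and \<psi>: "\<psi> \<in> test_functions punctured_bidisc"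
  shows "(LINT w|lborel. F w * wirtinger_bar i \<psi> (w + coord_axis j \<eta>))
     = - (LINT w|lborel. G w * \<psi> (w + coord_axis j \<eta>))"
proof -
  let ?\<psi> = "\<lambda>w. \<psi> (w + coord_axis j \<eta>)" and ?\<Omega> = "punctured_bidisc"
  let ?w\<psi> = "\<lambda>w. wirtinger_bar i \<psi> (w + coord_axis j \<eta>)"
  note w\<psi> = wirtinger_bar_test_function[OF \<psi>, of i]
  note [measurable] = borel_measurable_test_function[OF \<psi>] borel_measurable_test_function[OF w\<psi>]
  obtain B1 where B1: "\<And>z. cmod (\<psi> z) \<le> B1"
    using test_function_bounded[OF \<psi>] by blast
  obtain B2 where B2: "\<And>z. cmod (wirtinger_bar i \<psi> z) \<le> B2"
    using test_function_bounded[OF w\<psi>] by blast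
  have [measurable]: "F \<in> borel_measurable borel" "G \<in> borel_measurable borel"
    using F G by (simp_all add: integrable_iff_bounded)
  have [measurable]: "cutoff n j \<in> borel_measurable borel" for n
    using C_k_continuous_on[OF C_k_cutoff] by (rule borel_measurable_continuous_onI)
  have diff: "\<psi> differentiable (at z)" for z
    using \<psi> by (rule test_functionsE) (rule C_k_differentiable)
  \<comment> \<open>Removes the cutoff by dominated convergence with majorant |F'| B; off the
    domain, where the cutoffs need not tend to 1, \<open>F'\<close> is zero.\<close>
  have lim: "(\<lambda>n. LINT w|lborel. F' w * (complex_of_real (cutoff n j w) * \<phi> w)) \<longlonglongrightarrow> (LINT w|lborel. F' w * \<phi> w)"
    if F': "integrable lborel F'" "\<And>w. w \<notin> ?\<Omega> \<Longrightarrow> F' w = 0"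
      and [measurable]: "\<phi> \<in> borel_measurable borel" and \<phi>: "\<And>w. cmod (\<phi> w) \<le> B" for F' \<phi> B
  proof (rule integral_dominated_convergence[where w="\<lambda>w. cmod (F' w) * B"])
    have [measurable]: "F' \<in> borel_measurable borel" using F' by (simp add: integrable_iff_bounded)
    show "(\<lambda>w. F' w * \<phi> w) \<in> borel_measurable lborel"
      "(\<lambda>w. F' w * (complex_of_real (cutoff n j w) * \<phi> w)) \<in> borel_measurable lborel" for n
      by measurable
    show "integrable lborel (\<lambda>w. cmod (F' w) * B)" using F' by (intro integrable_mult_left integrable_norm)
    show "AE w in lborel. norm (F' w * (complex_of_real (cutoff n j w) * \<phi> w)) \<le> cmod (F' w) * B" for n
    proof (rule AE_I2)
      fix w
      have "cutoff n j w * cmod (\<phi> w) \<le> 1 * B"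
        using cutoff_bounds \<phi> by (intro mult_mono) auto
      then show "norm (F' w * (complex_of_real (cutoff n j w) * \<phi> w)) \<le> cmod (F' w) * B"
        using cutoff_bounds by (simp add: norm_mult mult_left_mono)
    qed
    show "AE w in lborel. (\<lambda>n. F' w * (complex_of_real (cutoff n j w) * \<phi> w)) \<longlonglongrightarrow> F' w * \<phi> w"
      using AE_coord_neq_0[of j]
    proof eventually_elim
      case (elim w)
      show ?case
      proof (cases "w \<in> ?\<Omega>")
        case True
        then have "cmod (coord j w) < 1" by (auto simp: coord_def)
        from cutoff_tendsto[OF elim this]
        have "(\<lambda>n. F' w * (complex_of_real (cutoff n j w) * \<phi> w)) \<longlonglongrightarrow> F' w * (complex_of_real 1 * \<phi> w)"
          by (intro tendsto_intros)
        then show ?thesis by simp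
      qed (simp add: F')
    qed
  qed
  have "(LINT w|lborel. F w * (complex_of_real (cutoff n j w) * ?w\<psi> w))
      = - (LINT w|lborel. G w * (complex_of_real (cutoff n j w) * ?\<psi> w))" for n
  proof -
    have "(\<lambda>w. ?\<psi> w) differentiable (at w)" for w
      using diff[of "w + coord_axis j \<eta>"] by (rule differentiable_compose) simp
    then have "wirtinger_bar i (\<lambda>w. complex_of_real (cutoff n j w) * ?\<psi> w) w
        = complex_of_real (cutoff n j w) * ?w\<psi> w" for w
      by (simp add: wirtinger_bar_mult C_k_differentiable[OF C_k_of_real[OF C_k_cutoff]]
          wirtinger_bar_cutoff[OF ij] wirtinger_bar_shift diff)
    then show ?thesis using weak[OF cutoff_shift_test_function[OF \<psi>, of n j \<eta>]] by simp
  qed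
  note eq = this
  have limF: "(\<lambda>n. LINT w|lborel. F w * (complex_of_real (cutoff n j w) * ?w\<psi> w)) \<longlonglongrightarrow> (LINT w|lborel. F w * ?w\<psi> w)"
    by (rule lim[OF F _ B2]) measurable
  have "(\<lambda>n. LINT w|lborel. G w * (complex_of_real (cutoff n j w) * ?\<psi> w)) \<longlonglongrightarrow> (LINT w|lborel. G w * ?\<psi> w)"
    by (rule lim[OF G _ B1]) measurable
  from LIMSEQ_unique[OF limF[unfolded eq] tendsto_minus[OF this]] show ?thesis .
qed

text \<open>The transform averages translates along axis \<open>j\<close>, so
  \<open>weak_derivative_shift\<close> is applied under the integral over the translation.\<close>

lemma integral_cauchy_transform_other_wirtinger_bar:
  fixes F G \<psi> :: cfun2
  assumes F: "integrable lborel F" "\<And>w. w \<notin> punctured_bidisc \<Longrightarrow> F w = 0"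
    and G: "integrable lborel G" "\<And>w. w \<notin> punctured_bidisc \<Longrightarrow> G w = 0"
    and weak: "\<And>\<psi>. \<psi> \<in> test_functions punctured_bidisc \<Longrightarrow>
       (LINT w|lborel. F w * wirtinger_bar i \<psi> w) = - (LINT w|lborel. G w * \<psi> w)"
    and ij: "(i = 1) \<noteq> (j = 1)" and \<psi>: "\<psi> \<in> test_functions punctured_bidisc"
  shows "(LINT w|lborel. cauchy_transform j F w * wirtinger_bar i \<psi> w)
     = - (LINT w|lborel. cauchy_transform j G w * \<psi> w)"
proof -
  note w\<psi> = wirtinger_bar_test_function[OF \<psi>, of i]
  obtain B1 where B1: "\<And>z. cmod (\<psi> z) \<le> B1"
    using test_function_bounded[OF \<psi>] by blast
  obtain B2 where B2: "\<And>z. cmod (wirtinger_bar i \<psi> z) \<le> B2"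
    using test_function_bounded[OF w\<psi>] by blast
  note adjoint = integral_convol_mult[OF borel_measurable_coord_axis integrable_cauchy_kernel]
  show ?thesis
    unfolding cauchy_transform_def adjoint[OF F(1) borel_measurable_test_function[OF w\<psi>] B2]
      adjoint[OF G(1) borel_measurable_test_function[OF \<psi>] B1]
    by (subst weak_derivative_shift[OF F G weak ij \<psi>]) simp_all
qed

section \<open>Change of variables\<close>

lemma borel_measurable_Complex [measurable (raw)]:
  assumes "f \<in> borel_measurable M" "g \<in> borel_measurable M"
  shows "(\<lambda>x. Complex (f x) (g x)) \<in> borel_measurable M"
  unfolding borel_measurable_complex_iff using assms by simp

lemma lborel_complex: "(lborel :: complex measure) = distr (lborel \<Otimes>\<^sub>M lborel) borel (\<lambda>(x, y). Complex x y)"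
    (is "_ = ?D")
proof (rule lborel_eqI)
  fix l u :: complex
  assume le: "\<And>b. b \<in> Basis \<Longrightarrow> l \<bullet> b \<le> u \<bullet> b"
  from le[of 1] le[of \<i>] have lu: "Re l \<le> Re u" "Im l \<le> Im u"
    by (simp_all add: Basis_complex_def inner_complex_def)
  have "emeasure ?D (box l u) = emeasure (lborel \<Otimes>\<^sub>M lborel) ({Re l<..<Re u} \<times> {Im l<..<Im u})"
    by (subst emeasure_distr)
      (auto intro!: arg_cong[where f="emeasure _"] simp: box_def Basis_complex_def inner_complex_def space_pair_measure)
  also have "\<dots> = ennreal (Re u - Re l) * ennreal (Im u - Im l)"
    using lu by (subst lborel.emeasure_pair_measure_Times) auto
  also have "\<dots> = (\<Prod>b\<in>Basis. (u - l) \<bullet> b)"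
    using lu by (simp add: Basis_complex_def inner_complex_def ennreal_mult)
  finally show "emeasure ?D (box l u) = (\<Prod>b\<in>Basis. (u - l) \<bullet> b)" .
qed simp

lemma nn_integral_complex_Re_Im:
  assumes [measurable]: "f \<in> borel_measurable borel"
  shows "(\<integral>\<^sup>+z. f z \<partial>lborel) = (\<integral>\<^sup>+x. \<integral>\<^sup>+y. f (Complex x y) \<partial>lborel \<partial>lborel)"
  unfolding lborel_complex
  by (subst nn_integral_distr) (simp_all add: lborel.nn_integral_fst[symmetric])

text \<open>Multiplication by \<open>c\<close> is a real linear map of determinant |c|^2. It is
  factored into one-dimensional affine substitutions joined by Tonelli. The general factorization
  divides by the real part; a purely imaginary factor only swaps and scales the axes.\<close>

lemma nn_integral_complex_mult:
  fixes c :: complex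
  assumes [measurable]: "f \<in> borel_measurable borel" and "c \<noteq> 0"
  shows "(\<integral>\<^sup>+z. f z \<partial>lborel) = ennreal ((cmod c)\<^sup>2) * (\<integral>\<^sup>+z. f (z * c) \<partial>lborel)"
proof -
  define a b where "a = Re c" and "b = Im c"
  define g where "g x y = f (Complex x y)" for x y
  have [measurable]: "(\<lambda>p. g (fst p) (snd p)) \<in> borel_measurable (borel \<Otimes>\<^sub>M borel)"
    unfolding g_def by measurable
  have g [measurable]: "(\<lambda>x. g (h x) (k x)) \<in> borel_measurable M"
    if "h \<in> borel_measurable M" "k \<in> borel_measurable M" for h k and M :: "'m measure"
    unfolding g_def using that by measurable
  have norm: "(cmod c)\<^sup>2 = a\<^sup>2 + b\<^sup>2" by (simp add: a_def b_def cmod_power2)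
  have mult: "f (Complex x y * c) = g (a * x - b * y) (b * x + a * y)" for x y
    unfolding g_def a_def b_def by (intro arg_cong[where f=f]) (simp add: complex_eq_iff algebra_simps)
  have lhs: "(\<integral>\<^sup>+z. f z \<partial>lborel) = (\<integral>\<^sup>+x. \<integral>\<^sup>+y. g x y \<partial>lborel \<partial>lborel)"
    unfolding g_def by (rule nn_integral_complex_Re_Im) measurable
  have rhs: "(\<integral>\<^sup>+z. f (z * c) \<partial>lborel) = (\<integral>\<^sup>+y. \<integral>\<^sup>+x. g (a * x - b * y) (b * x + a * y) \<partial>lborel \<partial>lborel)"
  proof -
    have "(\<integral>\<^sup>+z. f (z * c) \<partial>lborel) = (\<integral>\<^sup>+x. \<integral>\<^sup>+y. f (Complex x y * c) \<partial>lborel \<partial>lborel)"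
      by (rule nn_integral_complex_Re_Im) measurable
    also have "\<dots> = (\<integral>\<^sup>+y. \<integral>\<^sup>+x. f (Complex x y * c) \<partial>lborel \<partial>lborel)"
      by (rule lborel_pair.Fubini'[symmetric]) measurable
    finally show ?thesis unfolding mult .
  qed
  show ?thesis
  proof (cases "a = 0")
    case True
    then have b: "b \<noteq> 0" using assms(2) by (auto simp: a_def b_def complex_eq_iff)
    have "(\<integral>\<^sup>+x. \<integral>\<^sup>+y. g x y \<partial>lborel \<partial>lborel)
        = ennreal \<bar>- b\<bar> * (\<integral>\<^sup>+y. (\<integral>\<^sup>+v. g (0 + - b * y) v \<partial>lborel) \<partial>lborel)"
      using b by (intro nn_integral_real_affine) auto
    also have "\<dots> = ennreal \<bar>- b\<bar> * (\<integral>\<^sup>+y. ennreal \<bar>b\<bar> * (\<integral>\<^sup>+x. g (0 + - b * y) (0 + b * x) \<partial>lborel) \<partial>lborel)"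
      using b by (intro arg_cong[where f="\<lambda>x. _ * x"] nn_integral_cong nn_integral_real_affine) auto
    also have "\<dots> = ennreal \<bar>- b\<bar> * (ennreal \<bar>b\<bar> * (\<integral>\<^sup>+z. f (z * c) \<partial>lborel))"
      unfolding rhs by (subst nn_integral_cmult) (simp_all add: True)
    finally show ?thesis
      unfolding lhs norm by (simp add: True mult.assoc[symmetric] ennreal_mult[symmetric] power2_eq_square)
  next
    case False
    \<comment> \<open>With u = a x - b y as the first coordinate, the second one is b x + a y = (b /
      a) u + d y. This determines \<open>d\<close>, and |d| |a| = |c|^2.\<close>
    define d where "d = (a\<^sup>2 + b\<^sup>2) / a"
    have d: "d \<noteq> 0" using False by (simp add: d_def add_nonneg_eq_0_iff)
    have "(\<integral>\<^sup>+x. \<integral>\<^sup>+y. g x y \<partial>lborel \<partial>lborel)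
        = (\<integral>\<^sup>+u. ennreal \<bar>d\<bar> * (\<integral>\<^sup>+y. g u (b / a * u + d * y) \<partial>lborel) \<partial>lborel)"
      using d by (intro nn_integral_cong nn_integral_real_affine) auto
    also have "\<dots> = ennreal \<bar>d\<bar> * (\<integral>\<^sup>+u. \<integral>\<^sup>+y. g u (b / a * u + d * y) \<partial>lborel \<partial>lborel)"
      by (rule nn_integral_cmult) measurable
    also have "\<dots> = ennreal \<bar>d\<bar> * (\<integral>\<^sup>+y. \<integral>\<^sup>+u. g u (b / a * u + d * y) \<partial>lborel \<partial>lborel)"
    proof -
      have "(\<lambda>(u, y). g u (b / a * u + d * y)) \<in> borel_measurable (lborel \<Otimes>\<^sub>M lborel)" by measurable
      then show ?thesis by (simp only: lborel_pair.Fubini'[symmetric])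
    qed
    also have "\<dots> = ennreal \<bar>d\<bar> * (\<integral>\<^sup>+y. ennreal \<bar>a\<bar> *
        (\<integral>\<^sup>+x. g (- b * y + a * x) (b / a * (- b * y + a * x) + d * y) \<partial>lborel) \<partial>lborel)"
      using False by (intro arg_cong[where f="\<lambda>x. _ * x"] nn_integral_cong nn_integral_real_affine) auto
    also have "\<dots> = ennreal \<bar>d\<bar> * (\<integral>\<^sup>+y. ennreal \<bar>a\<bar> *
        (\<integral>\<^sup>+x. g (a * x - b * y) (b * x + a * y) \<partial>lborel) \<partial>lborel)"
    proof -
      have "- b * y + a * x = a * x - b * y" "b / a * (- b * y + a * x) + d * y = b * x + a * y" for x y
        using False by (simp_all add: d_def field_simps power2_eq_square)
      then show ?thesis by (simp only:)
    qed
    also have "\<dots> = ennreal \<bar>d\<bar> * (ennreal \<bar>a\<bar> * (\<integral>\<^sup>+z. f (z * c) \<partial>lborel))"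
      unfolding rhs by (subst nn_integral_cmult) simp_all
    also have "\<dots> = ennreal (\<bar>d\<bar> * \<bar>a\<bar>) * (\<integral>\<^sup>+z. f (z * c) \<partial>lborel)"
      by (simp add: ennreal_mult mult.assoc)
    also have "\<bar>d\<bar> * \<bar>a\<bar> = (cmod c)\<^sup>2"
      unfolding norm abs_mult[symmetric] using False by (simp add: d_def)
    finally show ?thesis unfolding lhs .
  qed
qed

section \<open>Substitution on the Hartogs triangle\<close>

lemma borel_measurable_hartogs [measurable]: "hartogs \<in> sets borel"
proof -
  have "open {z :: complex \<times> complex. cmod (fst z) < cmod (snd z) \<and> cmod (snd z) < 1}"
    by (intro open_Collect_conj open_Collect_less continuous_intros)
  moreover have "hartogs = {z. cmod (fst z) < cmod (snd z) \<and> cmod (snd z) < 1}"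
    by (auto simp: hartogs_def)
  ultimately show ?thesis by simp
qed

lemma open_disc_punctured_disc: "open punctured_bidisc"
  by (intro open_Times) auto

lemma borel_measurable_disc_punctured_disc [measurable]: "punctured_bidisc \<in> sets borel"
  using open_disc_punctured_disc by (rule borel_open)

lemma borel_measurable_hartogs_param [measurable]: "hartogs_param \<in> borel_measurable borel"
  by (intro borel_measurable_continuous_onI continuous_hartogs_param)

lemma borel_measurable_hartogs_map [measurable]: "hartogs_map \<in> borel_measurable borel"
  unfolding hartogs_map_def[abs_def] borel_prod[symmetric] by measurable

text \<open>The real Jacobian of \<open>hartogs_param\<close>, the squared modulus of its complex
  determinant \<open>snd w\<close>. The indicator confines it to the domain on which the map is a
  bijection to the Hartogs triangle.\<close>

definition hartogs_jacobian :: "complex \<times> complex \<Rightarrow> real" where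
  "hartogs_jacobian w = indicator punctured_bidisc w * (cmod (snd w))\<^sup>2"

lemma borel_measurable_hartogs_jacobian [measurable]: "hartogs_jacobian \<in> borel_measurable borel"
  unfolding hartogs_jacobian_def[abs_def]
  by (intro borel_measurable_times borel_measurable_indicator borel_measurable_disc_punctured_disc
      borel_measurable_continuous_onI continuous_intros)

lemma hartogs_jacobian_simps:
  "0 \<le> hartogs_jacobian w"
  "0 < hartogs_jacobian w \<longleftrightarrow> w \<in> punctured_bidisc"
  "hartogs_jacobian w = 0 \<longleftrightarrow> w \<notin> punctured_bidisc"
  by (auto simp: hartogs_jacobian_def indicator_def)

text \<open>For a fixed second coordinate the map multiplies the first one by it, so scaling in one
  complex variable and Tonelli give the formula.\<close>

lemma nn_integral_hartogs:
  fixes f :: "complex \<times> complex \<Rightarrow> ennreal"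
  assumes [measurable]: "f \<in> borel_measurable borel"
  shows "(\<integral>\<^sup>+z. indicator hartogs z * f z \<partial>lborel)
    = (\<integral>\<^sup>+w. ennreal (hartogs_jacobian w) * f (hartogs_param w) \<partial>lborel)"
proof -
  define k where "k z = indicator hartogs z * f z" for z
  define h where "h w = ennreal (hartogs_jacobian w) * f (hartogs_param w)" for w
  have kb: "k \<in> borel_measurable borel" unfolding k_def[abs_def] by measurable
  then have k [measurable]: "k \<in> borel_measurable (lborel \<Otimes>\<^sub>M lborel)" by (simp add: lborel_prod)
  have "h \<in> borel_measurable borel" unfolding h_def[abs_def] by measurable
  then have h [measurable]: "h \<in> borel_measurable (lborel \<Otimes>\<^sub>M lborel)" by (simp add: lborel_prod)
  have "(\<integral>\<^sup>+x. k (x, y) \<partial>lborel) = (\<integral>\<^sup>+x. h (x, y) \<partial>lborel)" for y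
  proof (cases "y = 0")
    case True
    then show ?thesis by (simp add: hartogs_def k_def h_def hartogs_jacobian_def)
  next
    case False
    have *: "ennreal ((cmod y)\<^sup>2) * k (x * y, y) = h (x, y)" for x
      using hartogs_param_mem[of "(x, y)"]
      by (auto simp: k_def h_def hartogs_jacobian_def hartogs_param_def indicator_def)
    have "(\<lambda>x. k (x, y)) \<in> borel_measurable lborel" by measurable
    then have kx: "(\<lambda>x. k (x, y)) \<in> borel_measurable borel" by simp
    have "(\<lambda>x. k (x * y, y)) \<in> borel_measurable lborel"
      using measurable_compose[OF _ kx, of "\<lambda>x. x * y" lborel] by simp
    then show ?thesis
      unfolding nn_integral_complex_mult[OF kx False] by (simp add: nn_integral_cmult[symmetric] *)
  qed
  then show ?thesis
    unfolding k_def[symmetric] h_def[symmetric] lborel_prod[symmetric]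
    by (simp add: lborel_pair.nn_integral_snd[symmetric])
qed

text \<open>As an identity of measures the substitution yields both Bochner integrals and null sets
  from general facts on image measures.\<close>

lemma density_hartogs:
  "density lborel (\<lambda>z. ennreal (indicator hartogs z)) =
    distr (density lborel (\<lambda>w. ennreal (hartogs_jacobian w))) borel hartogs_param"
    (is "?M = ?N")
proof (rule measure_eqI)
  fix A assume "A \<in> sets ?M"
  then have [measurable]: "A \<in> sets borel" by simp
  have [measurable]: "hartogs_param -` A \<in> sets borel" by (rule measurable_sets_borel) measurable
  have "emeasure ?M A = (\<integral>\<^sup>+z. indicator hartogs z * indicator A z \<partial>lborel)"
    by (subst emeasure_density) (auto simp: ennreal_indicator)
  also have "\<dots> = (\<integral>\<^sup>+w. ennreal (hartogs_jacobian w) * indicator (hartogs_param -` A) w \<partial>lborel)"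
    by (subst nn_integral_hartogs) (auto simp: indicator_def intro!: nn_integral_cong)
  also have "\<dots> = emeasure ?N A"
    by (simp add: emeasure_distr emeasure_density)
  finally show "emeasure ?M A = emeasure ?N A" .
qed simp

lemma integral_hartogs:
  fixes f :: "complex \<times> complex \<Rightarrow> complex"
  assumes [measurable]: "f \<in> borel_measurable borel"
  shows "(LINT z|lborel. indicator hartogs z *\<^sub>R f z)
      = (LINT w|lborel. hartogs_jacobian w *\<^sub>R f (hartogs_param w))"
proof -
  have "(LINT z|lborel. indicator hartogs z *\<^sub>R f z) = integral\<^sup>L (density lborel (\<lambda>z. ennreal (indicator hartogs z))) f"
    by (subst integral_density) auto
  also have "\<dots> = (LINT w|lborel. hartogs_jacobian w *\<^sub>R f (hartogs_param w))"
    unfolding density_hartogs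
    by (subst integral_distr, simp, simp, subst integral_density) (auto simp: hartogs_jacobian_simps)
  finally show ?thesis .
qed

lemma AE_hartogs_param:
  assumes "AE z in lborel. z \<in> hartogs \<longrightarrow> Q z"
  shows "AE w in lborel. w \<in> punctured_bidisc \<longrightarrow> Q (hartogs_param w)"
proof -
  have "AE z in density lborel (\<lambda>z. ennreal (indicator hartogs z)). Q z"
    using assms by (subst AE_density) (auto elim!: eventually_mono simp: indicator_def split: if_splits)
  from AE_distrD[OF _ this[unfolded density_hartogs]]
  have "AE w in density lborel (\<lambda>w. ennreal (hartogs_jacobian w)). Q (hartogs_param w)"
    by simp
  then show ?thesis
    by (subst (asm) AE_density) (simp_all add: hartogs_jacobian_simps)
qed

text \<open>The preimage of a null set under \<open>hartogs_map\<close> is measured by the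
  substitution formula, which turns it into an integral over the null set itself.\<close>

lemma AE_hartogs_map:
  assumes "AE w in lborel. w \<in> punctured_bidisc \<longrightarrow> R w"
  shows "AE z in lborel. z \<in> hartogs \<longrightarrow> R (hartogs_map z)"
proof -
  obtain N where N: "{w \<in> space lborel. \<not> (w \<in> punctured_bidisc \<longrightarrow> R w)} \<subseteq> N" "N \<in> null_sets lborel"
    using assms by (auto elim!: AE_E simp: null_sets_def)
  then have [measurable]: "N \<in> sets borel" by auto
  have [measurable]: "hartogs_map -` N \<in> sets borel" by (rule measurable_sets_borel) measurable
  have "(\<integral>\<^sup>+z. indicator hartogs z * indicator (hartogs_map -` N) z \<partial>lborel)
     = (\<integral>\<^sup>+w. ennreal (hartogs_jacobian w) * indicator (hartogs_map -` N) (hartogs_param w) \<partial>lborel)"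
    by (rule nn_integral_hartogs) measurable
  also have "\<dots> = (\<integral>\<^sup>+w. 0 \<partial>(lborel :: (complex \<times> complex) measure))"
  proof (rule nn_integral_cong_AE)
    show "AE w in lborel. ennreal (hartogs_jacobian w) * indicator (hartogs_map -` N) (hartogs_param w) = 0"
      using AE_not_in[OF N(2)]
    proof eventually_elim
      case (elim w)
      show ?case
      proof (cases "w \<in> punctured_bidisc")
        case True
        then have "hartogs_map (hartogs_param w) = w" by (intro hartogs_map_param) auto
        then show ?thesis using elim by simp
      qed (simp add: hartogs_jacobian_simps)
    qed
  qed
  finally have "(\<integral>\<^sup>+z. indicator hartogs z * indicator (hartogs_map -` N) z \<partial>lborel) = 0" by simp
  then have "AE z in lborel. indicator hartogs z * indicator (hartogs_map -` N) z = (0::ennreal)"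
    by (subst (asm) nn_integral_0_iff_AE) simp_all
  then show ?thesis
  proof eventually_elim
    case (elim z)
    then show ?case using N(1) hartogs_map_mem[of z] by (auto simp: indicator_def split: if_splits)
  qed
qed

text \<open>The theorem speaks of Lebesgue measurable functions, while Fubini and the substitutions
  are carried out for Borel functions. This is the bridge between a function and a Borel
  representative.\<close>

lemma lebesgue_AE_eq_lborel:
  fixes g g' :: "'a::euclidean_space \<Rightarrow> 'b::euclidean_space"
  assumes ae: "AE x in lborel. g x = g' x" and [measurable]: "g' \<in> borel_measurable borel"
  shows "g \<in> borel_measurable lebesgue" "integral\<^sup>L lebesgue g = integral\<^sup>L lborel g'"
    "integrable lebesgue g \<longleftrightarrow> integrable lborel g'"
proof -
  have g': "g' \<in> borel_measurable lebesgue" by (intro measurable_completion) simp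
  have "AE x in lborel. g' x = g x" using ae by eventually_elim simp
  then have ae': "AE x in lebesgue. g' x = g x" by (rule AE_completion)
  show g: "g \<in> borel_measurable lebesgue"
    by (rule borel_measurable_AE[OF g' ae'])
  show "integral\<^sup>L lebesgue g = integral\<^sup>L lborel g'"
    using integral_cong_AE[OF g' g ae'] integral_completion[of g' lborel] by simp
  show "integrable lebesgue g \<longleftrightarrow> integrable lborel g'"
    using integrable_cong_AE[OF g' g ae'] integrable_completion[of g' lborel] by simp
qed

lemma lebesgue_ex_borel_measurable_complex:
  fixes g :: "'a::euclidean_space \<Rightarrow> complex"
  assumes "g \<in> borel_measurable lebesgue"
  obtains g' where "g' \<in> borel_measurable borel" "AE x in lborel. g x = g' x"
proof -
  have "(\<lambda>x. Re (g x)) \<in> borel_measurable lebesgue" "(\<lambda>x. Im (g x)) \<in> borel_measurable lebesgue"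
    using assms by simp_all
  from this[THEN completion_ex_borel_measurable_real]
  obtain a b where [measurable]: "a \<in> borel_measurable lborel" "b \<in> borel_measurable lborel"
    and ab: "AE x in lborel. Re (g x) = a x" "AE x in lborel. Im (g x) = b x"
    by blast
  show thesis
  proof (rule that[of "\<lambda>x. Complex (a x) (b x)"])
    have "(\<lambda>x. Complex (a x) (b x)) \<in> borel_measurable lborel" by measurable
    then show "(\<lambda>x. Complex (a x) (b x)) \<in> borel_measurable borel" by simp
    show "AE x in lborel. g x = Complex (a x) (b x)"
      using ab by eventually_elim (simp add: complex_eq_iff)
  qed
qed

section \<open>Uniqueness of functions representing a distribution\<close>

text \<open>A Dynkin argument: boxes are stable under intersection and generate the Borel sets, so
  the integrals over all Borel sets vanish, and then the function does almost everywhere.\<close>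

lemma AE_zero_if_integral_box_zero:
  fixes g :: "'a::euclidean_space \<Rightarrow> 'b::{banach, second_countable_topology}"
  assumes g: "integrable lborel g" and box: "\<And>a b. (LINT x:box a b|lborel. g x) = 0"
  shows "AE x in lborel. g x = 0"
proof (rule sigma_finite_measure.density_zero[OF sigma_finite_lborel g])
  have int: "set_integrable lborel A g" if "A \<in> sets borel" for A
    using integrable_mult_indicator[of A lborel g] g that by (simp add: set_integrable_def)
  fix A :: "'a set" assume "A \<in> sets lborel"
  then have A: "A \<in> sigma_sets UNIV (range (\<lambda>(a, b). box a b))" by (simp add: borel_eq_box)
  have borel: "sigma_sets UNIV (range (\<lambda>(a, b). box a b)) = sets (borel :: 'a measure)"
    by (simp add: borel_eq_box)
  have "Int_stable (range (\<lambda>(a, b). box a b :: 'a set))"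
    by (auto simp: Int_stable_def box_Int_box)
  moreover have "range (\<lambda>(a, b). box a b :: 'a set) \<subseteq> Pow UNIV" by simp
  ultimately show "(LINT x:A|lborel. g x) = 0"
    using A
  proof (induction A rule: sigma_sets_induct_disjoint)
    case (compl A)
    \<comment> \<open>Complements require the integral over the whole space, which is obtained from
      an exhaustion by boxes.\<close>
    define B where "B n = box (- (real n *\<^sub>R One)) (real n *\<^sub>R One :: 'a)" for n
    have "(\<lambda>n. LINT x:B n|lborel. g x) \<longlonglongrightarrow> (LINT x:(\<Union>n. B n)|lborel. g x)"
    proof (rule set_integral_cont_up)
      show "incseq B"
        unfolding B_def by (intro monoI subset_box_imp) (auto simp: inner_simps)
    qed (auto simp: B_def intro!: int)
    moreover have "(\<Union>n. B n) = UNIV" unfolding B_def by (rule UN_box_eq_UNIV)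
    ultimately have "(LINT x:UNIV|lborel. g x) = 0"
      using box by (simp add: B_def LIMSEQ_const_iff)
    moreover have "(LINT x:UNIV|lborel. g x) = (LINT x:A|lborel. g x) + (LINT x:UNIV - A|lborel. g x)"
      using compl(1) unfolding borel by (subst set_integral_Un[symmetric]) (auto intro!: int)
    ultimately show ?case using compl(2) by simp
  next
    case (union A)
    then show ?case
      unfolding borel
      by (subst lebesgue_integral_countable_add) (auto simp: disjoint_family_on_def intro!: int)
  qed (use box in \<open>auto simp: set_lebesgue_integral_def\<close>)
qed

text \<open>The parameter \<open>n\<close> multiplies the argument of the bump and not its value, so
  for increasing \<open>n\<close> the functions flatten to 1 inside the box.\<close>

definition box_bump :: "nat \<Rightarrow> 'a::euclidean_space \<Rightarrow> 'a \<Rightarrow> 'a \<Rightarrow> real" where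
  "box_bump n e f x = (\<Prod>b\<in>Basis. exp_bump 0 (real n * ((x \<bullet> b - e \<bullet> b) * (f \<bullet> b - x \<bullet> b))))"

lemma C_k_box_bump: "C_k k (box_bump n e f)"
  unfolding box_bump_def[abs_def]
  by (intro C_k_prod C_k_exp_bump C_k_mult C_k_diff C_k_const
      C_k_bounded_linear bounded_linear_inner_left)

lemma box_bump_bounds: "0 \<le> box_bump n e f x" "box_bump n e f x \<le> 1"
  unfolding box_bump_def by (auto intro!: prod_nonneg prod_le_1 simp: exp_bump_0)

text \<open>Strict inequalities between the corners keep the two factors belonging to a coordinate
  from being negative together, which could make the bump positive outside the box.\<close>

lemma
  fixes e f x :: "'a::euclidean_space"
  assumes "\<And>b. b \<in> Basis \<Longrightarrow> e \<bullet> b < f \<bullet> b"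
  shows box_bump_outside: "x \<notin> box e f \<Longrightarrow> box_bump n e f x = 0"
    and box_bump_tendsto: "(\<lambda>n. box_bump n e f x) \<longlonglongrightarrow> indicator (box e f) x"
proof -
  show out: "box_bump n e f x = 0" if x: "x \<notin> box e f" for n
  proof -
    obtain b where b: "b \<in> Basis" "x \<bullet> b \<le> e \<bullet> b \<or> f \<bullet> b \<le> x \<bullet> b"
      using x by (auto simp: box_def not_less)
    then have "(x \<bullet> b - e \<bullet> b) * (f \<bullet> b - x \<bullet> b) \<le> 0"
      using assms[OF b(1)] by (auto simp: mult_le_0_iff)
    then have "exp_bump 0 (real n * ((x \<bullet> b - e \<bullet> b) * (f \<bullet> b - x \<bullet> b))) = 0"
      by (simp add: exp_bump_0 mult_nonneg_nonpos)
    then show ?thesis unfolding box_bump_def using b(1) by (intro prod_zero) auto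
  qed
  show "(\<lambda>n. box_bump n e f x) \<longlonglongrightarrow> indicator (box e f) x"
  proof (cases "x \<in> box e f")
    case True
    have "(\<lambda>n. box_bump n e f x) \<longlonglongrightarrow> (\<Prod>b\<in>(Basis :: 'a set). (1::real))"
      unfolding box_bump_def
    proof (rule tendsto_prod)
      fix b :: 'a assume "b \<in> Basis"
      with True have "0 < (x \<bullet> b - e \<bullet> b) * (f \<bullet> b - x \<bullet> b)" by (simp add: box_def)
      then show "(\<lambda>n. exp_bump 0 (real n * ((x \<bullet> b - e \<bullet> b) * (f \<bullet> b - x \<bullet> b)))) \<longlonglongrightarrow> 1"
        using exp_bump_scaled_tendsto[of "(x \<bullet> b - e \<bullet> b) * (f \<bullet> b - x \<bullet> b)"] by simp
    qed
    then show ?thesis using True by simp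
  qed (simp add: out)
qed

text \<open>Box bumps are test functions tending to the indicator of the box, and their products
  with \<open>g\<close> are dominated by |g| on the box.\<close>

lemma integral_box_eq_0_if_test_integrals_0:
  fixes g :: cfun2
  assumes g: "locally_integrable \<Omega> g" and zero: "\<And>\<psi>. \<psi> \<in> test_functions \<Omega> \<Longrightarrow> distr_of \<Omega> g \<psi> = 0"
    and sub: "cbox e f \<subseteq> \<Omega>" and ne: "box e f \<noteq> {}"
  shows "(LINT x:box e f|lebesgue. g x) = 0"
proof -
  have ef: "e \<bullet> b < f \<bullet> b" if "b \<in> Basis" for b using ne that by (auto simp: box_ne_empty)
  note outside = box_bump_outside[OF ef] and tends = box_bump_tendsto[OF ef]
  have "integrable lebesgue (\<lambda>x. indicator (cbox e f) x *\<^sub>R g x)"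
    using g sub by (auto simp: locally_integrable_def set_integrable_def)
  from integrable_mult_indicator[OF _ this, of "box e f"]
  have int: "integrable lebesgue (\<lambda>x. indicator (box e f) x *\<^sub>R g x)"
  proof (rule Bochner_Integration.integrable_cong[THEN iffD1, rotated -1])
    show "indicator (box e f) x *\<^sub>R indicator (cbox e f) x *\<^sub>R g x = indicator (box e f) x *\<^sub>R g x" for x
      using box_subset_cbox[of e f] by (auto simp: indicator_def)
  qed auto
  have "(\<lambda>n. LINT x|lebesgue. complex_of_real (box_bump n e f x) * (indicator (box e f) x *\<^sub>R g x))
     \<longlonglongrightarrow> (LINT x|lebesgue. indicator (box e f) x *\<^sub>R g x)"
  proof (rule integral_dominated_convergence[where w="\<lambda>x. norm (indicator (box e f) x *\<^sub>R g x)"])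
    show meas: "(\<lambda>x. indicator (box e f) x *\<^sub>R g x) \<in> borel_measurable lebesgue"
      using int by (rule borel_measurable_integrable)
    have "(\<lambda>x. complex_of_real (box_bump n e f x)) \<in> borel_measurable borel" for n
      by (intro borel_measurable_continuous_onI C_k_continuous_on[OF C_k_of_real[OF C_k_box_bump]])
    then have "(\<lambda>x. complex_of_real (box_bump n e f x)) \<in> borel_measurable lebesgue" for n
      by (intro measurable_completion) simp
    then show "(\<lambda>x. complex_of_real (box_bump n e f x) * (indicator (box e f) x *\<^sub>R g x)) \<in> borel_measurable lebesgue" for n
      using meas by (intro borel_measurable_times)
    show "integrable lebesgue (\<lambda>x. norm (indicator (box e f) x *\<^sub>R g x))"
      using int by (rule integrable_norm)
    show "AE x in lebesgue. norm (complex_of_real (box_bump n e f x) * (indicator (box e f) x *\<^sub>R g x))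
        \<le> norm (indicator (box e f) x *\<^sub>R g x)" for n
      using box_bump_bounds[of n e f] by (intro AE_I2) (simp add: norm_mult indicator_def mult_left_le_one_le)
    show "AE x in lebesgue. (\<lambda>n. complex_of_real (box_bump n e f x) * (indicator (box e f) x *\<^sub>R g x))
        \<longlonglongrightarrow> indicator (box e f) x *\<^sub>R g x"
    proof (rule AE_I2)
      fix x
      have eq: "complex_of_real (indicator (box e f) x) * (indicator (box e f) x *\<^sub>R g x) = indicator (box e f) x *\<^sub>R g x"
        by (simp add: indicator_def)
      have "(\<lambda>n. complex_of_real (box_bump n e f x) * (indicator (box e f) x *\<^sub>R g x))
          \<longlonglongrightarrow> complex_of_real (indicator (box e f) x) * (indicator (box e f) x *\<^sub>R g x)"
        by (intro tendsto_intros tends)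
      then show "(\<lambda>n. complex_of_real (box_bump n e f x) * (indicator (box e f) x *\<^sub>R g x))
        \<longlonglongrightarrow> indicator (box e f) x *\<^sub>R g x" unfolding eq .
    qed
  qed
  moreover have "(LINT x|lebesgue. complex_of_real (box_bump n e f x) * (indicator (box e f) x *\<^sub>R g x)) = 0" for n
  proof -
    have "(\<lambda>x. complex_of_real (box_bump n e f x)) \<in> test_functions \<Omega>"
      using outside box_subset_cbox[of e f]
      by (intro test_functionsI[OF C_k_of_real[OF C_k_box_bump] compact_cbox sub]) auto
    from zero[OF this] have "(LINT x|lebesgue. indicator \<Omega> x *\<^sub>R (g x * complex_of_real (box_bump n e f x))) = 0"
      by (simp add: distr_of_def set_lebesgue_integral_def)
    moreover have "indicator \<Omega> x *\<^sub>R (g x * complex_of_real (box_bump n e f x))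
        = complex_of_real (box_bump n e f x) * (indicator (box e f) x *\<^sub>R g x)" for x
      using outside[of x n] sub box_subset_cbox[of e f] by (auto simp: indicator_def)
    ultimately show ?thesis by simp
  qed
  ultimately show ?thesis by (simp add: LIMSEQ_const_iff set_lebesgue_integral_def)
qed

text \<open>The fundamental lemma of the calculus of variations. Localized to a closed box it
  reduces to vanishing box integrals, and countably many closed boxes exhaust the open set.\<close>

lemma AE_zero_if_test_integrals_0:
  fixes g :: cfun2
  assumes "open \<Omega>" and g: "locally_integrable \<Omega> g"
    and zero: "\<And>\<psi>. \<psi> \<in> test_functions \<Omega> \<Longrightarrow> distr_of \<Omega> g \<psi> = 0"
  shows "AE x in lborel. x \<in> \<Omega> \<longrightarrow> g x = 0"
proof -
  have cbox: "AE x in lborel. x \<in> cbox a b \<longrightarrow> g x = 0" if sub: "cbox a b \<subseteq> \<Omega>" for a b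
  proof -
    let ?g = "\<lambda>x. indicator (box a b) x *\<^sub>R g x"
    have "set_integrable lebesgue (cbox a b) g"
      using g sub by (auto simp: locally_integrable_def)
    then have int: "set_integrable lebesgue (box a b) g"
      by (rule set_integrable_subset) (auto simp: box_subset_cbox)
    then have "?g \<in> borel_measurable lebesgue"
      unfolding set_integrable_def by (rule borel_measurable_integrable)
    then obtain g' where g': "g' \<in> borel_measurable borel" "AE x in lborel. ?g x = g' x"
      by (rule lebesgue_ex_borel_measurable_complex)
    have "AE x in lborel. g' x = 0"
    proof (rule AE_zero_if_integral_box_zero)
      show "integrable lborel g'"
        using int lebesgue_AE_eq_lborel(3)[OF g'(2,1)] by (simp add: set_integrable_def)
      fix c d
      have 1: "AE x in lborel. indicator (box c d) x *\<^sub>R ?g x = indicator (box c d) x *\<^sub>R g' x"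
        using g'(2) by eventually_elim simp
      obtain e f where ef: "box c d \<inter> box a b = box e f" using box_Int_box by blast
      have "(LINT x:box c d|lborel. g' x) = (LINT x|lebesgue. indicator (box c d) x *\<^sub>R ?g x)"
        unfolding set_lebesgue_integral_def
        using g'(1) by (intro lebesgue_AE_eq_lborel(2)[OF 1, symmetric]) measurable
      also have "\<dots> = (LINT x:box e f|lebesgue. g x)"
        unfolding set_lebesgue_integral_def ef[symmetric]
        by (intro Bochner_Integration.integral_cong) (auto simp: indicator_def)
      also have "\<dots> = 0"
      proof (cases "box e f = {}")
        case False
        then have "cbox e f \<subseteq> cbox a b"
          using closure_mono[of "box e f" "box a b"] closure_box[of e f] closure_box[of a b] ef by blast
        then show ?thesis
          using integral_box_eq_0_if_test_integrals_0[OF g zero _ False] sub by blast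
      qed (simp add: set_lebesgue_integral_def)
      finally show "(LINT x:box c d|lborel. g' x) = 0" .
    qed
    \<comment> \<open>The conclusion on the open box extends to the closed one, since the boundary
      is a null set.\<close>
    with g'(2) AE_not_in[OF null_sets_cbox_Diff_box[of a b]] show ?thesis
      by eventually_elim (auto simp: indicator_def)
  qed
  obtain \<D> where D: "countable \<D>" "\<D> \<subseteq> Pow \<Omega>" "\<And>X. X \<in> \<D> \<Longrightarrow> \<exists>a b. X = cbox a b" "\<Union>\<D> = \<Omega>"
    using open_countable_Union_open_cbox[OF \<open>open \<Omega>\<close>] by metis
  have "AE x in lborel. x \<in> X \<longrightarrow> g x = 0" if "X \<in> \<D>" for X
    using D(2) D(3)[OF that] that cbox by blast
  then have "AE x in lborel. \<forall>X\<in>\<D>. x \<in> X \<longrightarrow> g x = 0"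
    unfolding AE_ball_countable[OF D(1)] by blast
  then show ?thesis by (rule eventually_mono) (use D(4) in blast)
qed

section \<open>The operator in terms of Cauchy transforms\<close>

text \<open>A single integral over both variables, as in the third term of the operator; the
  iterated transforms agree with it almost everywhere by \<open>convol_tensor\<close>.\<close>

definition double_cauchy_transform :: "cfun2 \<Rightarrow> cfun2" where
  "double_cauchy_transform = convol (\<lambda>\<eta>. coord_axis 1 (fst \<eta>) + coord_axis 2 (snd \<eta>))
     (\<lambda>\<eta>. cauchy_kernel (fst \<eta>) * cauchy_kernel (snd \<eta>))"

text \<open>The operator in terms of kernels 1 / (w - \<zeta>). Each single integral has the
  coefficient -1 / (2 pi i) * 2 i = -1 / pi, whose sign is absorbed by reversing the kernel; in the
  double integral the two reversals cancel and the minus sign stays.\<close>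

definition cauchy_solution :: "cfun2 \<Rightarrow> cfun2 \<Rightarrow> cfun2 \<Rightarrow> cfun2" where
  "cauchy_solution F1 F2 G w =
     (cauchy_transform 1 F1 w + cauchy_transform 2 F2 w) / pi - double_cauchy_transform G w / pi\<^sup>2"

lemma integrable_cauchy_kernel_tensor:
  "integrable lborel (\<lambda>\<eta>. cauchy_kernel (fst \<eta>) * cauchy_kernel (snd \<eta>))"
  by (intro integrable_tensor integrable_cauchy_kernel)

lemma borel_measurable_coord_axis_sum:
  "(\<lambda>\<eta>. coord_axis 1 (fst \<eta>) + coord_axis 2 (snd \<eta>)) \<in> borel_measurable borel"
  by (intro borel_measurable_continuous_onI continuous_intros
      bounded_linear.continuous_on[OF bounded_linear_coord_axis])

lemmas double_cauchy_convol = borel_measurable_coord_axis_sum integrable_cauchy_kernel_tensor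
lemmas cauchy_convol = borel_measurable_coord_axis integrable_cauchy_kernel

lemma integrable_cauchy_transform: "integrable lborel F \<Longrightarrow> integrable lborel (cauchy_transform j F)"
  unfolding cauchy_transform_def by (rule integrable_convol(2)[OF cauchy_convol])

lemma integrable_double_cauchy_transform:
  "integrable lborel G \<Longrightarrow> integrable lborel (double_cauchy_transform G)"
  unfolding double_cauchy_transform_def by (rule integrable_convol(2)[OF double_cauchy_convol])

lemma integrable_cauchy_solution:
  assumes "integrable lborel F1" "integrable lborel F2" "integrable lborel G"
  shows "integrable lborel (cauchy_solution F1 F2 G)"
  unfolding cauchy_solution_def[abs_def] divide_inverse
  by (intro Bochner_Integration.integrable_diff Bochner_Integration.integrable_add integrable_mult_left
      integrable_cauchy_transform integrable_double_cauchy_transform assms)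

lemma integrable_mult_test_function:
  fixes F \<psi> :: cfun2
  assumes "integrable lborel F" "\<psi> \<in> test_functions \<Omega>"
  shows "integrable lborel (\<lambda>w. F w * \<psi> w)"
proof -
  have [measurable]: "F \<in> borel_measurable borel" "\<psi> \<in> borel_measurable borel"
    using assms borel_measurable_test_function by (auto simp: integrable_iff_bounded)
  obtain B where B: "\<And>z. cmod (\<psi> z) \<le> B" using test_function_bounded[OF assms(2)] by blast
  show ?thesis
  proof (rule Bochner_Integration.integrable_bound)
    show "integrable lborel (\<lambda>w. cmod (F w) * B)" using assms(1) by (intro integrable_mult_left integrable_norm)
    have "cmod (F w) * cmod (\<psi> w) \<le> \<bar>cmod (F w) * B\<bar>" for w
      using mult_left_mono[OF B[of w] norm_ge_zero[of "F w"]] by linarith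
    then show "AE w in lborel. norm (F w * \<psi> w) \<le> norm (cmod (F w) * B)" by (simp add: norm_mult)
  qed measurable
qed

text \<open>The derivative in variable \<open>i\<close> turns the first term into \<open>F\<close>,
  and both the second and the third into \<open>cauchy_transform j G\<close> divided by
  \<open>pi\<close>; these two cancel because of the minus sign. With \<open>i\<close> and
  \<open>j\<close> as parameters one computation gives both equations.\<close>

lemma integral_solution_wirtinger_bar:
  fixes F F' G v \<psi> :: cfun2
  assumes F: "integrable lborel F" "\<And>w. w \<notin> punctured_bidisc \<Longrightarrow> F w = 0"
    and F': "integrable lborel F'" "\<And>w. w \<notin> punctured_bidisc \<Longrightarrow> F' w = 0"
    and G: "integrable lborel G" "\<And>w. w \<notin> punctured_bidisc \<Longrightarrow> G w = 0"
    and weak: "\<And>\<psi>. \<psi> \<in> test_functions punctured_bidisc \<Longrightarrow>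
       (LINT w|lborel. F' w * wirtinger_bar i \<psi> w) = - (LINT w|lborel. G w * \<psi> w)"
    and ij: "(i = 1) \<noteq> (j = 1)"
    and v: "v \<in> borel_measurable borel" "AE w in lborel. v w =
      (cauchy_transform i F w + cauchy_transform j F' w) / pi - cauchy_transform i (cauchy_transform j G) w / pi\<^sup>2"
    and \<psi>: "\<psi> \<in> test_functions punctured_bidisc"
  shows "(LINT w|lborel. v w * wirtinger_bar i \<psi> w) = - (LINT w|lborel. F w * \<psi> w)"
proof -
  have sub: "punctured_bidisc \<subseteq> {w. cmod (coord i w) < 1}" by (auto simp: coord_def)
  have F0: "F w = 0" if "1 \<le> cmod (coord i w)" for w using F(2)[of w] sub that by (auto simp: not_less[symmetric])
  \<comment> \<open>The transform in variable \<open>j\<close> leaves the other coordinate alone, so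
    \<open>cauchy_transform j G\<close> still vanishes for 1 <= |w_i|, although it need not be
    supported in the bidisc.\<close>
  have G0: "cauchy_transform j G w = 0" if "1 \<le> cmod (coord i w)" for w
  proof -
    have "w - coord_axis j \<eta> \<notin> punctured_bidisc" for \<eta>
      using sub that coord_diff_other_axis[OF ij, of w \<eta>] by fastforce
    then show ?thesis unfolding cauchy_transform_def convol_def using G(2) by simp
  qed
  note int = integrable_mult_test_function[OF _ wirtinger_bar_test_function[OF \<psi>, of i]]
  let ?d = "wirtinger_bar i \<psi>" and ?KF = "cauchy_transform i F" and ?KF' = "cauchy_transform j F'"
  let ?KG = "cauchy_transform j G" and ?KKG = "cauchy_transform i (cauchy_transform j G)"
  have [measurable]: "?d \<in> borel_measurable borel"
    using wirtinger_bar_test_function[OF \<psi>] by (rule borel_measurable_test_function)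
  have KG: "integrable lborel ?KG" by (rule integrable_cauchy_transform[OF G(1)])
  have ints: "integrable lborel (\<lambda>w. ?KF w * ?d w)" "integrable lborel (\<lambda>w. ?KF' w * ?d w)"
    "integrable lborel (\<lambda>w. ?KKG w * ?d w)"
    by (intro int integrable_cauchy_transform F F' KG)+
  have [measurable]: "?KF \<in> borel_measurable borel" "?KF' \<in> borel_measurable borel" "?KKG \<in> borel_measurable borel"
    using integrable_cauchy_transform[OF F(1), of i] integrable_cauchy_transform[OF F'(1), of j]
      integrable_cauchy_transform[OF KG, of i] by (simp_all add: integrable_iff_bounded)
  note [measurable] = v(1)
  have "(LINT w|lborel. v w * ?d w) =
      (LINT w|lborel. (?KF w * ?d w + ?KF' w * ?d w) / pi - ?KKG w * ?d w / pi\<^sup>2)"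
  proof (rule integral_cong_AE)
    show "AE w in lborel. v w * ?d w = (?KF w * ?d w + ?KF' w * ?d w) / pi - ?KKG w * ?d w / pi\<^sup>2"
      using v(2)
    proof eventually_elim
      case (elim w)
      show ?case unfolding elim by (simp add: algebra_simps add_divide_distrib)
    qed
  qed measurable
  also have "\<dots> = ((LINT w|lborel. ?KF w * ?d w) + (LINT w|lborel. ?KF' w * ?d w)) / pi
      - (LINT w|lborel. ?KKG w * ?d w) / pi\<^sup>2"
    using ints by simp
  also have "(LINT w|lborel. ?KF w * ?d w) = - pi * (LINT w|lborel. F w * \<psi> w)"
    by (rule integral_cauchy_transform_wirtinger_bar[OF F(1) _ \<psi> sub]) (rule F0)
  also have "(LINT w|lborel. ?KF' w * ?d w) = - (LINT w|lborel. ?KG w * \<psi> w)"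
    by (rule integral_cauchy_transform_other_wirtinger_bar[OF F'(1) _ G(1) _ _ ij \<psi>]) (fact F' G weak)+
  also have "(LINT w|lborel. ?KKG w * ?d w) = - pi * (LINT w|lborel. ?KG w * \<psi> w)"
    by (rule integral_cauchy_transform_wirtinger_bar[OF KG _ \<psi> sub]) (rule G0)
  also have "(complex_of_real (- pi) * (LINT w|lborel. F w * \<psi> w) + - (LINT w|lborel. ?KG w * \<psi> w)) / pi
      - complex_of_real (- pi) * (LINT w|lborel. ?KG w * \<psi> w) / pi\<^sup>2 = - (LINT w|lborel. F w * \<psi> w)"
    by (simp add: field_simps power2_eq_square)
  finally show ?thesis .
qed

lemma cauchy_solution_weak:
  fixes F1 F2 G \<psi> :: cfun2
  assumes F1: "integrable lborel F1" "\<And>w. w \<notin> punctured_bidisc \<Longrightarrow> F1 w = 0"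
    and F2: "integrable lborel F2" "\<And>w. w \<notin> punctured_bidisc \<Longrightarrow> F2 w = 0"
    and G: "integrable lborel G" "\<And>w. w \<notin> punctured_bidisc \<Longrightarrow> G w = 0"
    and weak1: "\<And>\<psi>. \<psi> \<in> test_functions punctured_bidisc \<Longrightarrow>
       (LINT w|lborel. F1 w * wirtinger_bar 2 \<psi> w) = - (LINT w|lborel. G w * \<psi> w)"
    and weak2: "\<And>\<psi>. \<psi> \<in> test_functions punctured_bidisc \<Longrightarrow>
       (LINT w|lborel. F2 w * wirtinger_bar 1 \<psi> w) = - (LINT w|lborel. G w * \<psi> w)"
    and \<psi>: "\<psi> \<in> test_functions punctured_bidisc"
  shows "(LINT w|lborel. cauchy_solution F1 F2 G w * wirtinger_bar 1 \<psi> w) = - (LINT w|lborel. F1 w * \<psi> w)"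
    and "(LINT w|lborel. cauchy_solution F1 F2 G w * wirtinger_bar 2 \<psi> w) = - (LINT w|lborel. F2 w * \<psi> w)"
proof -
  have v: "cauchy_solution F1 F2 G \<in> borel_measurable borel"
    using integrable_cauchy_solution[OF F1(1) F2(1) G(1)] by (simp add: integrable_iff_bounded)
  \<comment> \<open>For each equation the double transform is rewritten with the transform in the
    differentiated variable outermost.\<close>
  note tensor = convol_tensor[OF integrable_cauchy_kernel integrable_cauchy_kernel
      borel_measurable_coord_axis borel_measurable_coord_axis G(1), of 1 2,
      folded double_cauchy_transform_def cauchy_transform_def]
  have ae: "AE w in lborel. cauchy_solution F1 F2 G w =
      (cauchy_transform 1 F1 w + cauchy_transform 2 F2 w) / pi - cauchy_transform 1 (cauchy_transform 2 G) w / pi\<^sup>2"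
    using tensor(1) by eventually_elim (simp add: cauchy_solution_def)
  have ae': "AE w in lborel. cauchy_solution F1 F2 G w =
      (cauchy_transform 2 F2 w + cauchy_transform 1 F1 w) / pi - cauchy_transform 2 (cauchy_transform 1 G) w / pi\<^sup>2"
    using tensor(2) by eventually_elim (simp add: cauchy_solution_def add.commute)
  show "(LINT w|lborel. cauchy_solution F1 F2 G w * wirtinger_bar 1 \<psi> w) = - (LINT w|lborel. F1 w * \<psi> w)"
    by (rule integral_solution_wirtinger_bar[OF F1 F2 G weak2 _ v ae \<psi>]) simp_all
  show "(LINT w|lborel. cauchy_solution F1 F2 G w * wirtinger_bar 2 \<psi> w) = - (LINT w|lborel. F2 w * \<psi> w)"
    by (rule integral_solution_wirtinger_bar[OF F2 F1 G weak1 _ v ae' \<psi>]) simp_all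
qed

section \<open>The L^p bound for the Cauchy transforms\<close>

lemma powr_add3_le:
  fixes a b c :: real
  assumes "0 \<le> a" "0 \<le> b" "0 \<le> c" "0 \<le> p"
  shows "(a + b + c) powr p \<le> 3 powr p * (a powr p + b powr p + c powr p)"
proof -
  define m where "m = max a (max b c)"
  have m: "0 \<le> m" "a + b + c \<le> 3 * m" using assms by (auto simp: m_def)
  then have "(a + b + c) powr p \<le> (3 * m) powr p" using assms by (intro powr_mono2) auto
  also have "\<dots> = 3 powr p * m powr p" using m by (simp add: powr_mult)
  also have "m powr p \<le> a powr p + b powr p + c powr p" by (auto simp: m_def max_def add_increasing add_increasing2)
  finally show ?thesis by (simp add: mult_left_mono)
qed

lemma nn_integral_powr_add3_le:
  fixes f g h k :: "'a::euclidean_space \<Rightarrow> complex"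
  assumes [measurable]: "f \<in> borel_measurable borel" "g \<in> borel_measurable borel" "h \<in> borel_measurable borel"
    and le: "\<And>x. cmod (k x) \<le> cmod (f x) + cmod (g x) + cmod (h x)" and p: "0 \<le> p"
  shows "(\<integral>\<^sup>+x. cmod (k x) powr p \<partial>lborel) \<le> ennreal (3 powr p) * ((\<integral>\<^sup>+x. cmod (f x) powr p \<partial>lborel)
     + (\<integral>\<^sup>+x. cmod (g x) powr p \<partial>lborel) + (\<integral>\<^sup>+x. cmod (h x) powr p \<partial>lborel))"
proof -
  have "(\<integral>\<^sup>+x. cmod (k x) powr p \<partial>lborel) \<le> (\<integral>\<^sup>+x. ennreal (3 powr p) *
     (ennreal (cmod (f x) powr p) + ennreal (cmod (g x) powr p) + ennreal (cmod (h x) powr p)) \<partial>lborel)"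
  proof (rule nn_integral_mono)
    fix x
    have "cmod (k x) powr p \<le> (cmod (f x) + cmod (g x) + cmod (h x)) powr p"
      using le p by (intro powr_mono2) auto
    also have "\<dots> \<le> 3 powr p * (cmod (f x) powr p + cmod (g x) powr p + cmod (h x) powr p)"
      using p by (intro powr_add3_le) auto
    finally show "ennreal (cmod (k x) powr p) \<le> ennreal (3 powr p) *
       (ennreal (cmod (f x) powr p) + ennreal (cmod (g x) powr p) + ennreal (cmod (h x) powr p))"
      by (simp add: ennreal_mult[symmetric] ennreal_plus[symmetric] ennreal_leI del: ennreal_plus)
  qed
  then show ?thesis by (simp add: nn_integral_cmult nn_integral_add)
qed

text \<open>The constant is built from \<open>p\<close> and the L^1 norms of the single and the
  double kernel, hence is uniform in the three functions.\<close>

lemma cauchy_solution_Lp: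
  assumes p: "1 \<le> p"
  obtains C where "0 \<le> C" "\<And>F1 F2 G :: cfun2. F1 \<in> borel_measurable borel \<Longrightarrow> F2 \<in> borel_measurable borel \<Longrightarrow>
    G \<in> borel_measurable borel \<Longrightarrow> (\<integral>\<^sup>+w. cmod (cauchy_solution F1 F2 G w) powr p \<partial>lborel)
    \<le> ennreal C * ((\<integral>\<^sup>+w. cmod (F1 w) powr p \<partial>lborel) + (\<integral>\<^sup>+w. cmod (F2 w) powr p \<partial>lborel)
       + (\<integral>\<^sup>+w. cmod (G w) powr p \<partial>lborel))"
proof -
  let ?k = "cauchy_kernel" and ?kk = "\<lambda>\<eta>. cauchy_kernel (fst \<eta>) * cauchy_kernel (snd \<eta>)"
  define M M2 where "M = (LINT \<eta>|lborel. cmod (?k \<eta>))" and "M2 = (LINT \<eta>|lborel. cmod (?kk \<eta>))"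
  have M: "(\<integral>\<^sup>+\<eta>. cmod (?k \<eta>) \<partial>lborel) = ennreal M" "0 \<le> M"
    unfolding M_def using integrable_cauchy_kernel by (auto intro!: nn_integral_eq_integral integrable_norm)
  have M2: "(\<integral>\<^sup>+\<eta>. cmod (?kk \<eta>) \<partial>lborel) = ennreal M2" "0 \<le> M2"
    unfolding M2_def using integrable_cauchy_kernel_tensor by (auto intro!: nn_integral_eq_integral integrable_norm)
  define D where "D = (M + 1) powr p * M + (M2 + 1) powr p * M2"
  have D: "(M + 1) powr p * M \<le> D" "(M2 + 1) powr p * M2 \<le> D" "0 \<le> D"
    using M(2) M2(2) by (simp_all add: D_def)
  show thesis
  proof (rule that[of "3 powr p * D"])
    show "0 \<le> 3 powr p * D" using D by simp
    fix F1 F2 G :: cfun2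
    assume [measurable]: "F1 \<in> borel_measurable borel" "F2 \<in> borel_measurable borel" "G \<in> borel_measurable borel"
    let ?K1 = "cauchy_transform 1 F1" and ?K2 = "cauchy_transform 2 F2" and ?K = "double_cauchy_transform G"
    have K: "?K1 \<in> borel_measurable borel" "?K2 \<in> borel_measurable borel" "?K \<in> borel_measurable borel"
      unfolding cauchy_transform_def double_cauchy_transform_def
      by (intro borel_measurable_convol cauchy_convol double_cauchy_convol; measurable)+
    have "cmod (cauchy_solution F1 F2 G w) \<le> cmod (?K1 w) + cmod (?K2 w) + cmod (?K w)" for w
    proof -
      \<comment> \<open>Dividing by \<open>pi\<close> or its square only decreases the modulus, so
        these divisors are dropped.\<close>
      have pi: "1 \<le> pi" "1 \<le> pi\<^sup>2" using pi_gt3 by (auto simp: one_le_power)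
      have "cmod (cauchy_solution F1 F2 G w) \<le> cmod (?K1 w + ?K2 w) / pi + cmod (?K w) / pi\<^sup>2"
        unfolding cauchy_solution_def by (rule order_trans[OF norm_triangle_ineq4]) (simp add: norm_divide norm_power)
      also have "\<dots> \<le> cmod (?K1 w + ?K2 w) / 1 + cmod (?K w) / 1"
        using pi by (intro add_mono divide_left_mono) auto
      finally show ?thesis using norm_triangle_ineq[of "?K1 w" "?K2 w"] by simp
    qed
    then have "(\<integral>\<^sup>+w. cmod (cauchy_solution F1 F2 G w) powr p \<partial>lborel) \<le> ennreal (3 powr p) *
       ((\<integral>\<^sup>+w. cmod (?K1 w) powr p \<partial>lborel) + (\<integral>\<^sup>+w. cmod (?K2 w) powr p \<partial>lborel) + (\<integral>\<^sup>+w. cmod (?K w) powr p \<partial>lborel))"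
      by (rule nn_integral_powr_add3_le[OF K]) (use p in auto)
    also have "\<dots> \<le> ennreal (3 powr p) * (ennreal D * (\<integral>\<^sup>+w. cmod (F1 w) powr p \<partial>lborel)
        + ennreal D * (\<integral>\<^sup>+w. cmod (F2 w) powr p \<partial>lborel) + ennreal D * (\<integral>\<^sup>+w. cmod (G w) powr p \<partial>lborel))"
    proof (intro mult_left_mono add_mono)
      have "(\<integral>\<^sup>+w. cmod (cauchy_transform j F w) powr p \<partial>lborel) \<le> ennreal D * (\<integral>\<^sup>+w. cmod (F w) powr p \<partial>lborel)"
        if "F \<in> borel_measurable borel" for j F
        unfolding cauchy_transform_def
        by (rule order_trans[OF nn_integral_convol_powr_le[OF cauchy_convol that p M]])
          (intro mult_right_mono ennreal_leI D; simp)
      then show "(\<integral>\<^sup>+w. cmod (?K1 w) powr p \<partial>lborel) \<le> ennreal D * (\<integral>\<^sup>+w. cmod (F1 w) powr p \<partial>lborel)"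
        "(\<integral>\<^sup>+w. cmod (?K2 w) powr p \<partial>lborel) \<le> ennreal D * (\<integral>\<^sup>+w. cmod (F2 w) powr p \<partial>lborel)" by simp_all
      show "(\<integral>\<^sup>+w. cmod (?K w) powr p \<partial>lborel) \<le> ennreal D * (\<integral>\<^sup>+w. cmod (G w) powr p \<partial>lborel)"
        unfolding double_cauchy_transform_def
        by (rule order_trans[OF nn_integral_convol_powr_le[OF double_cauchy_convol \<open>G \<in> borel_measurable borel\<close> p M2]])
          (intro mult_right_mono ennreal_leI D; simp)
    qed auto
    finally show "(\<integral>\<^sup>+w. cmod (cauchy_solution F1 F2 G w) powr p \<partial>lborel)
    \<le> ennreal (3 powr p * D) * ((\<integral>\<^sup>+w. cmod (F1 w) powr p \<partial>lborel) + (\<integral>\<^sup>+w. cmod (F2 w) powr p \<partial>lborel)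
       + (\<integral>\<^sup>+w. cmod (G w) powr p \<partial>lborel))"
      using D(3) by (simp only: ennreal_mult[OF powr_ge_zero] distrib_left mult.assoc)
  qed
qed


text \<open>Functions equal almost everywhere on the space need not agree on a given slice. By
  Tonelli they agree almost everywhere on almost all slices, which is what the slice integrals of
  the operator require.\<close>

lemma AE_lborel_shift:
  fixes \<iota> :: "'b::euclidean_space \<Rightarrow> 'a::euclidean_space"
  assumes P: "AE x in lborel. P x" and [measurable]: "\<iota> \<in> borel_measurable borel"
  shows "AE w in lborel. AE \<eta> in lborel. P (w - \<iota> \<eta>)"
proof -
  obtain N where N: "{x \<in> space lborel. \<not> P x} \<subseteq> N" "N \<in> null_sets lborel"
    using P by (auto elim!: AE_E simp: null_sets_def)
  then have [measurable]: "N \<in> sets borel" by auto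
  have "(\<integral>\<^sup>+w. \<integral>\<^sup>+\<eta>. indicator N (w - \<iota> \<eta>) \<partial>lborel \<partial>lborel)
      = (\<integral>\<^sup>+\<eta>. \<integral>\<^sup>+w. indicator N (w - \<iota> \<eta>) \<partial>lborel \<partial>lborel)"
    by (rule lborel_pair.Fubini'[symmetric]) measurable
  also have "\<dots> = (\<integral>\<^sup>+\<eta>. \<integral>\<^sup>+w. indicator N w \<partial>(lborel :: 'a measure) \<partial>(lborel :: 'b measure))"
    by (intro nn_integral_cong lborel_nn_integral_shift(2)) measurable
  also have "\<dots> = 0" using N(2) by (simp add: null_sets_def)
  finally have "AE w in lborel. (\<integral>\<^sup>+\<eta>. indicator N (w - \<iota> \<eta>) \<partial>lborel) = 0"
    by (subst (asm) nn_integral_0_iff_AE) simp_all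
  then show ?thesis
  proof eventually_elim
    case (elim w)
    then have "AE \<eta> in lborel. (indicator N (w - \<iota> \<eta>) :: ennreal) = 0"
      by (subst (asm) nn_integral_0_iff_AE) simp_all
    then show ?case by eventually_elim (use N(1) in \<open>auto simp: indicator_def split: if_splits\<close>)
  qed
qed

lemma AE_lborel_reflect:
  fixes c :: "'a::euclidean_space"
  assumes "AE x in lborel. P x" shows "AE x in lborel. P (c - x)"
proof -
  have "AE x in distr lborel borel (\<lambda>x. c - x). P x"
    unfolding distr_lborel_reflect by (rule assms)
  from AE_distrD[OF _ this] show ?thesis by simp
qed

lemma cauchy_kernel_disc: "a \<in> disc \<Longrightarrow> b \<in> disc \<Longrightarrow> cauchy_kernel (a - b) = 1 / (a - b)"
  using norm_triangle_ineq4[of a b] by (auto simp: cauchy_kernel_def)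

text \<open>The point \<open>w - coord_axis j (coord j w - \<zeta>)\<close> is \<open>w\<close> with
  its j-th coordinate replaced by \<zeta>. The reflection \<zeta> = w_j - \<eta> turns the slice
  integral into a convolution, and the minus sign comes from the reversed kernel.\<close>

lemma slice_integral_eq_cauchy_transform:
  fixes f F :: cfun2
  assumes F: "integrable lborel F" "\<And>w. w \<notin> punctured_bidisc \<Longrightarrow> F w = 0"
    and f: "AE w in lborel. w \<in> punctured_bidisc \<longrightarrow> f w = F w"
    and A: "\<And>w \<zeta>. w \<in> punctured_bidisc \<Longrightarrow>
       w - coord_axis j (coord j w - \<zeta>) \<in> punctured_bidisc \<longleftrightarrow> \<zeta> \<in> A" "A \<subseteq> disc"
  shows "AE w in lborel. w \<in> punctured_bidisc \<longrightarrow>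
      set_integrable lebesgue A (\<lambda>\<zeta>. f (w - coord_axis j (coord j w - \<zeta>)) / (\<zeta> - coord j w)) \<and>
      (LINT \<zeta>:A|lebesgue. f (w - coord_axis j (coord j w - \<zeta>)) / (\<zeta> - coord j w)) = - cauchy_transform j F w"
  using AE_lborel_shift[OF f borel_measurable_coord_axis[of j]] integrable_convol(1)[OF borel_measurable_coord_axis[of j] integrable_cauchy_kernel F(1)]
proof eventually_elim
  case (elim w)
  show ?case
  proof (intro impI)
    assume w: "w \<in> punctured_bidisc"
    then have wj: "coord j w \<in> disc" by (auto simp: coord_def)
    have [measurable]: "F \<in> borel_measurable borel" using F by (simp add: integrable_iff_bounded)
    define h where "h \<eta> = cauchy_kernel \<eta> * F (w - coord_axis j \<eta>)" for \<eta>
    have h: "h \<in> borel_measurable borel" unfolding h_def[abs_def] by measurable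
    then have [measurable]: "(\<lambda>\<zeta>. - h (coord j w - \<zeta>)) \<in> borel_measurable borel" by measurable
    have "AE \<zeta> in lborel. indicator A \<zeta> *\<^sub>R (f (w - coord_axis j (coord j w - \<zeta>)) / (\<zeta> - coord j w))
        = - h (coord j w - \<zeta>)"
      using AE_lborel_reflect[OF elim(1), of "coord j w"]
    proof eventually_elim
      case (elim \<zeta>)
      show ?case
      proof (cases "\<zeta> \<in> A")
        case True
        then have "cauchy_kernel (coord j w - \<zeta>) = 1 / (coord j w - \<zeta>)"
          using A(2) wj by (intro cauchy_kernel_disc) auto
        also have "\<dots> = - (1 / (\<zeta> - coord j w))" by (metis minus_diff_eq minus_divide_right)
        finally show ?thesis using elim A(1)[OF w] True by (simp add: h_def)
      next
        case False
        then show ?thesis using A(1)[OF w] F(2) by (simp add: h_def)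
      qed
    qed
    note eq = lebesgue_AE_eq_lborel(2,3)[OF this \<open>(\<lambda>\<zeta>. - h (coord j w - \<zeta>)) \<in> borel_measurable borel\<close>]
    have "integrable lborel h" using elim(2) by (simp add: h_def[abs_def])
    then show "set_integrable lebesgue A (\<lambda>\<zeta>. f (w - coord_axis j (coord j w - \<zeta>)) / (\<zeta> - coord j w)) \<and>
      (LINT \<zeta>:A|lebesgue. f (w - coord_axis j (coord j w - \<zeta>)) / (\<zeta> - coord j w)) = - cauchy_transform j F w"
      unfolding set_integrable_def set_lebesgue_integral_def eq
      using lborel_integrable_shift(3)[OF h, of "coord j w"] lborel_integral_shift(3)[OF h, of "coord j w"]
      by (simp add: cauchy_transform_def convol_def h_def)
  qed
qed

text \<open>The integral runs over the whole domain, so an almost everywhere representative can be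
  inserted at once; the two kernel reversals leave no sign.\<close>

lemma double_integral_eq_double_cauchy_transform:
  fixes g G :: cfun2
  assumes G: "integrable lborel G" "\<And>w. w \<notin> punctured_bidisc \<Longrightarrow> G w = 0"
    and g: "AE w in lborel. w \<in> punctured_bidisc \<longrightarrow> g w = G w"
  shows "AE w in lborel. w \<in> punctured_bidisc \<longrightarrow>
      set_integrable lebesgue punctured_bidisc (\<lambda>\<zeta>. g \<zeta> / ((fst \<zeta> - fst w) * (snd \<zeta> - snd w))) \<and>
      (LINT \<zeta>:punctured_bidisc|lebesgue. g \<zeta> / ((fst \<zeta> - fst w) * (snd \<zeta> - snd w))) = double_cauchy_transform G w"
  using integrable_convol(1)[OF double_cauchy_convol G(1)]
proof eventually_elim
  case (elim w)
  show ?case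
  proof (intro impI)
    assume w: "w \<in> punctured_bidisc"
    have [measurable]: "G \<in> borel_measurable borel" using G by (simp add: integrable_iff_bounded)
    define \<kappa> where "\<kappa> \<eta> = cauchy_kernel (fst \<eta>) * cauchy_kernel (snd \<eta>)" for \<eta>
    have [measurable]: "\<kappa> \<in> borel_measurable borel"
      using integrable_cauchy_kernel_tensor by (simp add: integrable_iff_bounded \<kappa>_def[abs_def])
    define h where "h \<eta> = \<kappa> \<eta> * G (w - \<eta>)" for \<eta>
    have h: "h \<in> borel_measurable borel" unfolding h_def[abs_def] by measurable
    then have meas: "(\<lambda>\<zeta>. h (w - \<zeta>)) \<in> borel_measurable borel" by measurable
    have "AE \<zeta> in lborel. indicator punctured_bidisc \<zeta> *\<^sub>R (g \<zeta> / ((fst \<zeta> - fst w) * (snd \<zeta> - snd w)))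
        = h (w - \<zeta>)"
      using g
    proof eventually_elim
      case (elim \<zeta>)
      show ?case
      proof (cases "\<zeta> \<in> punctured_bidisc")
        case True
        then have "cauchy_kernel (fst w - fst \<zeta>) = 1 / (fst w - fst \<zeta>)" "cauchy_kernel (snd w - snd \<zeta>) = 1 / (snd w - snd \<zeta>)"
          using w by (auto intro!: cauchy_kernel_disc)
        then have "\<kappa> (w - \<zeta>) = 1 / ((fst w - fst \<zeta>) * (snd w - snd \<zeta>))" by (simp add: \<kappa>_def)
        also have "(fst w - fst \<zeta>) * (snd w - snd \<zeta>) = (fst \<zeta> - fst w) * (snd \<zeta> - snd w)" by (simp add: algebra_simps)
        finally show ?thesis using elim True by (simp add: h_def)
      qed (simp add: h_def G(2))
    qed
    note eq = lebesgue_AE_eq_lborel(2,3)[OF this meas]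
    have axis: "coord_axis 1 (fst \<eta>) + coord_axis 2 (snd \<eta>) = \<eta>" for \<eta> by simp
    have "integrable lborel h" using elim unfolding axis by (simp add: h_def[abs_def] \<kappa>_def)
    then show "set_integrable lebesgue punctured_bidisc (\<lambda>\<zeta>. g \<zeta> / ((fst \<zeta> - fst w) * (snd \<zeta> - snd w))) \<and>
      (LINT \<zeta>:punctured_bidisc|lebesgue. g \<zeta> / ((fst \<zeta> - fst w) * (snd \<zeta> - snd w))) = double_cauchy_transform G w"
      unfolding set_integrable_def set_lebesgue_integral_def eq
      using lborel_integrable_shift(3)[OF h, of w] lborel_integral_shift(3)[OF h, of w]
      unfolding double_cauchy_transform_def convol_def axis by (simp add: h_def \<kappa>_def)
  qed
qed

lemma T_op_eq_cauchy_solution: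
  fixes f1 f2 F1 F2 G :: cfun2
  assumes F1: "integrable lborel F1" "\<And>w. w \<notin> punctured_bidisc \<Longrightarrow> F1 w = 0"
    and F2: "integrable lborel F2" "\<And>w. w \<notin> punctured_bidisc \<Longrightarrow> F2 w = 0"
    and G: "integrable lborel G" "\<And>w. w \<notin> punctured_bidisc \<Longrightarrow> G w = 0"
    and f1: "AE w in lborel. w \<in> punctured_bidisc \<longrightarrow> f1 w = F1 w"
    and f2: "AE w in lborel. w \<in> punctured_bidisc \<longrightarrow> f2 w = F2 w"
    and g: "AE w in lborel. w \<in> punctured_bidisc \<longrightarrow> mixed_fun f1 f2 w = G w"
  shows "AE w in lborel. w \<in> punctured_bidisc \<longrightarrow>
      T_converges_at f1 f2 w \<and> T_op f1 f2 w = cauchy_solution F1 F2 G w"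
proof -
  \<comment> \<open>Pulls the factors 2 i of the area forms out of the integrals.\<close>
  have c: "set_lebesgue_integral M A (\<lambda>x. h x * c) = set_lebesgue_integral M A h * c"
    for M :: "'m measure" and A and h :: "'m \<Rightarrow> complex" and c
    unfolding set_lebesgue_integral_def by (simp flip: integral_mult_left_zero mult_scaleR_left)
  have s1: "AE w in lborel. w \<in> punctured_bidisc \<longrightarrow>
      set_integrable lebesgue disc (\<lambda>\<zeta>. f1 (\<zeta>, snd w) / (\<zeta> - fst w)) \<and>
      (LINT \<zeta>:disc|lebesgue. f1 (\<zeta>, snd w) / (\<zeta> - fst w)) = - cauchy_transform 1 F1 w"
  proof -
    have eq: "w - coord_axis 1 (fst w - \<zeta>) = (\<zeta>, snd w)" "coord 1 w = fst w" for w \<zeta>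
      by (simp_all add: prod_eq_iff)
    show ?thesis
      by (rule slice_integral_eq_cauchy_transform[OF F1 f1, of 1 disc, unfolded eq]) auto
  qed
  have s2: "AE w in lborel. w \<in> punctured_bidisc \<longrightarrow>
      set_integrable lebesgue punctured_disc (\<lambda>\<zeta>. f2 (fst w, \<zeta>) / (\<zeta> - snd w)) \<and>
      (LINT \<zeta>:punctured_disc|lebesgue. f2 (fst w, \<zeta>) / (\<zeta> - snd w)) = - cauchy_transform 2 F2 w"
  proof -
    have eq: "w - coord_axis 2 (snd w - \<zeta>) = (fst w, \<zeta>)" "coord 2 w = snd w" for w \<zeta>
      by (simp_all add: prod_eq_iff)
    show ?thesis
      by (rule slice_integral_eq_cauchy_transform[OF F2 f2, of 2 punctured_disc, unfolded eq]) auto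
  qed
  have s3: "AE w in lborel. w \<in> punctured_bidisc \<longrightarrow>
      set_integrable lebesgue punctured_bidisc
        (\<lambda>\<zeta>. mixed_fun f1 f2 \<zeta> / ((fst \<zeta> - fst w) * (snd \<zeta> - snd w))) \<and>
      (LINT \<zeta>:punctured_bidisc|lebesgue. mixed_fun f1 f2 \<zeta> / ((fst \<zeta> - fst w) * (snd \<zeta> - snd w)))
        = double_cauchy_transform G w"
    by (rule double_integral_eq_double_cauchy_transform[OF G(1) _ g]) (rule G(2))
  from s1 s2 s3 show ?thesis
  proof eventually_elim
    case (elim w)
    then show ?case
      unfolding T_converges_at_def T_op_def c cauchy_solution_def
      by (auto simp: field_simps power2_eq_square)
  qed
qed

section \<open>Transport of the weak equations\<close>

lemma integral_hartogs_param:
  fixes a \<phi> :: cfun2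
  assumes [measurable]: "a \<in> borel_measurable borel" "\<phi> \<in> borel_measurable borel"
    and a: "\<And>z. z \<notin> hartogs \<Longrightarrow> a z = 0"
  shows "(LINT z|lborel. a z * \<phi> z) = (LINT w|lborel. hartogs_jacobian w *\<^sub>R (a (hartogs_param w) * \<phi> (hartogs_param w)))"
proof -
  have "(LINT z|lborel. a z * \<phi> z) = (LINT z|lborel. indicator hartogs z *\<^sub>R (a z * \<phi> z))"
    using a by (intro Bochner_Integration.integral_cong) (auto simp: indicator_def)
  also have "\<dots> = (LINT w|lborel. hartogs_jacobian w *\<^sub>R (a (hartogs_param w) * \<phi> (hartogs_param w)))"
    by (rule integral_hartogs) measurable
  finally show ?thesis .
qed

lemma hartogs_jacobian_eq:
  "w \<in> punctured_bidisc \<Longrightarrow> complex_of_real (hartogs_jacobian w) = snd w * cnj (snd w)"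
  by (simp add: hartogs_jacobian_def complex_norm_square[symmetric])

text \<open>The Jacobian is \<open>snd w * cnj (snd w)\<close>. The pullback divides by
  \<open>snd w\<close>, which leaves \<open>cnj (snd w)\<close>; its barred derivative in the first
  variable divides by \<open>cnj (snd w)\<close> as well, which leaves 1.\<close>

lemma
  fixes a \<Psi> :: cfun2
  assumes a [measurable]: "a \<in> borel_measurable borel" and a0: "\<And>z. z \<notin> hartogs \<Longrightarrow> a z = 0"
    and \<Psi>: "\<Psi> \<in> test_functions punctured_bidisc"
  shows integral_hartogs_pullback: "(LINT z|lborel. a z * hartogs_pullback 1 0 \<Psi> z)
      = (LINT w|lborel. cnj (snd w) * a (hartogs_param w) * \<Psi> w)"
    and integral_hartogs_pullback_wirtinger1: "(LINT z|lborel. a z * wirtinger_bar 1 (hartogs_pullback 1 0 \<Psi>) z)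
      = (LINT w|lborel. a (hartogs_param w) * wirtinger_bar 1 \<Psi> w)"
    and integral_hartogs_pullback_wirtinger2: "(LINT z|lborel. a z * wirtinger_bar 2 (hartogs_pullback 1 0 \<Psi>) z)
      = (LINT w|lborel. a (hartogs_param w) * (cnj (snd w) * wirtinger_bar 2 \<Psi> w - cnj (fst w) * wirtinger_bar 1 \<Psi> w))"
proof -
  note test = test_functions_hartogs_pullback(1)[OF \<Psi>, of 1 0]
  note meas = borel_measurable_test_function[OF test] borel_measurable_test_function[OF wirtinger_bar_test_function[OF test]]
  have off: "a (hartogs_param w) = 0" if "w \<notin> punctured_bidisc" for w
    using that hartogs_param_mem a0 by blast
  have eq: "(LINT z|lborel. a z * \<phi> z) = (LINT w|lborel. h w)"
    if "\<phi> \<in> borel_measurable borel"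
      and "\<And>w. w \<in> punctured_bidisc \<Longrightarrow> snd w * cnj (snd w) * (a (hartogs_param w) * \<phi> (hartogs_param w)) = h w"
      and "\<And>w. w \<notin> punctured_bidisc \<Longrightarrow> h w = 0" for \<phi> h
  proof (subst integral_hartogs_param[OF a that(1)], rule a0, assumption, rule Bochner_Integration.integral_cong[OF refl])
    fix w
    show "hartogs_jacobian w *\<^sub>R (a (hartogs_param w) * \<phi> (hartogs_param w)) = h w"
    proof (cases "w \<in> punctured_bidisc")
      case True
      then show ?thesis using that(2)[OF True] hartogs_jacobian_eq[OF True] by (simp add: scaleR_conv_of_real)
    next
      case False
      then show ?thesis using that(3)[OF False] hartogs_jacobian_simps(3)[of w] by simp
    qed
  qed
  have map: "hartogs_map (hartogs_param w) = w" "snd (hartogs_param w) = snd w" "snd w \<noteq> 0"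
    if "w \<in> punctured_bidisc" for w
  proof -
    show "snd w \<noteq> 0" using that by auto
    then show "hartogs_map (hartogs_param w) = w" by (rule hartogs_map_param)
    show "snd (hartogs_param w) = snd w" by (simp add: hartogs_param_def)
  qed
  show "(LINT z|lborel. a z * hartogs_pullback 1 0 \<Psi> z) = (LINT w|lborel. cnj (snd w) * a (hartogs_param w) * \<Psi> w)"
    by (rule eq[OF meas(1)]) (simp_all add: off hartogs_pullback_def map)
  show "(LINT z|lborel. a z * wirtinger_bar 1 (hartogs_pullback 1 0 \<Psi>) z)
      = (LINT w|lborel. a (hartogs_param w) * wirtinger_bar 1 \<Psi> w)"
    by (rule eq[OF meas(2)], unfold wirtinger_bar_hartogs_pullback[OF \<Psi>])
      (simp_all add: off hartogs_pullback_def map field_simps)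
  show "(LINT z|lborel. a z * wirtinger_bar 2 (hartogs_pullback 1 0 \<Psi>) z)
      = (LINT w|lborel. a (hartogs_param w) * (cnj (snd w) * wirtinger_bar 2 \<Psi> w - cnj (fst w) * wirtinger_bar 1 \<Psi> w))"
    by (rule eq[OF meas(2)], unfold wirtinger_bar_hartogs_pullback[OF \<Psi>])
      (simp_all add: off hartogs_pullback_def map field_simps)
qed

lemma wirtinger_bar_coordinates:
  "wirtinger_bar 1 (\<lambda>w. cnj (fst w)) z = 1" "wirtinger_bar 2 (\<lambda>w. cnj (fst w)) z = 0"
  "wirtinger_bar 1 (\<lambda>w. cnj (snd w)) z = 0" "wirtinger_bar 2 (\<lambda>w. cnj (snd w)) z = 1"
  "wirtinger_bar 1 snd z = 0" "wirtinger_bar 2 snd z = 0"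
proof -
  note D = bounded_linear_imp_has_derivative
  have 1: "((\<lambda>w. cnj (fst w)) has_derivative (\<lambda>w. cnj (fst w))) (at z)"
    by (intro D bounded_linear_compose[OF bounded_linear_cnj bounded_linear_fst])
  have 2: "((\<lambda>w. cnj (snd w)) has_derivative (\<lambda>w. cnj (snd w))) (at z)"
    by (intro D bounded_linear_compose[OF bounded_linear_cnj bounded_linear_snd])
  have 3: "(snd has_derivative snd) (at z)" by (intro D bounded_linear_snd)
  show "wirtinger_bar 1 (\<lambda>w. cnj (fst w)) z = 1" "wirtinger_bar 2 (\<lambda>w. cnj (fst w)) z = 0"
    unfolding wirtinger_bar_has_derivative[OF 1] by simp_all
  show "wirtinger_bar 1 (\<lambda>w. cnj (snd w)) z = 0" "wirtinger_bar 2 (\<lambda>w. cnj (snd w)) z = 1"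
    unfolding wirtinger_bar_has_derivative[OF 2] by simp_all
  show "wirtinger_bar 1 snd z = 0" "wirtinger_bar 2 snd z = 0"
    unfolding wirtinger_bar_has_derivative[OF 3] by simp_all
qed

lemma C_k_cnj_coordinates: "C_k k (\<lambda>w. cnj (fst w))" "C_k k (\<lambda>w. cnj (snd w))"
  by (intro C_k_cnj C_k_fst C_k_snd)+

text \<open>The chain rule for distributions. Formally \<open>a1\<close> composed with the
  parametrization has the derivatives \<open>cnj (snd w) * b1\<close> and
  \<open>cnj (fst w) * b1 + b2\<close> in the two barred variables, and the product rule gives the
  common right side. Closedness enters through \<open>b2\<close>, which is a derivative of both
  \<open>a1\<close> and \<open>a2\<close>.\<close>

lemma transported_weak_equations:
  fixes a1 a2 b1 b2 :: cfun2
  assumes meas: "a1 \<in> borel_measurable borel" "a2 \<in> borel_measurable borel"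
      "b1 \<in> borel_measurable borel" "b2 \<in> borel_measurable borel"
    and off: "\<And>z. z \<notin> hartogs \<Longrightarrow> a1 z = 0" "\<And>z. z \<notin> hartogs \<Longrightarrow> a2 z = 0"
      "\<And>z. z \<notin> hartogs \<Longrightarrow> b1 z = 0" "\<And>z. z \<notin> hartogs \<Longrightarrow> b2 z = 0"
    and weak11: "\<And>\<psi>. \<psi> \<in> test_functions hartogs \<Longrightarrow>
      (LINT z|lborel. a1 z * wirtinger_bar 1 \<psi> z) = - (LINT z|lborel. b1 z * \<psi> z)"
    and weak12: "\<And>\<psi>. \<psi> \<in> test_functions hartogs \<Longrightarrow>
      (LINT z|lborel. a1 z * wirtinger_bar 2 \<psi> z) = - (LINT z|lborel. b2 z * \<psi> z)"
    and weak21: "\<And>\<psi>. \<psi> \<in> test_functions hartogs \<Longrightarrow>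
      (LINT z|lborel. a2 z * wirtinger_bar 1 \<psi> z) = - (LINT z|lborel. b2 z * \<psi> z)"
    and int: "integrable lborel (\<lambda>w. a1 (hartogs_param w))" "integrable lborel (\<lambda>w. a2 (hartogs_param w))"
      "integrable lborel (\<lambda>w. cnj (snd w) * b1 (hartogs_param w))"
      "integrable lborel (\<lambda>w. cnj (snd w) * b2 (hartogs_param w))"
    and \<Psi>: "\<Psi> \<in> test_functions punctured_bidisc"
  shows "(LINT w|lborel. cnj (snd w) * a1 (hartogs_param w) * wirtinger_bar 2 \<Psi> w)
      = - (LINT w|lborel. (a1 (hartogs_param w) + cnj (fst w) * (cnj (snd w) * b1 (hartogs_param w))
            + cnj (snd w) * b2 (hartogs_param w)) * \<Psi> w)" (is ?A)
    and "(LINT w|lborel. (cnj (fst w) * a1 (hartogs_param w) + a2 (hartogs_param w)) * wirtinger_bar 1 \<Psi> w)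
      = - (LINT w|lborel. (a1 (hartogs_param w) + cnj (fst w) * (cnj (snd w) * b1 (hartogs_param w))
            + cnj (snd w) * b2 (hartogs_param w)) * \<Psi> w)" (is ?B)
proof -
  let ?A1 = "\<lambda>w. a1 (hartogs_param w)" and ?A2 = "\<lambda>w. a2 (hartogs_param w)"
  let ?B1 = "\<lambda>w. cnj (snd w) * b1 (hartogs_param w)" and ?B2 = "\<lambda>w. cnj (snd w) * b2 (hartogs_param w)"
  \<comment> \<open>Testing with this product rewrites
    \<open>cnj (fst w) * wirtinger_bar 1 \<Psi> w\<close> as a barred derivative minus \<Psi>, the
    product rule on the side of the test function.\<close>
  define \<Psi>1 where "\<Psi>1 = (\<lambda>w. cnj (fst w) * \<Psi> w)"
  have \<Psi>1: "\<Psi>1 \<in> test_functions punctured_bidisc"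
    unfolding \<Psi>1_def by (rule test_functions_mult[OF \<Psi> C_k_cnj_coordinates(1)])
  have diff: "\<Psi> differentiable (at w)" for w
    using \<Psi> by (rule test_functionsE) (rule C_k_differentiable)
  have d\<Psi>1: "wirtinger_bar 1 \<Psi>1 w = cnj (fst w) * wirtinger_bar 1 \<Psi> w + \<Psi> w" for w
    unfolding \<Psi>1_def
    by (subst wirtinger_bar_mult[OF C_k_differentiable[OF C_k_cnj_coordinates(1)] diff])
      (simp add: wirtinger_bar_coordinates[simplified])
  note test = test_functions_hartogs_pullback(1)[of _ 1 0]
  note wd = wirtinger_bar_test_function[OF \<Psi>]
  have e11: "(LINT w|lborel. ?A1 w * wirtinger_bar 1 \<Psi> w) = - (LINT w|lborel. ?B1 w * \<Psi> w)"
    if "\<Psi> \<in> test_functions punctured_bidisc" for \<Psi>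
    using weak11[OF test[OF that]] integral_hartogs_pullback_wirtinger1[OF meas(1) off(1) that]
      integral_hartogs_pullback[OF meas(3) off(3) that] by simp
  have e21: "(LINT w|lborel. ?A2 w * wirtinger_bar 1 \<Psi> w) = - (LINT w|lborel. ?B2 w * \<Psi> w)"
    using weak21[OF test[OF \<Psi>]] integral_hartogs_pullback_wirtinger1[OF meas(2) off(2) \<Psi>]
      integral_hartogs_pullback[OF meas(4) off(4) \<Psi>] by simp
  have e12: "(LINT w|lborel. ?A1 w * (cnj (snd w) * wirtinger_bar 2 \<Psi> w - cnj (fst w) * wirtinger_bar 1 \<Psi> w))
      = - (LINT w|lborel. ?B2 w * \<Psi> w)"
    using weak12[OF test[OF \<Psi>]] integral_hartogs_pullback_wirtinger2[OF meas(1) off(1) \<Psi>]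
      integral_hartogs_pullback[OF meas(4) off(4) \<Psi>] by simp
  have i1: "integrable lborel (\<lambda>w. ?A1 w * \<Psi> w)" "integrable lborel (\<lambda>w. ?B1 w * \<Psi>1 w)"
    "integrable lborel (\<lambda>w. ?B2 w * \<Psi> w)" "integrable lborel (\<lambda>w. ?A1 w * wirtinger_bar 1 \<Psi>1 w)"
    "integrable lborel (\<lambda>w. ?A2 w * wirtinger_bar 1 \<Psi> w)"
    by (intro integrable_mult_test_function[OF int(1) \<Psi>] integrable_mult_test_function[OF int(3) \<Psi>1]
        integrable_mult_test_function[OF int(4) \<Psi>] integrable_mult_test_function[OF int(2) wd]
        integrable_mult_test_function[OF int(1) wirtinger_bar_test_function[OF \<Psi>1]])+
  have i2: "integrable lborel (\<lambda>w. ?A1 w * (cnj (snd w) * wirtinger_bar 2 \<Psi> w - cnj (fst w) * wirtinger_bar 1 \<Psi> w))"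
  proof -
    have "integrable lborel (\<lambda>w. ?A1 w * (cnj (snd w) * wirtinger_bar 2 \<Psi> w))"
      "integrable lborel (\<lambda>w. ?A1 w * (cnj (fst w) * wirtinger_bar 1 \<Psi> w))"
      by (intro integrable_mult_test_function[OF int(1) test_functions_mult[OF wd]] C_k_cnj_coordinates)+
    then show ?thesis unfolding right_diff_distrib by (rule Bochner_Integration.integrable_diff)
  qed
  have "(LINT w|lborel. (?A1 w + cnj (fst w) * ?B1 w + ?B2 w) * \<Psi> w)
      = (LINT w|lborel. ?A1 w * \<Psi> w + ?B1 w * \<Psi>1 w + ?B2 w * \<Psi> w)"
    by (intro Bochner_Integration.integral_cong) (simp_all add: \<Psi>1_def algebra_simps)
  also have "\<dots> = (LINT w|lborel. ?A1 w * \<Psi> w) + (LINT w|lborel. ?B1 w * \<Psi>1 w) + (LINT w|lborel. ?B2 w * \<Psi> w)"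
    using i1 by (simp only: Bochner_Integration.integral_add Bochner_Integration.integrable_add)
  finally have G: "(LINT w|lborel. (?A1 w + cnj (fst w) * ?B1 w + ?B2 w) * \<Psi> w) =
      (LINT w|lborel. ?A1 w * \<Psi> w) + (LINT w|lborel. ?B1 w * \<Psi>1 w) + (LINT w|lborel. ?B2 w * \<Psi> w)" .
  have "(LINT w|lborel. cnj (snd w) * ?A1 w * wirtinger_bar 2 \<Psi> w) =
      (LINT w|lborel. ?A1 w * (cnj (snd w) * wirtinger_bar 2 \<Psi> w - cnj (fst w) * wirtinger_bar 1 \<Psi> w)
        + ?A1 w * wirtinger_bar 1 \<Psi>1 w - ?A1 w * \<Psi> w)"
    by (intro Bochner_Integration.integral_cong) (simp_all add: d\<Psi>1[simplified] algebra_simps)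
  also have "\<dots> = (LINT w|lborel. ?A1 w * (cnj (snd w) * wirtinger_bar 2 \<Psi> w - cnj (fst w) * wirtinger_bar 1 \<Psi> w))
      + (LINT w|lborel. ?A1 w * wirtinger_bar 1 \<Psi>1 w) - (LINT w|lborel. ?A1 w * \<Psi> w)"
    using i1 i2 by (simp only: Bochner_Integration.integral_add Bochner_Integration.integrable_add Bochner_Integration.integral_diff)
  also have "\<dots> = - (LINT w|lborel. (?A1 w + cnj (fst w) * ?B1 w + ?B2 w) * \<Psi> w)"
    unfolding G e11[OF \<Psi>1] e12 by simp
  finally show ?A .
  have "(LINT w|lborel. (cnj (fst w) * ?A1 w + ?A2 w) * wirtinger_bar 1 \<Psi> w) =
      (LINT w|lborel. ?A1 w * wirtinger_bar 1 \<Psi>1 w - ?A1 w * \<Psi> w + ?A2 w * wirtinger_bar 1 \<Psi> w)"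
    by (intro Bochner_Integration.integral_cong) (simp_all add: d\<Psi>1[simplified] algebra_simps)
  also have "\<dots> = (LINT w|lborel. ?A1 w * wirtinger_bar 1 \<Psi>1 w) - (LINT w|lborel. ?A1 w * \<Psi> w)
      + (LINT w|lborel. ?A2 w * wirtinger_bar 1 \<Psi> w)"
    using i1 by (simp only: Bochner_Integration.integral_add Bochner_Integration.integrable_diff Bochner_Integration.integral_diff)
  also have "\<dots> = - (LINT w|lborel. (?A1 w + cnj (fst w) * ?B1 w + ?B2 w) * \<Psi> w)"
    unfolding G e11[OF \<Psi>1] e21 by simp
  finally show ?B .
qed

text \<open>The converse transport. The Jacobian times a barred derivative of \<psi> is a
  combination of barred derivatives of test functions in the w coordinates, to which the weak
  equations for \<open>u\<close> apply.\<close>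

lemma pulled_back_weak_solution:
  fixes u a1 a2 \<psi> :: cfun2
  assumes meas: "a1 \<in> borel_measurable borel" "a2 \<in> borel_measurable borel"
    and off: "\<And>z. z \<notin> hartogs \<Longrightarrow> a1 z = 0" "\<And>z. z \<notin> hartogs \<Longrightarrow> a2 z = 0"
    and int: "integrable lborel (\<lambda>w. a1 (hartogs_param w))" "integrable lborel (\<lambda>w. a2 (hartogs_param w))"
    and u: "integrable lborel u"
    and weak1: "\<And>\<Psi>. \<Psi> \<in> test_functions punctured_bidisc \<Longrightarrow> (LINT w|lborel. u w * wirtinger_bar 1 \<Psi> w)
      = - (LINT w|lborel. cnj (snd w) * a1 (hartogs_param w) * \<Psi> w)"
    and weak2: "\<And>\<Psi>. \<Psi> \<in> test_functions punctured_bidisc \<Longrightarrow> (LINT w|lborel. u w * wirtinger_bar 2 \<Psi> w)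
      = - (LINT w|lborel. (cnj (fst w) * a1 (hartogs_param w) + a2 (hartogs_param w)) * \<Psi> w)"
    and \<psi>: "\<psi> \<in> test_functions hartogs"
  shows "(LINT z|lborel. indicator hartogs z *\<^sub>R u (hartogs_map z) * wirtinger_bar 1 \<psi> z) = - (LINT z|lborel. a1 z * \<psi> z)" (is ?A)
    and "(LINT z|lborel. indicator hartogs z *\<^sub>R u (hartogs_map z) * wirtinger_bar 2 \<psi> z) = - (LINT z|lborel. a2 z * \<psi> z)" (is ?B)
proof -
  have [measurable]: "u \<in> borel_measurable borel" using u by (simp add: integrable_iff_bounded)
  define \<Psi> where "\<Psi> = (\<lambda>w. \<psi> (hartogs_param w))"
  have \<Psi>: "\<Psi> \<in> test_functions punctured_bidisc"
    unfolding \<Psi>_def by (rule test_functions_hartogs_param[OF \<psi>])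
  \<comment> \<open>The holomorphic factor \<open>snd w\<close> passes through barred derivatives.
    In \<open>wirtinger_bar 2 \<Psi>2 - wirtinger_bar 1 \<Psi>3\<close> the two extra terms \<Psi>1
    cancel, and so do the derivatives of \<psi> in the first variable; what remains is |w_2|^2 times
    its derivative in the second.\<close>
  define \<Psi>1 \<Psi>2 \<Psi>3 where "\<Psi>1 = (\<lambda>w. snd w * \<Psi> w)" and "\<Psi>2 = (\<lambda>w. cnj (snd w) * \<Psi>1 w)"
    and "\<Psi>3 = (\<lambda>w. cnj (fst w) * \<Psi>1 w)"
  have \<Psi>1: "\<Psi>1 \<in> test_functions punctured_bidisc"
    unfolding \<Psi>1_def by (rule test_functions_mult[OF \<Psi> C_k_snd])
  have \<Psi>2: "\<Psi>2 \<in> test_functions punctured_bidisc"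
    unfolding \<Psi>2_def by (rule test_functions_mult[OF \<Psi>1 C_k_cnj_coordinates(2)])
  have \<Psi>3: "\<Psi>3 \<in> test_functions punctured_bidisc"
    unfolding \<Psi>3_def by (rule test_functions_mult[OF \<Psi>1 C_k_cnj_coordinates(1)])
  have diff: "f differentiable (at w)" if "f \<in> test_functions \<Omega>" for f w \<Omega>
    using that by (rule test_functionsE) (rule C_k_differentiable)
  have d1: "wirtinger_bar j \<Psi>1 w = snd w * wirtinger_bar j \<Psi> w" if "j = 1 \<or> j = 2" for j w
    unfolding \<Psi>1_def
    by (subst wirtinger_bar_mult[OF C_k_differentiable[OF C_k_snd] diff[OF \<Psi>]])
      (use that in \<open>auto simp: wirtinger_bar_coordinates[simplified]\<close>)
  have d2: "wirtinger_bar 2 \<Psi>2 w = cnj (snd w) * wirtinger_bar 2 \<Psi>1 w + \<Psi>1 w" for w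
    unfolding \<Psi>2_def
    by (subst wirtinger_bar_mult[OF C_k_differentiable[OF C_k_cnj_coordinates(2)] diff[OF \<Psi>1]])
      (simp add: wirtinger_bar_coordinates[simplified])
  have d3: "wirtinger_bar 1 \<Psi>3 w = cnj (fst w) * wirtinger_bar 1 \<Psi>1 w + \<Psi>1 w" for w
    unfolding \<Psi>3_def
    by (subst wirtinger_bar_mult[OF C_k_differentiable[OF C_k_cnj_coordinates(1)] diff[OF \<Psi>1]])
      (simp add: wirtinger_bar_coordinates[simplified])
  note d\<Psi> = wirtinger_bar_hartogs_param[OF diff[OF \<psi>], folded \<Psi>_def]
  have zero: "wirtinger_bar j \<Phi> w = 0" "\<Phi> w = 0"
    if \<Phi>: "\<Phi> \<in> test_functions punctured_bidisc" and w\<Omega>: "w \<notin> punctured_bidisc" for j \<Phi> w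
  proof -
    obtain K where K: "\<And>k. C_k k \<Phi>" "compact K" "K \<subseteq> punctured_bidisc" "\<And>z. z \<notin> K \<Longrightarrow> \<Phi> z = 0"
      using test_functionsE[OF \<Phi>] by blast
    have w: "w \<notin> K" using K(3) w\<Omega> by blast
    show "\<Phi> w = 0" by (rule K(4)[OF w])
    show "wirtinger_bar j \<Phi> w = 0"
      by (rule wirtinger_zero_outside(1)[OF compact_imp_closed[OF K(2)] _ w]) (rule K(4))
  qed
  have map: "hartogs_map (hartogs_param w) = w" if "w \<in> punctured_bidisc" for w
    using that by (intro hartogs_map_param) auto
  let ?V = "\<lambda>z. indicator hartogs z *\<^sub>R u (hartogs_map z)"
  have V: "(LINT z|lborel. ?V z * \<phi> z) = (LINT w|lborel. u w * h w)"
    if "\<phi> \<in> borel_measurable borel"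
      and "\<And>w. w \<in> punctured_bidisc \<Longrightarrow> snd w * cnj (snd w) * \<phi> (hartogs_param w) = h w"
      and "\<And>w. w \<notin> punctured_bidisc \<Longrightarrow> h w = 0" for \<phi> h
  proof -
    have "(LINT z|lborel. ?V z * \<phi> z) = (LINT w|lborel. hartogs_jacobian w *\<^sub>R (?V (hartogs_param w) * \<phi> (hartogs_param w)))"
      using that(1) by (intro integral_hartogs_param) auto
    also have "\<dots> = (LINT w|lborel. u w * h w)"
    proof (rule Bochner_Integration.integral_cong[OF refl])
      fix w
      show "hartogs_jacobian w *\<^sub>R (?V (hartogs_param w) * \<phi> (hartogs_param w)) = u w * h w"
      proof (cases "w \<in> punctured_bidisc")
        case True
        then have "?V (hartogs_param w) = u w" using map hartogs_param_mem[of w] by simp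
        then show ?thesis
          using that(2)[OF True, symmetric] hartogs_jacobian_eq[OF True] by (simp add: scaleR_conv_of_real)
      next
        case False
        then show ?thesis using that(3)[OF False] hartogs_jacobian_simps(3)[of w] by simp
      qed
    qed
    finally show ?thesis .
  qed
  have rhs: "(LINT z|lborel. a z * \<psi> z) = (LINT w|lborel. cnj (snd w) * a (hartogs_param w) * \<Psi>1 w)"
    if "a \<in> borel_measurable borel" "\<And>z. z \<notin> hartogs \<Longrightarrow> a z = 0" for a
  proof (subst integral_hartogs_param[OF that(1) borel_measurable_test_function[OF \<psi>]], rule that(2), assumption,
      rule Bochner_Integration.integral_cong[OF refl])
    fix w
    show "hartogs_jacobian w *\<^sub>R (a (hartogs_param w) * \<psi> (hartogs_param w)) = cnj (snd w) * a (hartogs_param w) * \<Psi>1 w"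
    proof (cases "w \<in> punctured_bidisc")
      case True
      then show ?thesis
        using hartogs_jacobian_eq[OF True] by (simp add: scaleR_conv_of_real \<Psi>1_def \<Psi>_def mult_ac)
    next
      case False
      then show ?thesis using zero(2)[OF \<Psi>1 False] hartogs_jacobian_simps(3)[of w] by simp
    qed
  qed
  have rhs1: "(LINT z|lborel. a1 z * \<psi> z) = (LINT w|lborel. cnj (snd w) * a1 (hartogs_param w) * \<Psi>1 w)"
    by (rule rhs[OF meas(1)]) (rule off(1))
  have rhs2: "(LINT z|lborel. a2 z * \<psi> z) = (LINT w|lborel. cnj (snd w) * a2 (hartogs_param w) * \<Psi>1 w)"
    by (rule rhs[OF meas(2)]) (rule off(2))
  note wd = borel_measurable_test_function[OF wirtinger_bar_test_function[OF \<psi>]]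
  have "(LINT z|lborel. ?V z * wirtinger_bar 1 \<psi> z) = (LINT w|lborel. u w * wirtinger_bar 1 \<Psi>1 w)"
  proof (rule V[OF wd])
    show "snd w * cnj (snd w) * wirtinger_bar 1 \<psi> (hartogs_param w) = wirtinger_bar 1 \<Psi>1 w" for w
      using d1[of 1 w] d\<Psi>(1)[of w] by simp
  qed (rule zero(1)[OF \<Psi>1])
  also have "\<dots> = - (LINT z|lborel. a1 z * \<psi> z)"
    unfolding rhs1 by (rule weak1[OF \<Psi>1])
  finally show ?A .
  have "(LINT z|lborel. ?V z * wirtinger_bar 2 \<psi> z)
      = (LINT w|lborel. u w * (wirtinger_bar 2 \<Psi>2 w - wirtinger_bar 1 \<Psi>3 w))"
  proof (rule V[OF wd])
    show "snd w * cnj (snd w) * wirtinger_bar 2 \<psi> (hartogs_param w) = wirtinger_bar 2 \<Psi>2 w - wirtinger_bar 1 \<Psi>3 w" for w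
      using d1[of 1 w] d1[of 2 w] d2[of w] d3[of w] d\<Psi>[of w] by (simp add: algebra_simps)
  qed (use zero(1)[OF \<Psi>2] zero(1)[OF \<Psi>3] in simp)
  also have "\<dots> = (LINT w|lborel. u w * wirtinger_bar 2 \<Psi>2 w) - (LINT w|lborel. u w * wirtinger_bar 1 \<Psi>3 w)"
    unfolding right_diff_distrib
    by (rule Bochner_Integration.integral_diff[OF
          integrable_mult_test_function[OF u wirtinger_bar_test_function[OF \<Psi>2]]
          integrable_mult_test_function[OF u wirtinger_bar_test_function[OF \<Psi>3]]])
  also have "\<dots> = - (LINT w|lborel. (cnj (fst w) * a1 (hartogs_param w) + a2 (hartogs_param w)) * \<Psi>2 w)
      + (LINT w|lborel. cnj (snd w) * a1 (hartogs_param w) * \<Psi>3 w)"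
    unfolding weak1[OF \<Psi>3] weak2[OF \<Psi>2] by simp
  also have "(LINT w|lborel. (cnj (fst w) * a1 (hartogs_param w) + a2 (hartogs_param w)) * \<Psi>2 w)
      = (LINT w|lborel. a1 (hartogs_param w) * (cnj (fst w) * \<Psi>2 w) + a2 (hartogs_param w) * \<Psi>2 w)"
    by (intro Bochner_Integration.integral_cong) (simp_all add: algebra_simps)
  also have "\<dots> = (LINT w|lborel. a1 (hartogs_param w) * (cnj (fst w) * \<Psi>2 w)) + (LINT w|lborel. a2 (hartogs_param w) * \<Psi>2 w)"
    by (rule Bochner_Integration.integral_add[OF
          integrable_mult_test_function[OF int(1) test_functions_mult[OF \<Psi>2 C_k_cnj_coordinates(1)]]
          integrable_mult_test_function[OF int(2) \<Psi>2]])
  \<comment> \<open>The products \<open>cnj (fst w) * \<Psi>2 w\<close> and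
    \<open>cnj (snd w) * \<Psi>3 w\<close> coincide, so the contributions of \<open>a1\<close> from
    the two equations cancel and only \<open>a2\<close> is left.\<close>
  also have "(LINT w|lborel. a1 (hartogs_param w) * (cnj (fst w) * \<Psi>2 w)) = (LINT w|lborel. cnj (snd w) * a1 (hartogs_param w) * \<Psi>3 w)"
    by (intro Bochner_Integration.integral_cong) (simp_all add: \<Psi>2_def \<Psi>3_def)
  also have "(LINT w|lborel. a2 (hartogs_param w) * \<Psi>2 w) = (LINT z|lborel. a2 z * \<psi> z)"
    unfolding rhs2 by (intro Bochner_Integration.integral_cong) (simp_all add: \<Psi>2_def)
  finally show ?B by simp
qed

section \<open>The estimate\<close>

lemma borel_measurable_fst_snd [measurable]:
  "(fst :: complex \<times> complex \<Rightarrow> complex) \<in> borel_measurable borel"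
  "(snd :: complex \<times> complex \<Rightarrow> complex) \<in> borel_measurable borel"
  by (intro borel_measurable_continuous_onI continuous_intros)+

text \<open>A Borel representative that is zero off the Hartogs triangle can be integrated over the
  whole space, and its norm becomes a nonnegative integral open to Tonelli and substitution.\<close>

lemma weighted_Lp_representative:
  assumes p: "1 \<le> p" and \<alpha>: "\<alpha> \<in> weighted_Lp p s"
  obtains a where "a \<in> borel_measurable borel" "\<And>z. z \<notin> hartogs \<Longrightarrow> a z = 0"
    "AE z in lborel. z \<in> hartogs \<longrightarrow> \<alpha> z = a z"
    "(\<integral>\<^sup>+z. ennreal (cmod (a z) powr p * cmod (snd z) powr s) \<partial>lborel) = ennreal (weighted_Lp_norm p s \<alpha> powr p)"
proof -
  have "(\<lambda>z. indicator hartogs z *\<^sub>R \<alpha> z) \<in> borel_measurable lebesgue"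
    using \<alpha> by (simp add: weighted_Lp_def set_borel_measurable_def)
  then obtain a' where a' [measurable]: "a' \<in> borel_measurable borel"
    and ae: "AE z in lborel. indicator hartogs z *\<^sub>R \<alpha> z = a' z"
    by (rule lebesgue_ex_borel_measurable_complex)
  define a where "a z = indicator hartogs z *\<^sub>R a' z" for z
  have [measurable]: "a \<in> borel_measurable borel" unfolding a_def[abs_def] by measurable
  let ?k = "\<lambda>z. cmod (a z) powr p * cmod (snd z) powr s"
  have k: "?k \<in> borel_measurable borel" by measurable
  have "AE z in lborel. indicator hartogs z *\<^sub>R (cmod (\<alpha> z) powr p * cmod (snd z) powr s) = ?k z"
    using ae by eventually_elim (auto simp: a_def indicator_def)
  note eq = lebesgue_AE_eq_lborel(2,3)[OF this k]
  have int: "integrable lborel ?k"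
  proof -
    have "set_integrable lebesgue hartogs (\<lambda>z. cmod (\<alpha> z) powr p * cmod (snd z) powr s)"
      using \<alpha> by (simp add: weighted_Lp_def)
    then show ?thesis unfolding set_integrable_def eq .
  qed
  have norm: "weighted_Lp_norm p s \<alpha> = (LINT z|lborel. ?k z) powr (1 / p)"
    unfolding weighted_Lp_norm_def set_lebesgue_integral_def eq ..
  have "0 \<le> (LINT z|lborel. ?k z)" by (intro integral_nonneg_AE AE_I2) simp
  then have "weighted_Lp_norm p s \<alpha> powr p = (LINT z|lborel. ?k z)"
    unfolding norm using p by (simp add: powr_powr)
  then have "(\<integral>\<^sup>+z. ennreal (?k z) \<partial>lborel) = ennreal (weighted_Lp_norm p s \<alpha> powr p)"
    using nn_integral_eq_integral[OF int] by simp
  moreover have "AE z in lborel. z \<in> hartogs \<longrightarrow> \<alpha> z = a z"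
    using ae by eventually_elim (auto simp: a_def indicator_def)
  ultimately show thesis by (intro that[of a]) (simp_all add: a_def)
qed

section \<open>Distributions and their representatives\<close>

lemma distr_of_representative:
  fixes \<alpha> a \<psi> :: cfun2
  assumes "AE z in lborel. z \<in> \<Omega> \<longrightarrow> \<alpha> z = a z" "\<And>z. z \<notin> \<Omega> \<Longrightarrow> a z = 0"
    and [measurable]: "a \<in> borel_measurable borel" "\<psi> \<in> borel_measurable borel"
  shows "distr_of \<Omega> \<alpha> \<psi> = (LINT z|lborel. a z * \<psi> z)"
proof -
  have "AE z in lborel. indicator \<Omega> z *\<^sub>R (\<alpha> z * \<psi> z) = a z * \<psi> z"
    using assms(1) by (rule eventually_mono) (use assms(2) in \<open>auto simp: indicator_def\<close>)
  then show ?thesis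
    unfolding distr_of_def set_lebesgue_integral_def by (rule lebesgue_AE_eq_lborel(2)) measurable
qed

lemma locally_integrable_representative:
  fixes \<alpha> a :: cfun2
  assumes "AE z in lborel. z \<in> \<Omega> \<longrightarrow> \<alpha> z = a z" and a: "integrable lborel a"
  shows "locally_integrable \<Omega> \<alpha>"
  unfolding locally_integrable_def
proof (intro allI impI)
  fix K :: "(complex \<times> complex) set" assume K: "compact K \<and> K \<subseteq> \<Omega>"
  then have [measurable]: "K \<in> sets borel" by (simp add: borel_compact)
  have [measurable]: "a \<in> borel_measurable borel" using a by (simp add: integrable_iff_bounded)
  have ae: "AE z in lborel. indicator K z *\<^sub>R \<alpha> z = indicator K z *\<^sub>R a z"
    using assms(1) by (rule eventually_mono) (use K in \<open>auto simp: indicator_def\<close>)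
  have meas: "(\<lambda>z. indicator K z *\<^sub>R a z) \<in> borel_measurable borel" by measurable
  show "set_integrable lebesgue K \<alpha>"
    unfolding set_integrable_def lebesgue_AE_eq_lborel(3)[OF ae meas]
    using a by (intro integrable_mult_indicator) simp_all
qed

lemma locally_integrable_mult_test_function:
  fixes g \<psi> :: cfun2
  assumes g: "locally_integrable \<Omega> g" and \<psi>: "\<psi> \<in> test_functions \<Omega>"
  shows "set_integrable lebesgue \<Omega> (\<lambda>z. g z * \<psi> z)"
proof -
  obtain K where K: "\<And>k. C_k k \<psi>" "compact K" "K \<subseteq> \<Omega>" "\<And>z. z \<notin> K \<Longrightarrow> \<psi> z = 0"
    using test_functionsE[OF \<psi>] by blast
  obtain B where B: "\<And>z. cmod (\<psi> z) \<le> B" using test_function_bounded[OF \<psi>] by blast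
  have int: "integrable lebesgue (\<lambda>z. indicator K z *\<^sub>R g z)"
    using g K by (auto simp: locally_integrable_def set_integrable_def)
  have \<psi>_meas: "\<psi> \<in> borel_measurable lebesgue"
    using borel_measurable_test_function[OF \<psi>] by (intro measurable_completion) simp
  have "integrable lebesgue (\<lambda>z. (indicator K z *\<^sub>R g z) * \<psi> z)"
  proof (rule Bochner_Integration.integrable_bound)
    show "integrable lebesgue (\<lambda>z. cmod (indicator K z *\<^sub>R g z) * B)"
      using int by (intro integrable_mult_left integrable_norm)
    show "(\<lambda>z. (indicator K z *\<^sub>R g z) * \<psi> z) \<in> borel_measurable lebesgue"
      using borel_measurable_integrable[OF int] \<psi>_meas by (rule borel_measurable_times)
    have "cmod x * cmod (\<psi> z) \<le> \<bar>cmod x * B\<bar>" for x z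
      using mult_left_mono[OF B[of z] norm_ge_zero[of x]] by linarith
    then show "AE z in lebesgue. norm ((indicator K z *\<^sub>R g z) * \<psi> z) \<le> norm (cmod (indicator K z *\<^sub>R g z) * B)"
      by (intro AE_I2) (simp only: norm_mult real_norm_def)
  qed
  moreover have eq: "(indicator K z *\<^sub>R g z) * \<psi> z = indicator \<Omega> z *\<^sub>R (g z * \<psi> z)" for z
    using K(3) K(4)[of z] by (auto simp: indicator_def)
  ultimately show ?thesis unfolding set_integrable_def by (simp only: eq)
qed

text \<open>This makes the choice in \<open>mixed_fun\<close> immaterial: whichever function is
  chosen agrees almost everywhere with an explicit mixed derivative.\<close>

lemma is_function_unique:
  assumes "open \<Omega>" "is_function \<Omega> S g" "is_function \<Omega> S h"
  shows "AE z in lborel. z \<in> \<Omega> \<longrightarrow> g z = h z"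
proof -
  have gh: "locally_integrable \<Omega> g" "locally_integrable \<Omega> h"
    using assms by (auto simp: is_function_def)
  have "AE z in lborel. z \<in> \<Omega> \<longrightarrow> g z - h z = 0"
  proof (rule AE_zero_if_test_integrals_0[OF \<open>open \<Omega>\<close>])
    show "locally_integrable \<Omega> (\<lambda>z. g z - h z)"
      using gh by (auto simp: locally_integrable_def intro: set_integral_diff(1))
    fix \<psi> assume \<psi>: "\<psi> \<in> test_functions \<Omega>"
    have "distr_of \<Omega> (\<lambda>z. g z - h z) \<psi> = distr_of \<Omega> g \<psi> - distr_of \<Omega> h \<psi>"
      unfolding distr_of_def left_diff_distrib
      by (intro set_integral_diff(2) locally_integrable_mult_test_function gh \<psi>)
    also have "\<dots> = 0" using assms(2,3) \<psi> by (simp add: is_function_def distr_eq_def)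
    finally show "distr_of \<Omega> (\<lambda>z. g z - h z) \<psi> = 0" .
  qed
  then show ?thesis by simp
qed

text \<open>On a bounded set the elementary bound x <= 1 + x^p takes the place of Hoelder's
  inequality.\<close>

lemma integrable_if_Lp:
  fixes F :: "'a::euclidean_space \<Rightarrow> complex"
  assumes [measurable]: "F \<in> borel_measurable borel" "S \<in> sets borel" and "bounded S"
    and F0: "\<And>w. w \<notin> S \<Longrightarrow> F w = 0" and p: "1 \<le> p"
    and fin: "(\<integral>\<^sup>+w. cmod (F w) powr p \<partial>lborel) < \<infinity>"
  shows "integrable lborel F"
proof (rule integrableI_bounded)
  have "(\<integral>\<^sup>+w. ennreal (norm (F w)) \<partial>lborel) \<le> (\<integral>\<^sup>+w. indicator S w + ennreal (cmod (F w) powr p) \<partial>lborel)"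
  proof (rule nn_integral_mono)
    fix w
    have "x \<le> 1 + x powr p" if "0 \<le> x" for x :: real
      using powr_mono[of 1 p x] p that by (cases "x \<le> 1") (auto simp: add_increasing2)
    then have "ennreal (norm (F w)) \<le> ennreal (1 + cmod (F w) powr p)" by (intro ennreal_leI) auto
    also have "\<dots> = 1 + ennreal (cmod (F w) powr p)" by (simp add: ennreal_plus)
    finally show "ennreal (norm (F w)) \<le> indicator S w + ennreal (cmod (F w) powr p)"
      using F0[of w] by (cases "w \<in> S") auto
  qed
  also have "\<dots> = emeasure lborel S + (\<integral>\<^sup>+w. cmod (F w) powr p \<partial>lborel)"
    by (simp add: nn_integral_add)
  also have "\<dots> < \<infinity>" using fin emeasure_bounded_finite[OF \<open>bounded S\<close>] by simp
  finally show "(\<integral>\<^sup>+w. ennreal (norm (F w)) \<partial>lborel) < \<infinity>" .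
qed simp

lemma bounded_disc_punctured_disc: "bounded punctured_bidisc"
  by (intro bounded_Times) (auto intro: bounded_subset[OF bounded_ball])

lemma bounded_hartogs: "bounded hartogs"
proof (rule bounded_subset)
  show "bounded (ball 0 1 \<times> ball 0 1 :: (complex \<times> complex) set)" by (intro bounded_Times bounded_ball)
  show "hartogs \<subseteq> ball 0 1 \<times> ball 0 1" by (auto simp: hartogs_def)
qed

lemma nn_integral_hartogs_param:
  fixes a :: cfun2
  assumes [measurable]: "a \<in> borel_measurable borel" and a0: "\<And>z. z \<notin> hartogs \<Longrightarrow> a z = 0"
  shows "(\<integral>\<^sup>+z. ennreal (cmod (a z) powr p * cmod (snd z) powr s) \<partial>lborel) =
    (\<integral>\<^sup>+w. ennreal (hartogs_jacobian w * (cmod (a (hartogs_param w)) powr p * cmod (snd w) powr s)) \<partial>lborel)"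
proof -
  have "(\<integral>\<^sup>+z. ennreal (cmod (a z) powr p * cmod (snd z) powr s) \<partial>lborel)
      = (\<integral>\<^sup>+z. indicator hartogs z * ennreal (cmod (a z) powr p * cmod (snd z) powr s) \<partial>lborel)"
    using a0 by (intro nn_integral_cong) (auto simp: indicator_def)
  also have "\<dots> = (\<integral>\<^sup>+w. ennreal (hartogs_jacobian w) *
      ennreal (cmod (a (hartogs_param w)) powr p * cmod (snd (hartogs_param w)) powr s) \<partial>lborel)"
    by (rule nn_integral_hartogs) measurable
  finally show ?thesis by (simp add: ennreal_mult[symmetric] hartogs_jacobian_simps hartogs_param_def)
qed

text \<open>The weight exponent -2 cancels the Jacobian |w_2|^2 exactly. The exponent -1 leaves
  |w_2|, which dominates the factor |w_2|^p coming from \<open>cnj (snd w)\<close>, because p >= 1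
  and |w_2| <= 1.\<close>

lemma nn_integral_transport:
  fixes a :: cfun2
  assumes a: "a \<in> borel_measurable borel" and a0: "\<And>z. z \<notin> hartogs \<Longrightarrow> a z = 0" and p: "1 \<le> p"
  shows "(\<integral>\<^sup>+w. cmod (a (hartogs_param w)) powr p \<partial>lborel)
      \<le> (\<integral>\<^sup>+z. ennreal (cmod (a z) powr p * cmod (snd z) powr (-2)) \<partial>lborel)"
    and "(\<integral>\<^sup>+w. cmod (cnj (snd w) * a (hartogs_param w)) powr p \<partial>lborel)
      \<le> (\<integral>\<^sup>+z. ennreal (cmod (a z) powr p * cmod (snd z) powr (-1)) \<partial>lborel)"
proof -
  have off: "a (hartogs_param w) = 0" if "w \<notin> punctured_bidisc" for w
    using that hartogs_param_mem a0 by blast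
  have jac: "hartogs_jacobian w = (cmod (snd w))\<^sup>2" "0 < cmod (snd w)" "cmod (snd w) \<le> 1"
    if "w \<in> punctured_bidisc" for w
    using that by (auto simp: hartogs_jacobian_def)
  show "(\<integral>\<^sup>+w. cmod (a (hartogs_param w)) powr p \<partial>lborel)
      \<le> (\<integral>\<^sup>+z. ennreal (cmod (a z) powr p * cmod (snd z) powr (-2)) \<partial>lborel)"
  proof (subst nn_integral_hartogs_param[OF a], rule a0, assumption, intro nn_integral_mono ennreal_leI)
    fix w
    show "cmod (a (hartogs_param w)) powr p \<le> hartogs_jacobian w * (cmod (a (hartogs_param w)) powr p * cmod (snd w) powr - 2)"
      using jac[of w] off[of w] by (cases "w \<in> punctured_bidisc") (simp_all add: powr_minus divide_simps)
  qed
  show "(\<integral>\<^sup>+w. cmod (cnj (snd w) * a (hartogs_param w)) powr p \<partial>lborel)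
      \<le> (\<integral>\<^sup>+z. ennreal (cmod (a z) powr p * cmod (snd z) powr (-1)) \<partial>lborel)"
  proof (subst nn_integral_hartogs_param[OF a], rule a0, assumption, intro nn_integral_mono ennreal_leI)
    fix w
    show "cmod (cnj (snd w) * a (hartogs_param w)) powr p
        \<le> hartogs_jacobian w * (cmod (a (hartogs_param w)) powr p * cmod (snd w) powr - 1)"
    proof (cases "w \<in> punctured_bidisc")
      case True
      note j = jac[OF True]
      have "cmod (snd w) powr p \<le> cmod (snd w) powr 1"
        using powr_mono'[of 1 p "cmod (snd w)"] j p by simp
      also have "\<dots> = hartogs_jacobian w * cmod (snd w) powr - 1"
        using j by (simp add: powr_minus power2_eq_square)
      finally have "cmod (snd w) powr p * cmod (a (hartogs_param w)) powr p
          \<le> (hartogs_jacobian w * cmod (snd w) powr - 1) * cmod (a (hartogs_param w)) powr p"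
        by (rule mult_right_mono) simp
      then show ?thesis by (simp add: norm_mult powr_mult mult_ac)
    qed (simp add: off)
  qed
qed

lemma hartogs_map_inv_eq: "w \<in> punctured_bidisc \<Longrightarrow> hartogs_map_inv w = hartogs_param w"
  unfolding hartogs_map_inv_def
  using hartogs_param_mem[of w] hartogs_map_param[of w] bij_betw_hartogs_map
  by (intro the_inv_into_f_eq) (auto simp: bij_betw_def)


text \<open>The functions \<beta>1 and \<beta>2 stand for the distributional derivatives, since
  weighted norms are defined for functions. Integrals are total, with value 0 when they diverge, so
  convergence of the operator and membership in the L^p space are asserted beside the equation and
  the estimate.\<close>

theorem theorem6p3:
  fixes p :: real
  assumes "1 \<le> p"
  shows "\<exists>C>0. \<forall>\<alpha>1 \<alpha>2 \<beta>1 \<beta>2 :: complex \<times> complex \<Rightarrow> complex.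
      weakly_dbar_closed hartogs \<alpha>1 \<alpha>2 \<and>
      \<alpha>1 \<in> weighted_Lp p (-2) \<and> \<alpha>2 \<in> weighted_Lp p (-2) \<and>
      is_function hartogs (distr_dbar 1 (distr_of hartogs \<alpha>2)) \<beta>2 \<and>
      is_function hartogs (distr_dbar 2 (distr_of hartogs \<alpha>1)) \<beta>2 \<and>
      \<beta>2 \<in> weighted_Lp p (-1) \<and>
      is_function hartogs (distr_dbar 1 (distr_of hartogs \<alpha>1)) \<beta>1 \<and>
      \<beta>1 \<in> weighted_Lp p (-1)
      \<longrightarrow>
      (let f1 = transport1 \<alpha>1; f2 = transport2 \<alpha>1 \<alpha>2; v = T_op f1 f2 \<circ> hartogs_map
       in mixed_is_function f1 f2 \<and>
          (AE z in lebesgue. z \<in> hartogs \<longrightarrow> T_converges_at f1 f2 (hartogs_map z)) \<and>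
          weak_dbar_solution hartogs v \<alpha>1 \<alpha>2 \<and>
          v \<in> weighted_Lp p 0 \<and>
          weighted_Lp_norm p 0 v
            \<le> C * ((weighted_Lp_norm p (-2) \<alpha>1 + weighted_Lp_norm p (-2) \<alpha>2)
                 + (weighted_Lp_norm p (-1) \<beta>1 + weighted_Lp_norm p (-1) \<beta>2)))"
proof -
  obtain C0 where C0: "0 \<le> C0" "\<And>F1 F2 G :: cfun2. F1 \<in> borel_measurable borel \<Longrightarrow> F2 \<in> borel_measurable borel \<Longrightarrow>
    G \<in> borel_measurable borel \<Longrightarrow> (\<integral>\<^sup>+w. cmod (cauchy_solution F1 F2 G w) powr p \<partial>lborel)
    \<le> ennreal C0 * ((\<integral>\<^sup>+w. cmod (F1 w) powr p \<partial>lborel) + (\<integral>\<^sup>+w. cmod (F2 w) powr p \<partial>lborel)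
       + (\<integral>\<^sup>+w. cmod (G w) powr p \<partial>lborel))"
    using cauchy_solution_Lp[OF assms] by blast
  \<comment> \<open>There are three functions \<open>F1\<close>, \<open>F2\<close>,
    \<open>G\<close>, each with p-th power integral at most \<open>3 powr p * S\<close>, and
    \<open>S\<close> is \<open>4 * T powr p\<close> with one summand for each of the four given
    norms.\<close>
  define D where "D = C0 * (3 * 3 powr p) * 4"
  have D: "0 \<le> D" using C0(1) by (simp add: D_def)
  \<comment> \<open>The p-th root undoes the p-th powers; adding 1 makes the constant strictly
    positive in any case.\<close>
  define C where "C = D powr (1 / p) + 1"
  have C: "0 < C" by (simp add: C_def add_nonneg_pos)
  show ?thesis
  proof (intro exI[of _ C] conjI C allI impI; elim conjE)
    fix \<alpha>1 \<alpha>2 \<beta>1 \<beta>2 :: cfun2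
    assume \<alpha>: "\<alpha>1 \<in> weighted_Lp p (-2)" "\<alpha>2 \<in> weighted_Lp p (-2)"
      and \<beta>: "\<beta>1 \<in> weighted_Lp p (-1)" "\<beta>2 \<in> weighted_Lp p (-1)"
      and w21: "is_function hartogs (distr_dbar 1 (distr_of hartogs \<alpha>2)) \<beta>2"
      and w12: "is_function hartogs (distr_dbar 2 (distr_of hartogs \<alpha>1)) \<beta>2"
      and w11: "is_function hartogs (distr_dbar 1 (distr_of hartogs \<alpha>1)) \<beta>1"
    let ?n1 = "weighted_Lp_norm p (-2) \<alpha>1" and ?n2 = "weighted_Lp_norm p (-2) \<alpha>2"
    let ?m1 = "weighted_Lp_norm p (-1) \<beta>1" and ?m2 = "weighted_Lp_norm p (-1) \<beta>2"
    let ?\<Omega> = "punctured_bidisc"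
    obtain a1 where a1 [measurable]: "a1 \<in> borel_measurable borel" and a1_off: "\<And>z. z \<notin> hartogs \<Longrightarrow> a1 z = 0"
      and a1_ae: "AE z in lborel. z \<in> hartogs \<longrightarrow> \<alpha>1 z = a1 z"
      and a1_norm: "(\<integral>\<^sup>+z. ennreal (cmod (a1 z) powr p * cmod (snd z) powr (-2)) \<partial>lborel) = ennreal (?n1 powr p)"
      using weighted_Lp_representative[OF assms \<alpha>(1)] by blast
    obtain a2 where a2 [measurable]: "a2 \<in> borel_measurable borel" and a2_off: "\<And>z. z \<notin> hartogs \<Longrightarrow> a2 z = 0"
      and a2_ae: "AE z in lborel. z \<in> hartogs \<longrightarrow> \<alpha>2 z = a2 z"
      and a2_norm: "(\<integral>\<^sup>+z. ennreal (cmod (a2 z) powr p * cmod (snd z) powr (-2)) \<partial>lborel) = ennreal (?n2 powr p)"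
      using weighted_Lp_representative[OF assms \<alpha>(2)] by blast
    obtain b1 where b1 [measurable]: "b1 \<in> borel_measurable borel" and b1_off: "\<And>z. z \<notin> hartogs \<Longrightarrow> b1 z = 0"
      and b1_ae: "AE z in lborel. z \<in> hartogs \<longrightarrow> \<beta>1 z = b1 z"
      and b1_norm: "(\<integral>\<^sup>+z. ennreal (cmod (b1 z) powr p * cmod (snd z) powr (-1)) \<partial>lborel) = ennreal (?m1 powr p)"
      using weighted_Lp_representative[OF assms \<beta>(1)] by blast
    obtain b2 where b2 [measurable]: "b2 \<in> borel_measurable borel" and b2_off: "\<And>z. z \<notin> hartogs \<Longrightarrow> b2 z = 0"
      and b2_ae: "AE z in lborel. z \<in> hartogs \<longrightarrow> \<beta>2 z = b2 z"
      and b2_norm: "(\<integral>\<^sup>+z. ennreal (cmod (b2 z) powr p * cmod (snd z) powr (-1)) \<partial>lborel) = ennreal (?m2 powr p)"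
      using weighted_Lp_representative[OF assms \<beta>(2)] by blast
    \<comment> \<open>The derivatives are stored with the factor \<open>cnj (snd w)\<close> that
      they carry in the mixed derivative, since the weaker weight bounds them in L^p with this
      factor.\<close>
    define A1 A2 B1 B2 where "A1 w = a1 (hartogs_param w)" and "A2 w = a2 (hartogs_param w)"
      and "B1 w = cnj (snd w) * b1 (hartogs_param w)" and "B2 w = cnj (snd w) * b2 (hartogs_param w)" for w
    have AB_meas: "A1 \<in> borel_measurable borel" "A2 \<in> borel_measurable borel"
      "B1 \<in> borel_measurable borel" "B2 \<in> borel_measurable borel"
      unfolding A1_def[abs_def] A2_def[abs_def] B1_def[abs_def] B2_def[abs_def] by measurable
    note [measurable] = AB_meas
    \<comment> \<open>\<open>G\<close> is the common value of the two mixed derivatives computed in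
      \<open>transported_weak_equations\<close>.\<close>
    define F1 F2 G where "F1 w = cnj (snd w) * A1 w" and "F2 w = cnj (fst w) * A1 w + A2 w"
      and "G w = A1 w + cnj (fst w) * B1 w + B2 w" for w
    have F_meas: "F1 \<in> borel_measurable borel" "F2 \<in> borel_measurable borel" "G \<in> borel_measurable borel"
      unfolding F1_def[abs_def] F2_def[abs_def] G_def[abs_def] by measurable
    have off: "A1 w = 0" "A2 w = 0" "B1 w = 0" "B2 w = 0" if "w \<notin> ?\<Omega>" for w
    proof -
      have "hartogs_param w \<notin> hartogs" using that hartogs_param_mem by blast
      then show "A1 w = 0" "A2 w = 0" "B1 w = 0" "B2 w = 0"
        by (simp_all add: A1_def A2_def B1_def B2_def a1_off a2_off b1_off b2_off)
    qed
    have F_off: "F1 w = 0" "F2 w = 0" "G w = 0" if "w \<notin> ?\<Omega>" for w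
      using off[OF that] by (simp_all add: F1_def F2_def G_def)
    let ?I = "\<lambda>F :: cfun2. \<integral>\<^sup>+w. ennreal (cmod (F w) powr p) \<partial>lborel"
    have norm_A1: "?I A1 \<le> ennreal (?n1 powr p)"
      unfolding A1_def a1_norm[symmetric] by (rule nn_integral_transport(1)[OF a1 _ assms]) (rule a1_off)
    have norm_A2: "?I A2 \<le> ennreal (?n2 powr p)"
      unfolding A2_def a2_norm[symmetric] by (rule nn_integral_transport(1)[OF a2 _ assms]) (rule a2_off)
    have norm_B1: "?I B1 \<le> ennreal (?m1 powr p)"
      unfolding B1_def b1_norm[symmetric] by (rule nn_integral_transport(2)[OF b1 _ assms]) (rule b1_off)
    have norm_B2: "?I B2 \<le> ennreal (?m2 powr p)"
      unfolding B2_def b2_norm[symmetric] by (rule nn_integral_transport(2)[OF b2 _ assms]) (rule b2_off)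
    define T where "T = ?n1 + ?n2 + (?m1 + ?m2)"
    have nonneg: "0 \<le> ?n1" "0 \<le> ?n2" "0 \<le> ?m1" "0 \<le> ?m2" by (simp_all add: weighted_Lp_norm_def)
    then have T: "0 \<le> T" "?n1 \<le> T" "?n2 \<le> T" "?m1 \<le> T" "?m2 \<le> T" by (simp_all add: T_def)
    define S where "S = ennreal (4 * T powr p)"
    have S: "?I A1 + ?I A2 + ?I B1 + ?I B2 \<le> S"
    proof -
      have mono: "ennreal (x powr p) \<le> ennreal (T powr p)" if "0 \<le> x" "x \<le> T" for x
        using that assms by (intro ennreal_leI powr_mono2) auto
      have "?I A1 + ?I A2 + ?I B1 + ?I B2
          \<le> ennreal (T powr p) + ennreal (T powr p) + ennreal (T powr p) + ennreal (T powr p)"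
        by (intro add_mono order_trans[OF norm_A1 mono] order_trans[OF norm_A2 mono]
            order_trans[OF norm_B1 mono] order_trans[OF norm_B2 mono] nonneg T)
      also have "\<dots> = S" unfolding S_def by (simp add: ennreal_plus[symmetric] del: ennreal_plus)
      finally show ?thesis .
    qed
    have I_le: "?I A1 \<le> S" "?I A2 \<le> S" "?I B1 \<le> S" "?I B2 \<le> S"
      "?I A1 + ?I A2 \<le> S" "?I A1 + ?I B1 + ?I B2 \<le> S"
      by (rule order_trans[OF _ S], simp add: add_increasing add_increasing2 add_mono add.assoc add_left_mono)+
    have S_fin: "S < \<infinity>" by (simp add: S_def)
    have fst_snd_le: "cmod (fst w) \<le> 1" "cmod (snd w) \<le> 1" if "w \<in> ?\<Omega>" for w using that by auto
    have IF: "?I F1 \<le> ennreal (3 powr p) * S" "?I F2 \<le> ennreal (3 powr p) * S" "?I G \<le> ennreal (3 powr p) * S"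
    proof -
      have bound: "cmod (F1 w) \<le> cmod (A1 w)" "cmod (F2 w) \<le> cmod (A1 w) + cmod (A2 w)"
        "cmod (G w) \<le> cmod (A1 w) + cmod (B1 w) + cmod (B2 w)" for w
      proof -
        have le: "cmod (x * y) \<le> cmod y" if "cmod x \<le> 1" for x y
          using that by (simp add: norm_mult mult_left_le_one_le)
        have fs: "cmod (cnj (fst w) * X w) \<le> cmod (X w)" "cmod (cnj (snd w) * X w) \<le> cmod (X w)"
          if "\<And>w. w \<notin> ?\<Omega> \<Longrightarrow> X w = 0" for X :: cfun2
          using that[of w] fst_snd_le[of w] by (cases "w \<in> ?\<Omega>"; force intro: le)+
        show "cmod (F1 w) \<le> cmod (A1 w)" unfolding F1_def by (rule fs(2)) (rule off(1))
        have "cmod (F2 w) \<le> cmod (cnj (fst w) * A1 w) + cmod (A2 w)" unfolding F2_def by (rule norm_triangle_ineq)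
        then show "cmod (F2 w) \<le> cmod (A1 w) + cmod (A2 w)"
          using fs(1)[of A1] off(1) by fastforce
        have "cmod (G w) \<le> cmod (A1 w) + cmod (cnj (fst w) * B1 w) + cmod (B2 w)"
          unfolding G_def by (intro norm_triangle_le add_mono) auto
        then show "cmod (G w) \<le> cmod (A1 w) + cmod (B1 w) + cmod (B2 w)"
          using fs(1)[of B1] off(3) by fastforce
      qed
      \<comment> \<open>The three-term inequality also serves for \<open>F1\<close> and
        \<open>F2\<close>, with zero functions in the vacant places.\<close>
      have z: "?I (\<lambda>w. 0) = 0" using assms by simp
      have "?I F1 \<le> ennreal (3 powr p) * (?I A1 + ?I (\<lambda>w. 0) + ?I (\<lambda>w. 0))"
        using bound(1) assms by (intro nn_integral_powr_add3_le) auto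
      also have "\<dots> \<le> ennreal (3 powr p) * S" unfolding z using I_le by (intro mult_left_mono) auto
      finally show "?I F1 \<le> ennreal (3 powr p) * S" .
      have "?I F2 \<le> ennreal (3 powr p) * (?I A1 + ?I A2 + ?I (\<lambda>w. 0))"
        using bound(2) assms by (intro nn_integral_powr_add3_le) auto
      also have "\<dots> \<le> ennreal (3 powr p) * S" unfolding z using I_le by (intro mult_left_mono) auto
      finally show "?I F2 \<le> ennreal (3 powr p) * S" .
      have "?I G \<le> ennreal (3 powr p) * (?I A1 + ?I B1 + ?I B2)"
        using bound(3) assms by (intro nn_integral_powr_add3_le) auto
      also have "\<dots> \<le> ennreal (3 powr p) * S" using I_le by (intro mult_left_mono) auto
      finally show "?I G \<le> ennreal (3 powr p) * S" .
    qed
    have int: "integrable lborel F" if "F \<in> borel_measurable borel" "\<And>w. w \<notin> ?\<Omega> \<Longrightarrow> F w = 0" "?I F < \<infinity>" for F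
      by (rule integrable_if_Lp[OF that(1) borel_measurable_disc_punctured_disc bounded_disc_punctured_disc _ assms that(3)])
        (rule that(2))
    have int_AB: "integrable lborel A1" "integrable lborel A2" "integrable lborel B1" "integrable lborel B2"
      using int[OF AB_meas(1) off(1) le_less_trans[OF I_le(1) S_fin]]
        int[OF AB_meas(2) off(2) le_less_trans[OF I_le(2) S_fin]]
        int[OF AB_meas(3) off(3) le_less_trans[OF I_le(3) S_fin]]
        int[OF AB_meas(4) off(4) le_less_trans[OF I_le(4) S_fin]] by blast+
    have fin: "ennreal (3 powr p) * S < \<infinity>" using S_fin by (simp add: ennreal_mult_less_top)
    have int_F: "integrable lborel F1" "integrable lborel F2" "integrable lborel G"
      using int[OF F_meas(1) F_off(1) le_less_trans[OF IF(1) fin]]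
        int[OF F_meas(2) F_off(2) le_less_trans[OF IF(2) fin]]
        int[OF F_meas(3) F_off(3) le_less_trans[OF IF(3) fin]] by blast+
    have repr: "distr_of hartogs \<alpha> \<psi> = (LINT z|lborel. a z * \<psi> z)"
      if "AE z in lborel. z \<in> hartogs \<longrightarrow> \<alpha> z = a z" "a \<in> borel_measurable borel"
        "\<psi> \<in> test_functions hartogs" "\<And>z. z \<notin> hartogs \<Longrightarrow> a z = 0" for \<alpha> a \<psi>
      by (rule distr_of_representative[OF that(1) _ that(2) borel_measurable_test_function[OF that(3)]]) (rule that(4))
    have weak: "(LINT z|lborel. a z * wirtinger_bar j \<psi> z) = - (LINT z|lborel. b z * \<psi> z)"
      if "is_function hartogs (distr_dbar j (distr_of hartogs \<alpha>)) \<beta>" "\<psi> \<in> test_functions hartogs"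
        "distr_of hartogs \<alpha> (wirtinger_bar j \<psi>) = (LINT z|lborel. a z * wirtinger_bar j \<psi> z)"
        "distr_of hartogs \<beta> \<psi> = (LINT z|lborel. b z * \<psi> z)" for j \<psi> \<alpha> \<beta> a b
      using that by (simp add: is_function_def distr_eq_def distr_dbar_def minus_equation_iff eq_commute)
    note wd = wirtinger_bar_test_function
    have weak11: "(LINT z|lborel. a1 z * wirtinger_bar 1 \<psi> z) = - (LINT z|lborel. b1 z * \<psi> z)"
      and weak12: "(LINT z|lborel. a1 z * wirtinger_bar 2 \<psi> z) = - (LINT z|lborel. b2 z * \<psi> z)"
      and weak21: "(LINT z|lborel. a2 z * wirtinger_bar 1 \<psi> z) = - (LINT z|lborel. b2 z * \<psi> z)"
      if "\<psi> \<in> test_functions hartogs" for \<psi>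
      using weak[OF w11 that repr[OF a1_ae a1 wd[OF that]] repr[OF b1_ae b1 that]]
        weak[OF w12 that repr[OF a1_ae a1 wd[OF that]] repr[OF b2_ae b2 that]]
        weak[OF w21 that repr[OF a2_ae a2 wd[OF that]] repr[OF b2_ae b2 that]]
        a1_off a2_off b1_off b2_off by blast+
    note transported = transported_weak_equations[of a1 a2 b1 b2, folded A1_def A2_def B1_def B2_def, folded F1_def F2_def G_def,
        OF a1 a2 b1 b2]
    have weakF1: "(LINT w|lborel. F1 w * wirtinger_bar 2 \<psi> w) = - (LINT w|lborel. G w * \<psi> w)"
      and weakF2: "(LINT w|lborel. F2 w * wirtinger_bar 1 \<psi> w) = - (LINT w|lborel. G w * \<psi> w)"
      if "\<psi> \<in> test_functions ?\<Omega>" for \<psi>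
      by (rule transported; fact a1_off a2_off b1_off b2_off weak11 weak12 weak21 int_AB that)+
    let ?f1 = "transport1 \<alpha>1" and ?f2 = "transport2 \<alpha>1 \<alpha>2"
    have f1: "AE w in lborel. w \<in> ?\<Omega> \<longrightarrow> ?f1 w = F1 w"
      using AE_hartogs_param[OF a1_ae]
      by eventually_elim (simp add: transport1_def F1_def A1_def hartogs_map_inv_eq)
    have f2: "AE w in lborel. w \<in> ?\<Omega> \<longrightarrow> ?f2 w = F2 w"
      using AE_hartogs_param[OF a1_ae] AE_hartogs_param[OF a2_ae]
      by eventually_elim (simp add: transport2_def F2_def A1_def A2_def hartogs_map_inv_eq)
    have repr\<Omega>: "distr_of ?\<Omega> f \<psi> = (LINT z|lborel. F z * \<psi> z)"
      if "AE w in lborel. w \<in> ?\<Omega> \<longrightarrow> f w = F w" "F \<in> borel_measurable borel" "\<psi> \<in> test_functions ?\<Omega>"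
        "\<And>w. w \<notin> ?\<Omega> \<Longrightarrow> F w = 0" for f F \<psi>
      by (rule distr_of_representative[OF that(1) _ that(2) borel_measurable_test_function[OF that(3)]]) (rule that(4))
    have mixed: "is_function ?\<Omega> (mixed_distr ?f1 ?f2) G"
      unfolding is_function_def distr_eq_def
    proof (intro conjI ballI)
      show "locally_integrable ?\<Omega> G"
        by (rule locally_integrable_representative[of _ G G]) (use int_F in auto)
      fix \<psi> assume \<psi>: "\<psi> \<in> test_functions ?\<Omega>"
      have "distr_of ?\<Omega> ?f1 (wirtinger_bar 2 \<psi>) = - (LINT w|lborel. G w * \<psi> w)"
        using repr\<Omega>[OF f1 F_meas(1) wd[OF \<psi>] F_off(1)] weakF1[OF \<psi>] by simp
      moreover have "distr_of ?\<Omega> ?f2 (wirtinger_bar 1 \<psi>) = - (LINT w|lborel. G w * \<psi> w)"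
        using repr\<Omega>[OF f2 F_meas(2) wd[OF \<psi>] F_off(2)] weakF2[OF \<psi>] by simp
      moreover have "distr_of ?\<Omega> G \<psi> = (LINT w|lborel. G w * \<psi> w)"
        by (rule repr\<Omega>[OF _ F_meas(3) \<psi> F_off(3)]) auto
      ultimately show "mixed_distr ?f1 ?f2 \<psi> = distr_of ?\<Omega> G \<psi>"
        by (simp add: mixed_distr_def distr_dbar_def)
    qed
    \<comment> \<open>\<open>mixed_fun\<close> is an arbitrary choice: existence of \<open>G\<close>
      shows that it represents the distribution, and uniqueness that it equals \<open>G\<close>
      almost everywhere.\<close>
    then have "is_function ?\<Omega> (mixed_distr ?f1 ?f2) (mixed_fun ?f1 ?f2)"
      unfolding mixed_fun_def by (rule someI[of "is_function ?\<Omega> (mixed_distr ?f1 ?f2)"])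
    from is_function_unique[OF open_disc_punctured_disc this mixed]
    have g: "AE w in lborel. w \<in> ?\<Omega> \<longrightarrow> mixed_fun ?f1 ?f2 w = G w" .
    define u where "u = cauchy_solution F1 F2 G"
    have u_int: "integrable lborel u"
      unfolding u_def by (rule integrable_cauchy_solution[OF int_F])
    then have [measurable]: "u \<in> borel_measurable borel" by (simp add: integrable_iff_bounded)
    have T_op: "AE z in lborel. z \<in> hartogs \<longrightarrow>
        T_converges_at ?f1 ?f2 (hartogs_map z) \<and> T_op ?f1 ?f2 (hartogs_map z) = u (hartogs_map z)"
      unfolding u_def
      by (rule AE_hartogs_map, rule T_op_eq_cauchy_solution) (fact int_F F_off f1 f2 g)+
    \<comment> \<open>A Borel representative of the solution, zero off the Hartogs triangle.\<close>
    define V where "V z = indicator hartogs z *\<^sub>R u (hartogs_map z)" for z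
    have V: "V \<in> borel_measurable borel" unfolding V_def[abs_def] by measurable
    note [measurable] = V
    have V_off: "V z = 0" if "z \<notin> hartogs" for z using that by (simp add: V_def)
    define v where "v = T_op ?f1 ?f2 \<circ> hartogs_map"
    have vV: "AE z in lborel. z \<in> hartogs \<longrightarrow> v z = V z"
      using T_op by eventually_elim (simp add: v_def V_def)
    \<comment> \<open>On the domain the Jacobian is at most 1, so passing back to the Hartogs
      triangle does not increase the integral.\<close>
    have "?I V \<le> ?I u"
    proof -
      have "?I V = (\<integral>\<^sup>+z. indicator hartogs z * ennreal (cmod (u (hartogs_map z)) powr p) \<partial>lborel)"
        by (intro nn_integral_cong) (auto simp: V_def indicator_def)
      also have "\<dots> = (\<integral>\<^sup>+w. ennreal (hartogs_jacobian w) * ennreal (cmod (u (hartogs_map (hartogs_param w))) powr p) \<partial>lborel)"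
        by (rule nn_integral_hartogs) measurable
      also have "\<dots> \<le> ?I u"
      proof (rule nn_integral_mono)
        fix w
        show "ennreal (hartogs_jacobian w) * ennreal (cmod (u (hartogs_map (hartogs_param w))) powr p)
            \<le> ennreal (cmod (u w) powr p)"
        proof (cases "w \<in> ?\<Omega>")
          case True
          then have "hartogs_map (hartogs_param w) = w" by (intro hartogs_map_param) auto
          moreover have "hartogs_jacobian w \<le> 1"
            using True fst_snd_le[OF True] by (simp add: hartogs_jacobian_def power_le_one)
          ultimately show ?thesis
            using hartogs_jacobian_simps(1)[of w]
            by (simp add: ennreal_mult[symmetric] ennreal_leI mult_left_le_one_le)
        next
          case False
          then show ?thesis using hartogs_jacobian_simps(3)[of w] by simp
        qed
      qed
      finally show ?thesis .
    qed
    also have "\<dots> \<le> ennreal C0 * (?I F1 + ?I F2 + ?I G)"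
      unfolding u_def by (rule C0(2)[OF F_meas])
    also have "\<dots> \<le> ennreal C0 * (ennreal (3 powr p) * S + ennreal (3 powr p) * S + ennreal (3 powr p) * S)"
      by (intro mult_left_mono add_mono IF) simp
    also have "\<dots> = ennreal (D * T powr p)"
      using C0(1) unfolding S_def D_def
      by (simp add: ennreal_mult[symmetric] ennreal_plus[symmetric] algebra_simps del: ennreal_plus)
    finally have V_le: "?I V \<le> ennreal (D * T powr p)" .
    have V_int: "integrable lborel V"
    proof (rule integrable_if_Lp[OF V borel_measurable_hartogs bounded_hartogs _ assms])
      show "?I V < \<infinity>" using V_le by (rule le_less_trans) simp
    qed (rule V_off)
    have Vp: "(\<lambda>z. cmod (V z) powr p) \<in> borel_measurable borel" by measurable
    have Vp_int: "integrable lborel (\<lambda>z. cmod (V z) powr p)"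
    proof (rule integrableI_bounded)
      show "(\<integral>\<^sup>+z. ennreal (norm (cmod (V z) powr p)) \<partial>lborel) < \<infinity>"
        using le_less_trans[OF V_le] by simp
    qed (use Vp in simp)
    \<comment> \<open>The weight with exponent 0 equals 1 because the second coordinate is nonzero
      on the Hartogs triangle; the default value of \<open>0 powr 0\<close> would be 0.\<close>
    have v_p: "AE z in lborel. indicator hartogs z *\<^sub>R (cmod (v z) powr p * cmod (snd z) powr 0) = cmod (V z) powr p"
      using vV
    proof eventually_elim
      case (elim z)
      show ?case
      proof (cases "z \<in> hartogs")
        case True
        then have "snd z \<noteq> 0" by (auto simp: hartogs_def)
        then show ?thesis using elim True by simp
      qed (simp add: V_off)
    qed
    note v_p_eq = lebesgue_AE_eq_lborel(2,3)[OF v_p Vp]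
    have "(LINT z|lborel. cmod (V z) powr p) \<le> D * T powr p"
      using V_le D T(1) unfolding nn_integral_eq_integral[OF Vp_int AE_I2[OF powr_ge_zero]]
      by (subst (asm) ennreal_le_iff) auto
    then have "weighted_Lp_norm p 0 v \<le> (D * T powr p) powr (1 / p)"
      unfolding weighted_Lp_norm_def set_lebesgue_integral_def v_p_eq
      using assms by (intro powr_mono2 integral_nonneg_AE AE_I2) auto
    also have "\<dots> = D powr (1 / p) * T"
      using assms D T(1) by (simp add: powr_mult powr_powr)
    also have "\<dots> \<le> C * T" using T(1) by (intro mult_right_mono) (simp_all add: C_def)
    finally have norm: "weighted_Lp_norm p 0 v \<le> C * T" .
    have "AE z in lborel. indicator hartogs z *\<^sub>R v z = V z"
      using vV by eventually_elim (auto simp: indicator_def V_off)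
    from lebesgue_AE_eq_lborel(1)[OF this V] have v_Lp: "v \<in> weighted_Lp p 0"
      using Vp_int unfolding weighted_Lp_def set_borel_measurable_def set_integrable_def mem_Collect_eq v_p_eq by blast
    have weak_u: "(LINT w|lborel. u w * wirtinger_bar 1 \<psi> w) = - (LINT w|lborel. F1 w * \<psi> w)"
      "(LINT w|lborel. u w * wirtinger_bar 2 \<psi> w) = - (LINT w|lborel. F2 w * \<psi> w)"
      if "\<psi> \<in> test_functions ?\<Omega>" for \<psi>
      unfolding u_def
      by (rule cauchy_solution_weak; fact int_F F_off weakF1 weakF2 that)+
    note pulled_back = pulled_back_weak_solution[of a1 a2 u, folded V_def A1_def A2_def, folded F1_def F2_def, OF a1 a2]
    have weak_V: "(LINT z|lborel. V z * wirtinger_bar 1 \<psi> z) = - (LINT z|lborel. a1 z * \<psi> z)"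
      "(LINT z|lborel. V z * wirtinger_bar 2 \<psi> z) = - (LINT z|lborel. a2 z * \<psi> z)"
      if "\<psi> \<in> test_functions hartogs" for \<psi>
      by (rule pulled_back; fact a1_off a2_off int_AB u_int weak_u that)+
    have "weak_dbar_solution hartogs v \<alpha>1 \<alpha>2"
      unfolding weak_dbar_solution_def distr_eq_def distr_dbar_def
    proof (intro conjI ballI)
      show "locally_integrable hartogs v" by (rule locally_integrable_representative[OF vV V_int])
      fix \<psi> assume \<psi>: "\<psi> \<in> test_functions hartogs"
      show "- distr_of hartogs v (wirtinger_bar 1 \<psi>) = distr_of hartogs \<alpha>1 \<psi>"
        using repr[OF vV V wd[OF \<psi>] V_off] repr[OF a1_ae a1 \<psi> a1_off] weak_V(1)[OF \<psi>] by simp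
      show "- distr_of hartogs v (wirtinger_bar 2 \<psi>) = distr_of hartogs \<alpha>2 \<psi>"
        using repr[OF vV V wd[OF \<psi>] V_off] repr[OF a2_ae a2 \<psi> a2_off] weak_V(2)[OF \<psi>] by simp
    qed
    moreover have "mixed_is_function ?f1 ?f2" using mixed by (auto simp: mixed_is_function_def)
    moreover have "AE z in lebesgue. z \<in> hartogs \<longrightarrow> T_converges_at ?f1 ?f2 (hartogs_map z)"
      using T_op by (intro AE_completion) (auto elim: eventually_mono)
    ultimately show "let f1 = transport1 \<alpha>1; f2 = transport2 \<alpha>1 \<alpha>2; v = T_op f1 f2 \<circ> hartogs_map
       in mixed_is_function f1 f2 \<and>
          (AE z in lebesgue. z \<in> hartogs \<longrightarrow> T_converges_at f1 f2 (hartogs_map z)) \<and>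
          weak_dbar_solution hartogs v \<alpha>1 \<alpha>2 \<and>
          v \<in> weighted_Lp p 0 \<and>
          weighted_Lp_norm p 0 v
            \<le> C * ((weighted_Lp_norm p (-2) \<alpha>1 + weighted_Lp_norm p (-2) \<alpha>2)
                 + (weighted_Lp_norm p (-1) \<beta>1 + weighted_Lp_norm p (-1) \<beta>2))"
      using norm v_Lp unfolding Let_def v_def T_def by blast
  qed
qed

end
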